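(* Let $K$ be a field of characteristic $p\neq 2,3$. The weak Leibniz operad over $K$ is self-dual, i.e., its Koszul dual operad is equivalent (isomorphic as an operad) to the weak Leibniz operad. Moreover, the weak Leibniz operad is not Koszul.
   Context: Characteristic $p=0$ is allowed. An algebra over $K$ (a vector space with a bilinear product $ab$, no further axioms) is weak Leibniz if, with $[a,b]=ab-ba$, for all $a,b,c$: $$[a,b]c=2a(bc)-2b(ac),\qquad a[b,c]=2(ab)c-2(ac)b.$$ The weak Leibniz operad is the binary quadratic symmetric $K$-linear operad whose algebras are the weak Leibniz algebras: it is generated by one binary operation without symmetry (so the space $E$ of generators is the regular representation of the symmetric group $S_2$), modulo the operadic ideal generated by the two multilinear identities above. The Koszul dual is understood in the sense of Ginzburg and Kapranov: if $\mathcal P=\mathcal F(E)/(R)$ with $R\subseteq \mathcal F(E)(3)$, where $\mathcal F(E)$ is the free operad on $E$, then $\mathcal P^!=\mathcal F(E^\vee)/(R^\perp)$, where $E^\vee=E^*\otimes \mathrm{sgn}$ and $R^\perp$ is the annihilator of $R$ under the natural pairing $\mathcal F(E^\vee)(3)\otimes\mathcal F(E)(3)\to K$. Koszulness of a quadratic operad is also understood in the sense of Ginzburg and Kapranov. *)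

theory Defs
  imports "HOL-Library.FuncSet" "HOL-Library.Poly_Mapping"
begin

section \<open>Vector spaces with an explicit carrier\<close>

record ('k, 'x) vspace =
  vecs :: "'x set"
  vzero :: 'x
  vadd :: "'x \<Rightarrow> 'x \<Rightarrow> 'x"
  vscale :: "'k \<Rightarrow> 'x \<Rightarrow> 'x"

definition is_vspace :: "('k::field, 'x, 'm) vspace_scheme \<Rightarrow> bool" where
  "is_vspace V \<longleftrightarrow>
     vzero V \<in> vecs V \<and>
     (\<forall>x\<in>vecs V. \<forall>y\<in>vecs V. vadd V x y \<in> vecs V \<and> vadd V x y = vadd V y x) \<and>
     (\<forall>x\<in>vecs V. \<forall>y\<in>vecs V. \<forall>z\<in>vecs V.
        vadd V (vadd V x y) z = vadd V x (vadd V y z)) \<and>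
     (\<forall>x\<in>vecs V. vadd V (vzero V) x = x \<and> (\<exists>y\<in>vecs V. vadd V x y = vzero V)) \<and>
     (\<forall>c. \<forall>x\<in>vecs V. vscale V c x \<in> vecs V) \<and>
     (\<forall>c. \<forall>x\<in>vecs V. \<forall>y\<in>vecs V.
        vscale V c (vadd V x y) = vadd V (vscale V c x) (vscale V c y)) \<and>
     (\<forall>c d. \<forall>x\<in>vecs V. vscale V (c + d) x = vadd V (vscale V c x) (vscale V d x)) \<and>
     (\<forall>c d. \<forall>x\<in>vecs V. vscale V (c * d) x = vscale V c (vscale V d x)) \<and>
     (\<forall>x\<in>vecs V. vscale V 1 x = x)"

definition is_subspace :: "('k::field, 'x, 'm) vspace_scheme \<Rightarrow> 'x set \<Rightarrow> bool" where
  "is_subspace V W \<longleftrightarrow>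
     W \<subseteq> vecs V \<and> vzero V \<in> W \<and> (\<forall>x\<in>W. \<forall>y\<in>W. vadd V x y \<in> W) \<and>
     (\<forall>c. \<forall>x\<in>W. vscale V c x \<in> W)"

definition is_linear ::
    "('k::field, 'x, 'm) vspace_scheme \<Rightarrow> ('k, 'y, 'n) vspace_scheme \<Rightarrow> ('x \<Rightarrow> 'y) \<Rightarrow> bool" where
  "is_linear V W f \<longleftrightarrow>
     (\<forall>x\<in>vecs V. f x \<in> vecs W) \<and>
     (\<forall>x\<in>vecs V. \<forall>y\<in>vecs V. f (vadd V x y) = vadd W (f x) (f y)) \<and>
     (\<forall>c. \<forall>x\<in>vecs V. f (vscale V c x) = vscale W c (f x))"

definition scalars :: "('k::field, 'k) vspace" where
  "scalars = \<lparr>vecs = UNIV, vzero = 0, vadd = (+), vscale = (*)\<rparr>"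

definition vcoset :: "('k::field, 'x, 'm) vspace_scheme \<Rightarrow> 'x set \<Rightarrow> 'x \<Rightarrow> 'x set" where
  "vcoset V W x = vadd V x ` W"

definition vquot :: "('k::field, 'x, 'm) vspace_scheme \<Rightarrow> 'x set \<Rightarrow> ('k, 'x set) vspace" where
  "vquot V W =
     \<lparr>vecs = vcoset V W ` vecs V,
      vzero = vcoset V W (vzero V),
      vadd = (\<lambda>X Y. \<Union>x\<in>X. \<Union>y\<in>Y. vcoset V W (vadd V x y)),
      vscale = (\<lambda>c X. \<Union>x\<in>X. vcoset V W (vscale V c x))\<rparr>"

definition fscale :: "'k::field \<Rightarrow> ('a \<Rightarrow>\<^sub>0 'k) \<Rightarrow> ('a \<Rightarrow>\<^sub>0 'k)" where
  "fscale c v = Poly_Mapping.map (\<lambda>x. c * x) v"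

definition free_vspace :: "'a set \<Rightarrow> ('k::field, 'a \<Rightarrow>\<^sub>0 'k) vspace" where
  "free_vspace S =
     \<lparr>vecs = {v. Poly_Mapping.keys v \<subseteq> S}, vzero = 0, vadd = (+), vscale = fscale\<rparr>"

abbreviation basis :: "'a \<Rightarrow> ('a \<Rightarrow>\<^sub>0 'k::field)" where
  "basis t \<equiv> Poly_Mapping.single t 1"

definition lin_ext :: "('a \<Rightarrow> ('b \<Rightarrow>\<^sub>0 'k)) \<Rightarrow> ('a \<Rightarrow>\<^sub>0 'k::field) \<Rightarrow> ('b \<Rightarrow>\<^sub>0 'k)" where
  "lin_ext f v = (\<Sum>t\<in>Poly_Mapping.keys v. fscale (Poly_Mapping.lookup v t) (f t))"

section \<open>Symmetric operads\<close>

text \<open>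
  Operads are given in coordinate-free form, as functors on finite sets of inputs (here: finite
  sets of natural numbers) and bijections: the space of operations with input set \<open>I\<close> is
  \<open>space P I\<close>, and the usual \<open>P(n)\<close> with its action of the symmetric group is
  \<open>space P {1..n}\<close> with \<open>relabel\<close>. The operation \<open>compose P I a J x y\<close> is the partial
  composition that inserts \<open>y\<close> (with inputs \<open>J\<close>) into the input \<open>a\<close> of \<open>x\<close> (with inputs \<open>I\<close>);
  the result has inputs \<open>(I - {a}) \<union> J\<close>. It is meaningful only if \<open>I - {a}\<close> and \<open>J\<close> are disjoint.
\<close>

record ('k, 'x) operad =
  space :: "nat set \<Rightarrow> ('k, 'x) vspace"
  relabel :: "nat set \<Rightarrow> (nat \<Rightarrow> nat) \<Rightarrow> 'x \<Rightarrow> 'x"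
  compose :: "nat set \<Rightarrow> nat \<Rightarrow> nat set \<Rightarrow> 'x \<Rightarrow> 'x \<Rightarrow> 'x"
  unit :: "nat \<Rightarrow> 'x"

abbreviation ops :: "('k, 'x) operad \<Rightarrow> nat set \<Rightarrow> 'x set" where
  "ops P I \<equiv> vecs (space P I)"

definition composable :: "nat set \<Rightarrow> nat \<Rightarrow> nat set \<Rightarrow> bool" where
  "composable I a J \<longleftrightarrow> finite I \<and> finite J \<and> a \<in> I \<and> (I - {a}) \<inter> J = {}"

locale symmetric_operad =
  fixes P :: "('k::field, 'x) operad"
  assumes vspace: "finite I \<Longrightarrow> is_vspace (space P I)"
    and relabel_linear:
      "finite I \<Longrightarrow> inj_on f I \<Longrightarrow> is_linear (space P I) (space P (f ` I)) (relabel P I f)"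
    and relabel_cong:
      "finite I \<Longrightarrow> inj_on f I \<Longrightarrow> (\<And>i. i \<in> I \<Longrightarrow> f i = g i) \<Longrightarrow> x \<in> ops P I \<Longrightarrow>
       relabel P I f x = relabel P I g x"
    and relabel_id: "finite I \<Longrightarrow> x \<in> ops P I \<Longrightarrow> relabel P I id x = x"
    and relabel_relabel:
      "finite I \<Longrightarrow> inj_on f I \<Longrightarrow> inj_on g (f ` I) \<Longrightarrow> x \<in> ops P I \<Longrightarrow>
       relabel P (f ` I) g (relabel P I f x) = relabel P I (g \<circ> f) x"
    and compose_linear_left:
      "composable I a J \<Longrightarrow> y \<in> ops P J \<Longrightarrow>
       is_linear (space P I) (space P (I - {a} \<union> J)) (\<lambda>x. compose P I a J x y)"
    and compose_linear_right:
      "composable I a J \<Longrightarrow> x \<in> ops P I \<Longrightarrow>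
       is_linear (space P J) (space P (I - {a} \<union> J)) (compose P I a J x)"
    and unit_closed: "unit P a \<in> ops P {a}"
    and relabel_unit: "relabel P {a} f (unit P a) = unit P (f a)"
    and unit_left: "finite J \<Longrightarrow> y \<in> ops P J \<Longrightarrow> compose P {a} a J (unit P a) y = y"
    and unit_right:
      "composable I a {b} \<Longrightarrow> x \<in> ops P I \<Longrightarrow>
       compose P I a {b} x (unit P b) = relabel P I (id(a := b)) x"
    and compose_equivariant:
      "composable I a J \<Longrightarrow> composable (f ` I) (f a) (g ` J) \<Longrightarrow> inj_on f I \<Longrightarrow> inj_on g J \<Longrightarrow>
       x \<in> ops P I \<Longrightarrow> y \<in> ops P J \<Longrightarrow>
       compose P (f ` I) (f a) (g ` J) (relabel P I f x) (relabel P J g y) =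
       relabel P (I - {a} \<union> J) (\<lambda>i. if i \<in> J then g i else f i) (compose P I a J x y)"
    and compose_sequential:
      "composable I a J \<Longrightarrow> composable J b L \<Longrightarrow> (I - {a}) \<inter> L = {} \<Longrightarrow>
       x \<in> ops P I \<Longrightarrow> y \<in> ops P J \<Longrightarrow> z \<in> ops P L \<Longrightarrow>
       compose P (I - {a} \<union> J) b L (compose P I a J x y) z =
       compose P I a (J - {b} \<union> L) x (compose P J b L y z)"
    and compose_parallel:
      "composable I a J \<Longrightarrow> composable I b L \<Longrightarrow> a \<noteq> b \<Longrightarrow> J \<inter> L = {} \<Longrightarrow>
       x \<in> ops P I \<Longrightarrow> y \<in> ops P J \<Longrightarrow> z \<in> ops P L \<Longrightarrow>
       compose P (I - {a} \<union> J) b L (compose P I a J x y) z =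
       compose P (I - {b} \<union> L) a J (compose P I b L x z) y"

definition operad_iso ::
    "('k::field, 'x) operad \<Rightarrow> ('k, 'y) operad \<Rightarrow> (nat set \<Rightarrow> 'x \<Rightarrow> 'y) \<Rightarrow> bool" where
  "operad_iso P Q \<phi> \<longleftrightarrow>
     (\<forall>I. finite I \<longrightarrow> is_linear (space P I) (space Q I) (\<phi> I) \<and>
        bij_betw (\<phi> I) (ops P I) (ops Q I)) \<and>
     (\<forall>I f. \<forall>x\<in>ops P I. finite I \<and> inj_on f I \<longrightarrow>
        \<phi> (f ` I) (relabel P I f x) = relabel Q I f (\<phi> I x)) \<and>
     (\<forall>I a J. \<forall>x\<in>ops P I. \<forall>y\<in>ops P J. composable I a J \<longrightarrow>
        \<phi> (I - {a} \<union> J) (compose P I a J x y) = compose Q I a J (\<phi> I x) (\<phi> J y)) \<and>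
     (\<forall>a. \<phi> {a} (unit P a) = unit Q a)"

definition isomorphic_operads :: "('k::field, 'x) operad \<Rightarrow> ('k, 'y) operad \<Rightarrow> bool" where
  "isomorphic_operads P Q \<longleftrightarrow>
     symmetric_operad P \<and> symmetric_operad Q \<and> (\<exists>\<phi>. operad_iso P Q \<phi>)"

section \<open>Ideals and quotients\<close>

definition operad_ideal :: "('k::field, 'x) operad \<Rightarrow> (nat set \<Rightarrow> 'x set) \<Rightarrow> bool" where
  "operad_ideal P N \<longleftrightarrow>
     (\<forall>I. finite I \<longrightarrow> is_subspace (space P I) (N I)) \<and>
     (\<forall>I f. \<forall>x\<in>N I. finite I \<and> inj_on f I \<longrightarrow> relabel P I f x \<in> N (f ` I)) \<and>
     (\<forall>I a J. composable I a J \<longrightarrow>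
        (\<forall>x\<in>N I. \<forall>y\<in>ops P J. compose P I a J x y \<in> N (I - {a} \<union> J)) \<and>
        (\<forall>x\<in>ops P I. \<forall>y\<in>N J. compose P I a J x y \<in> N (I - {a} \<union> J)))"

definition ideal_generated ::
    "('k::field, 'x) operad \<Rightarrow> (nat set \<Rightarrow> 'x set) \<Rightarrow> nat set \<Rightarrow> 'x set" where
  "ideal_generated P S I =
     {x \<in> ops P I. \<forall>N. operad_ideal P N \<and> (\<forall>J. S J \<subseteq> N J) \<longrightarrow> x \<in> N I}"

definition quotient_operad ::
    "('k::field, 'x) operad \<Rightarrow> (nat set \<Rightarrow> 'x set) \<Rightarrow> ('k, 'x set) operad" where
  "quotient_operad P N =
     \<lparr>space = (\<lambda>I. vquot (space P I) (N I)),
      relabel = (\<lambda>I f X. \<Union>x\<in>X. vcoset (space P (f ` I)) (N (f ` I)) (relabel P I f x)),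
      compose = (\<lambda>I a J X Y. \<Union>x\<in>X. \<Union>y\<in>Y.
        vcoset (space P (I - {a} \<union> J)) (N (I - {a} \<union> J)) (compose P I a J x y)),
      unit = (\<lambda>a. vcoset (space P {a}) (N {a}) (unit P a))\<rparr>"

section \<open>The free operad on a space of binary operations\<close>

text \<open>Representations of the symmetric group \<open>S\<^sub>2\<close>; \<open>swap\<close> is the action of the transposition.\<close>

record ('k, 'e) s2_module = "('k, 'e) vspace" +
  swap :: "'e \<Rightarrow> 'e"

datatype (labels: 'e, leaves: 'l) btree =
  Leaf 'l
| Node 'e "('e, 'l) btree" "('e, 'l) btree"

primrec multilinear_tree :: "('e, 'l) btree \<Rightarrow> bool" where
  "multilinear_tree (Leaf i) \<longleftrightarrow> True"
| "multilinear_tree (Node e s t) \<longleftrightarrow>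
     multilinear_tree s \<and> multilinear_tree t \<and> leaves s \<inter> leaves t = {}"

definition trees :: "'e set \<Rightarrow> nat set \<Rightarrow> ('e, nat) btree set" where
  "trees X I = {t. multilinear_tree t \<and> leaves t = I \<and> labels t \<subseteq> X}"

primrec graft :: "'l \<Rightarrow> ('e, 'l) btree \<Rightarrow> ('e, 'l) btree \<Rightarrow> ('e, 'l) btree" where
  "graft a u (Leaf i) = (if i = a then u else Leaf i)"
| "graft a u (Node e s t) = Node e (graft a u s) (graft a u t)"

text \<open>The free operad on a mere set \<open>X\<close> of binary operations without symmetry.\<close>

definition tree_operad :: "'e set \<Rightarrow> ('k::field, ('e, nat) btree \<Rightarrow>\<^sub>0 'k) operad" where
  "tree_operad X =
     \<lparr>space = (\<lambda>I. free_vspace (trees X I)),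
      relabel = (\<lambda>I f. lin_ext (\<lambda>t. basis (map_btree id f t))),
      compose = (\<lambda>I a J v w. lin_ext (\<lambda>s. lin_ext (\<lambda>t. basis (graft a t s)) w) v),
      unit = (\<lambda>a. basis (Leaf a))\<rparr>"

text \<open>
  The free operad \<open>\<F>(E)\<close> on an \<open>S\<^sub>2\<close>-module \<open>E\<close> is obtained from the free operad on the underlying
  set of \<open>E\<close> by making the labels of vertices linear and identifying \<open>(\<sigma>e)(a,b)\<close> with \<open>e(b,a)\<close>.
\<close>

definition free_relations ::
    "('k::field, 'e) s2_module \<Rightarrow> nat set \<Rightarrow> (('e, nat) btree \<Rightarrow>\<^sub>0 'k) set" where
  "free_relations E I =
     (\<Union>(a, b)\<in>{(a, b). a \<noteq> b \<and> I = {a, b}}.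
        (let c = (\<lambda>e. Node e (Leaf a) (Leaf b)); d = (\<lambda>e. Node e (Leaf b) (Leaf a)) in
         {basis (c (vadd E e f)) - basis (c e) - basis (c f) |e f. e \<in> vecs E \<and> f \<in> vecs E} \<union>
         {basis (c (vscale E k e)) - fscale k (basis (c e)) |k e. e \<in> vecs E} \<union>
         {basis (c (swap E e)) - basis (d e) |e. e \<in> vecs E}))"

abbreviation free_kernel ::
    "('k::field, 'e) s2_module \<Rightarrow> nat set \<Rightarrow> (('e, nat) btree \<Rightarrow>\<^sub>0 'k) set" where
  "free_kernel E \<equiv> ideal_generated (tree_operad (vecs E)) (free_relations E)"

definition free_operad ::
    "('k::field, 'e) s2_module \<Rightarrow> ('k, (('e, nat) btree \<Rightarrow>\<^sub>0 'k) set) operad" where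
  "free_operad E = quotient_operad (tree_operad (vecs E)) (free_kernel E)"

text \<open>The element of \<open>\<F>(E)(I)\<close> represented by a linear combination of labelled trees.\<close>

definition free_class ::
    "('k::field, 'e) s2_module \<Rightarrow> nat set \<Rightarrow> (('e, nat) btree \<Rightarrow>\<^sub>0 'k) \<Rightarrow>
     (('e, nat) btree \<Rightarrow>\<^sub>0 'k) set" where
  "free_class E I v = vcoset (space (tree_operad (vecs E)) I) (free_kernel E I) v"

section \<open>Binary quadratic operads and Koszul duality\<close>

text \<open>Generators \<open>E\<close> and relations \<open>R \<subseteq> \<F>(E)(3)\<close>.\<close>

record (overloaded) ('k, 'e) quadratic_data =
  gens :: "('k, 'e) s2_module"
  rels :: "(('e, nat) btree \<Rightarrow>\<^sub>0 'k) set set"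

definition quadratic_operad ::
    "('k::field, 'e) quadratic_data \<Rightarrow> ('k, (('e, nat) btree \<Rightarrow>\<^sub>0 'k) set set) operad" where
  "quadratic_operad D =
     quotient_operad (free_operad (gens D))
       (ideal_generated (free_operad (gens D)) (\<lambda>I. if I = {1, 2, 3} then rels D else {}))"

text \<open>\<open>E\<^sup>* \<otimes> sgn\<close>; functionals are extended by zero outside of the carrier of \<open>E\<close>.\<close>

definition sgn_dual :: "('k::field, 'e) s2_module \<Rightarrow> ('k, 'e \<Rightarrow> 'k) s2_module" where
  "sgn_dual E =
     \<lparr>vecs = {\<phi>. is_linear E scalars \<phi> \<and> (\<forall>e. e \<notin> vecs E \<longrightarrow> \<phi> e = 0)},
      vzero = (\<lambda>e. 0),
      vadd = (\<lambda>\<phi> \<psi> e. \<phi> e + \<psi> e),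
      vscale = (\<lambda>c \<phi> e. c * \<phi> e),
      swap = (\<lambda>\<phi> e. if e \<in> vecs E then - \<phi> (swap E e) else 0)\<rparr>"

text \<open>
  Every tree with three leaves equals in \<open>\<F>(E)\<close> a left comb \<open>e(f(i,j),k)\<close>;
  \<open>left_comb\<close> returns the tuple \<open>(e,f,i,j,k)\<close>.
\<close>

fun left_comb :: "('k, 'e) s2_module \<Rightarrow> ('e, nat) btree \<Rightarrow> 'e \<times> 'e \<times> nat \<times> nat \<times> nat" where
  "left_comb E (Node e (Node f (Leaf i) (Leaf j)) (Leaf k)) = (e, f, i, j, k)"
| "left_comb E (Node e (Leaf k) (Node f (Leaf i) (Leaf j))) = (swap E e, f, i, j, k)"
| "left_comb E t = undefined"

text \<open>
  The natural pairing of \<open>\<F>(E\<^sup>* \<otimes> sgn)(3)\<close> with \<open>\<F>(E)(3)\<close>. The three isomorphism types of binary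
  trees with leaves \<open>1, 2, 3\<close>, distinguished by the leaf \<open>k\<close> next to the root, are orthogonal to
  each other; on the tree of type \<open>k = 3\<close> it is
  \<open>\<langle>\<alpha>(\<beta>(1,2),3), e(f(1,2),3)\<rangle> = \<alpha>(e) \<beta>(f)\<close>, and it is extended to the other types by
  \<open>\<langle>\<tau>x, \<tau>y\<rangle> = sgn(\<tau>) \<langle>x, y\<rangle>\<close>.
\<close>

definition tree_pairing ::
    "('k::field, 'e) s2_module \<Rightarrow> ('e \<Rightarrow> 'k, nat) btree \<Rightarrow> ('e, nat) btree \<Rightarrow> 'k" where
  "tree_pairing E s t =
     (case left_comb (sgn_dual E) s of (\<alpha>, \<beta>, i, j, k) \<Rightarrow>
      case left_comb E t of (e, f, i', j', k') \<Rightarrow>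
        if k \<noteq> k' then 0
        else (if (i, j, k) \<in> {(1, 2, 3), (2, 3, 1), (3, 1, 2)} then 1 else - 1) *
          \<alpha> e * \<beta> (if i = i' then f else swap E f))"

definition natural_pairing ::
    "('k::field, 'e) s2_module \<Rightarrow> (('e \<Rightarrow> 'k, nat) btree \<Rightarrow>\<^sub>0 'k) set \<Rightarrow>
     (('e, nat) btree \<Rightarrow>\<^sub>0 'k) set \<Rightarrow> 'k" where
  "natural_pairing E X Y =
     (THE c. \<forall>v\<in>X. \<forall>w\<in>Y.
        c = (\<Sum>s\<in>Poly_Mapping.keys v. \<Sum>t\<in>Poly_Mapping.keys w.
               Poly_Mapping.lookup v s * Poly_Mapping.lookup w t * tree_pairing E s t))"

definition koszul_dual :: "('k::field, 'e) quadratic_data \<Rightarrow> ('k, 'e \<Rightarrow> 'k) quadratic_data" where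
  "koszul_dual D =
     \<lparr>gens = sgn_dual (gens D),
      rels = {X \<in> ops (free_operad (sgn_dual (gens D))) {1, 2, 3}.
                \<forall>Y\<in>rels D. natural_pairing (gens D) X Y = 0}\<rparr>"

section \<open>The dual complex and Koszulness\<close>

text \<open>
  A reduced tree with leaves \<open>{1..n}\<close> (every vertex has at least two inputs) is encoded by its set of
  internal edges, an edge being identified with the set of leaves above it; these are the families of
  proper subsets of \<open>{1..n}\<close> with at least two elements that are pairwise nested or disjoint.
  Equivalently, a vertex is identified with the set of leaves above it, and the root is \<open>{1..n}\<close>.
  The edges are given as a list, because the determinant of the set of edges enters the complex.
\<close>

definition edge_list :: "nat \<Rightarrow> nat set list \<Rightarrow> bool" where
  "edge_list n es \<longleftrightarrow> distinct es \<and>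
     (\<forall>A\<in>set es. A \<subset> {1..n} \<and> card A \<ge> 2) \<and>
     (\<forall>A\<in>set es. \<forall>B\<in>set es. A \<subseteq> B \<or> B \<subseteq> A \<or> A \<inter> B = {})"

definition vertices :: "nat \<Rightarrow> nat set list \<Rightarrow> nat set set" where
  "vertices n es = insert {1..n} (set es)"

text \<open>
  The inputs of the vertex \<open>A\<close> are the maximal edges or leaves strictly above it. As elements of the
  input set of an operation they are represented by their least leaf.
\<close>

definition inputs :: "nat set list \<Rightarrow> nat set \<Rightarrow> nat set" where
  "inputs es A =
     (let above = {C. C \<subset> A \<and> (C \<in> set es \<or> (\<exists>i\<in>A. C = {i}))}
      in Min ` {C \<in> above. \<not> (\<exists>D\<in>above. C \<subset> D)})"

definition decorations :: "('k::field, 'x) operad \<Rightarrow> nat \<Rightarrow> nat set list \<Rightarrow> (nat set \<Rightarrow> 'x) set" where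
  "decorations P n es = (\<Pi>\<^sub>E A\<in>vertices n es. ops P (inputs es A))"

text \<open>
  The space of degree \<open>k\<close> is the sum over all trees \<open>T\<close> with \<open>k\<close> internal edges of
  \<open>P(T)\<^sup>* \<otimes> Det(T)\<close>. Here \<open>P(T)\<close> is the tensor product of the spaces of operations at the vertices,
  so that elements of \<open>P(T)\<^sup>*\<close> are multilinear forms in the decorations of the vertices, and tensoring
  with the top exterior power \<open>Det(T)\<close> of the space spanned by the internal edges amounts
  to considering alternating functions of the orderings of these edges.
\<close>

definition cochains ::
    "('k::field, 'x) operad \<Rightarrow> nat \<Rightarrow> nat \<Rightarrow> (nat set list \<Rightarrow> (nat set \<Rightarrow> 'x) \<Rightarrow> 'k) set" where
  "cochains P n k = {\<phi>.
     (\<forall>es x. \<not> (edge_list n es \<and> length es = k \<and> x \<in> decorations P n es) \<longrightarrow> \<phi> es x = 0) \<and>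
     (\<forall>es. edge_list n es \<and> length es = k \<longrightarrow>
        (\<forall>x\<in>decorations P n es.
           (\<forall>A\<in>vertices n es.
              is_linear (space P (inputs es A)) scalars (\<lambda>u. \<phi> es (x(A := u)))) \<and>
           (\<forall>i j. i < j \<and> j < k \<longrightarrow> \<phi> (es[i := es ! j, j := es ! i]) x = - \<phi> es x)))}"

text \<open>Contraction of the edge \<open>A\<close>, whose lower end is the least vertex strictly containing \<open>A\<close>.\<close>

definition contract ::
    "('k::field, 'x) operad \<Rightarrow> nat \<Rightarrow> nat set list \<Rightarrow> nat set \<Rightarrow> (nat set \<Rightarrow> 'x) \<Rightarrow> (nat set \<Rightarrow> 'x)" where
  "contract P n es A x =
     (let B = \<Inter>{C \<in> vertices n es. A \<subset> C}
      in restrict (x(B := compose P (inputs es B) (Min A) (inputs es A) (x B) (x A)))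
           (vertices n es - {A}))"

definition coboundary ::
    "('k::field, 'x) operad \<Rightarrow> nat \<Rightarrow> nat \<Rightarrow> (nat set list \<Rightarrow> (nat set \<Rightarrow> 'x) \<Rightarrow> 'k) \<Rightarrow>
     nat set list \<Rightarrow> (nat set \<Rightarrow> 'x) \<Rightarrow> 'k" where
  "coboundary P n k \<phi> es x =
     (if edge_list n es \<and> length es = Suc k \<and> x \<in> decorations P n es
      then \<Sum>i\<le>k. (- 1) ^ i * \<phi> (take i es @ drop (Suc i) es) (contract P n es (es ! i) x)
      else 0)"

text \<open>
  The complex \<open>D(P)(n)\<close> of Ginzburg and Kapranov, up to the twist by a one-dimensional space, is
  \<open>cochains P n 0 \<rightarrow> \<dots> \<rightarrow> cochains P n (n - 2)\<close>. A quadratic operad \<open>P\<close> is Koszul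
  if the canonical morphism \<open>D(P) \<rightarrow> P\<^sup>!\<close> is a quasi-isomorphism, i.e. if each of these complexes
  is exact everywhere but at the right end.
\<close>

definition koszul :: "('k::field, 'x) operad \<Rightarrow> bool" where
  "koszul P \<longleftrightarrow>
     (\<forall>n\<ge>2. \<forall>k<n - 2. \<forall>\<phi>\<in>cochains P n k.
        coboundary P n k \<phi> = (\<lambda>es x. 0) \<longrightarrow>
        (if k = 0 then \<phi> = (\<lambda>es x. 0)
         else \<exists>\<psi>\<in>cochains P n (k - 1). \<phi> = coboundary P n (k - 1) \<psi>))"

section \<open>The weak Leibniz operad\<close>

text \<open>The pair \<open>(\<alpha>, \<beta>)\<close> stands for the operation \<open>\<alpha> ab + \<beta> ba\<close>.\<close>

definition regular_s2 :: "('k::field, 'k \<times> 'k) s2_module" where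
  "regular_s2 =
     \<lparr>vecs = UNIV, vzero = (0, 0),
      vadd = (\<lambda>u v. (fst u + fst v, snd u + snd v)),
      vscale = (\<lambda>c u. (c * fst u, c * snd u)),
      swap = (\<lambda>u. (snd u, fst u))\<rparr>"

definition times_tree ::
    "('k::field \<times> 'k, nat) btree \<Rightarrow> ('k \<times> 'k, nat) btree \<Rightarrow> ('k \<times> 'k, nat) btree"
    (infixl \<open>\<star>\<close> 75) where
  "s \<star> t = Node (1, 0) s t"

definition left_identity :: "('k::field \<times> 'k, nat) btree \<Rightarrow>\<^sub>0 'k" where
  "left_identity =
     (let a = Leaf 1; b = Leaf 2; c = Leaf 3 in
      basis ((a \<star> b) \<star> c) - basis ((b \<star> a) \<star> c)
      - fscale 2 (basis (a \<star> (b \<star> c))) + fscale 2 (basis (b \<star> (a \<star> c))))"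

definition right_identity :: "('k::field \<times> 'k, nat) btree \<Rightarrow>\<^sub>0 'k" where
  "right_identity =
     (let a = Leaf 1; b = Leaf 2; c = Leaf 3 in
      basis (a \<star> (b \<star> c)) - basis (a \<star> (c \<star> b))
      - fscale 2 (basis ((a \<star> b) \<star> c)) + fscale 2 (basis ((a \<star> c) \<star> b)))"

definition weak_leibniz :: "('k::field, 'k \<times> 'k) quadratic_data" where
  "weak_leibniz =
     \<lparr>gens = regular_s2,
      rels = ideal_generated (free_operad regular_s2)
        (\<lambda>I. if I = {1, 2, 3}
             then free_class regular_s2 I ` {left_identity, right_identity} else {})
        {1, 2, 3}\<rparr>"

abbreviation weak_leibniz_operad ::
    "('k::field, (('k \<times> 'k, nat) btree \<Rightarrow>\<^sub>0 'k) set set) operad" where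
  "weak_leibniz_operad \<equiv> quadratic_operad weak_leibniz"

end

theory Submission
  imports Defs "HOL-Computational_Algebra.Polynomial"
begin

text \<open>
  Put \<open>{a,b} = ab + ba\<close> and \<open>[a,b] = ab - ba\<close>. The weak Leibniz identities say that \<open>{a,b}\<close> is
  associative and that \<open>2 {[a,b],c} = [a,{b,c}] - [b,{a,c}]\<close>, together with their consequences
  (transposed Poisson algebras). Evaluating trees in the weak Leibniz algebra of functions of one
  variable with the product \<open>ab + \<epsilon> (a b' - a' b)\<close> shows that no further relations hold in arity
  three; it follows that the space of relations is its own annihilator under the identification
  \<open>(\<alpha>, \<beta>) \<mapsto> (\<alpha>, - \<beta>)\<close> of the generators with their twisted dual, which gives self-duality.

  For the second claim, the parts of degree zero and one in \<open>\<epsilon>\<close> of the evaluation give a cocycle with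
  two internal edges in arity five. A coboundary vanishes on every cycle of decorated trees in
  which neighbours have a common contraction. The relation \<open>{t, D(x;y,z)} = D(x;{y,t},z)\<close> for
  \<open>D(x;y,z) = [y,{x,z}] + [z,{x,y}]\<close> yields a cycle of length five, on which the cocycle takes the
  value \<open>32\<close> up to sign.
\<close>

section \<open>Vector spaces and quotients\<close>

text \<open>The operad is a quotient by a generated ideal, so the obstacle is to show that something
  is nonzero in it. Evaluation annihilates the whole ideal and bounds it from above; explicit
  combinations of the identities bound it from below. In arity three the bounds meet. In arity five
  it is enough that one functional is well defined and that the links of one cycle are valid
  relations.

  For the duality, let p and r be the coefficients at the combs (ij)k and i(jk). The relations say
  that p + 2r is antisymmetric in i, j and 2p + r in j, k, and three times the pairing is a signed
  sum of products of these quantities, which cancels. The change of coordinates has determinant -3,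
  and evaluation yields the antisymmetry up to a factor 2: hence the excluded characteristics.

  In functions D(x;y,z) is 8 \<epsilon> x' y z. As y is not differentiated, a factor t can be moved
  into it; as D has no constant part, the cocycle vanishes on three of the five trees. The value is
  32 = 2 * 2 * 8, from two symmetrised products and one D.\<close>

locale vector_space_on =
  fixes V :: "('k::field, 'x, 'm) vspace_scheme"
  assumes is_vspace: "is_vspace V"
begin

lemma zero_closed [simp]: "vzero V \<in> vecs V"
  using is_vspace unfolding is_vspace_def by blast

lemma add_closed [simp]: "x \<in> vecs V \<Longrightarrow> y \<in> vecs V \<Longrightarrow> vadd V x y \<in> vecs V"
  using is_vspace unfolding is_vspace_def by blast

lemma scale_closed [simp]: "x \<in> vecs V \<Longrightarrow> vscale V c x \<in> vecs V"
  using is_vspace unfolding is_vspace_def by blast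

lemma add_commute: "x \<in> vecs V \<Longrightarrow> y \<in> vecs V \<Longrightarrow> vadd V x y = vadd V y x"
  using is_vspace unfolding is_vspace_def by blast

lemma add_assoc: "x \<in> vecs V \<Longrightarrow> y \<in> vecs V \<Longrightarrow> z \<in> vecs V \<Longrightarrow>
    vadd V (vadd V x y) z = vadd V x (vadd V y z)"
  using is_vspace unfolding is_vspace_def by blast

lemma zero_add [simp]: "x \<in> vecs V \<Longrightarrow> vadd V (vzero V) x = x"
  using is_vspace unfolding is_vspace_def by blast

lemma add_zero [simp]: "x \<in> vecs V \<Longrightarrow> vadd V x (vzero V) = x"
  using add_commute[of x "vzero V"] by simp

lemma scale_add: "x \<in> vecs V \<Longrightarrow> y \<in> vecs V \<Longrightarrow>
    vscale V c (vadd V x y) = vadd V (vscale V c x) (vscale V c y)"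
  using is_vspace unfolding is_vspace_def by blast

lemma add_scale: "x \<in> vecs V \<Longrightarrow> vscale V (c + d) x = vadd V (vscale V c x) (vscale V d x)"
  using is_vspace unfolding is_vspace_def by blast

lemma scale_scale: "x \<in> vecs V \<Longrightarrow> vscale V (c * d) x = vscale V c (vscale V d x)"
  using is_vspace unfolding is_vspace_def by blast

lemma scale_one [simp]: "x \<in> vecs V \<Longrightarrow> vscale V 1 x = x"
  using is_vspace unfolding is_vspace_def by blast

lemma add_left_commute: "x \<in> vecs V \<Longrightarrow> y \<in> vecs V \<Longrightarrow> z \<in> vecs V \<Longrightarrow>
    vadd V x (vadd V y z) = vadd V y (vadd V x z)"
  by (metis add_assoc add_commute)

lemma ex_neg: "x \<in> vecs V \<Longrightarrow> \<exists>y\<in>vecs V. vadd V x y = vzero V"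
  using is_vspace unfolding is_vspace_def by blast

lemma idempotent_zero:
  assumes "x \<in> vecs V" "vadd V x x = x"
  shows "x = vzero V"
proof -
  obtain y where y: "y \<in> vecs V" "vadd V x y = vzero V"
    using ex_neg assms by blast
  then show ?thesis using add_assoc[of x x y] assms by simp
qed

lemma scale_zero_left [simp]: "x \<in> vecs V \<Longrightarrow> vscale V 0 x = vzero V"
  using add_scale[of x 0 0] by (intro idempotent_zero) simp_all

lemma scale_zero_right [simp]: "vscale V c (vzero V) = vzero V"
  using scale_add[of "vzero V" "vzero V" c] by (intro idempotent_zero) simp_all

lemma add_neg [simp]: "x \<in> vecs V \<Longrightarrow> vadd V x (vscale V (- 1) x) = vzero V"
  using add_scale[of x 1 "- 1"] by simp

lemma neg_add_cancel [simp]: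
  "x \<in> vecs V \<Longrightarrow> y \<in> vecs V \<Longrightarrow> vadd V x (vadd V (vscale V (- 1) x) y) = y"
  using add_assoc[of x "vscale V (- 1) x" y] by simp

end

locale subspace_on = vector_space_on V for V :: "('k::field, 'x, 'm) vspace_scheme" +
  fixes W :: "'x set"
  assumes is_subspace: "is_subspace V W"
begin

lemma mem_vecs: "w \<in> W \<Longrightarrow> w \<in> vecs V"
  using is_subspace unfolding is_subspace_def by blast

lemma zero_mem [simp]: "vzero V \<in> W"
  using is_subspace unfolding is_subspace_def by blast

lemma add_mem [simp]: "v \<in> W \<Longrightarrow> w \<in> W \<Longrightarrow> vadd V v w \<in> W"
  using is_subspace unfolding is_subspace_def by blast

lemma scale_mem [simp]: "w \<in> W \<Longrightarrow> vscale V c w \<in> W"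
  using is_subspace unfolding is_subspace_def by blast

abbreviation coset where "coset \<equiv> vcoset V W"

lemma coset_subset: "x \<in> vecs V \<Longrightarrow> coset x \<subseteq> vecs V"
  unfolding vcoset_def using mem_vecs by auto

lemma mem_coset: "x \<in> vecs V \<Longrightarrow> x \<in> coset x"
  unfolding vcoset_def by (rule image_eqI[of _ _ "vzero V"]) simp_all

lemma coset_add_mem:
  assumes "x \<in> vecs V" "w \<in> W"
  shows "coset (vadd V x w) = coset x"
proof -
  have "vadd V (vadd V x w) w' = vadd V x (vadd V w w')" if "w' \<in> W" for w'
    using that assms mem_vecs by (simp add: add_assoc)
  moreover have "w' \<in> (\<lambda>w'. vadd V w w') ` W" if "w' \<in> W" for w'
    using that assms mem_vecs
    by (intro image_eqI[of _ _ "vadd V (vscale V (- 1) w) w'"]) simp_all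
  ultimately show ?thesis
    unfolding vcoset_def using assms by (auto simp: image_iff)
qed

lemma coset_eq: "x \<in> vecs V \<Longrightarrow> y \<in> coset x \<Longrightarrow> coset y = coset x"
proof -
  assume *: "x \<in> vecs V" "y \<in> coset x"
  then obtain w where "w \<in> W" "y = vadd V x w" by (auto simp: vcoset_def)
  with * show ?thesis by (simp add: coset_add_mem)
qed

lemma coset_eq_iff: "x \<in> vecs V \<Longrightarrow> y \<in> vecs V \<Longrightarrow> coset y = coset x \<longleftrightarrow> y \<in> coset x"
  using coset_eq mem_coset by blast

lemma coset_eq_zero_iff: "x \<in> vecs V \<Longrightarrow> coset x = coset (vzero V) \<longleftrightarrow> x \<in> W"
  using coset_eq_iff[of "vzero V" x] mem_vecs by (auto simp: vcoset_def image_iff)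

lemma vecs_vquot: "vecs (vquot V W) = coset ` vecs V"
  by (simp add: vquot_def)

lemma vzero_vquot: "vzero (vquot V W) = coset (vzero V)"
  by (simp add: vquot_def)

text \<open>The operations of \<open>vquot\<close> and \<open>quotient_operad\<close> are unions
  over all representatives. Once the set does not depend on the representative, such a union
  collapses, because a coset is nonempty.\<close>

lemma UN_coset_const:
  assumes "x \<in> vecs V" "\<And>x'. x' \<in> coset x \<Longrightarrow> f x' = A"
  shows "(\<Union>x'\<in>coset x. f x') = A"
  using assms mem_coset by blast

lemma vadd_vquot:
  assumes "x \<in> vecs V" "y \<in> vecs V"
  shows "vadd (vquot V W) (coset x) (coset y) = coset (vadd V x y)"
proof -
  have "coset (vadd V x' y') = coset (vadd V x y)" if xy: "x' \<in> coset x" "y' \<in> coset y" for x' y'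
  proof -
    obtain v w where "v \<in> W" "w \<in> W" "x' = vadd V x v" "y' = vadd V y w"
      using xy by (auto simp: vcoset_def)
    moreover from this have "vadd V x' y' = vadd V (vadd V x y) (vadd V v w)"
      using assms mem_vecs by (simp add: add_assoc add_left_commute[of v y w])
    ultimately show ?thesis using assms by (simp add: coset_add_mem)
  qed
  then have "(\<Union>x'\<in>coset x. \<Union>y'\<in>coset y. coset (vadd V x' y')) = coset (vadd V x y)"
    using assms by (intro UN_coset_const) simp_all
  then show ?thesis by (simp add: vquot_def)
qed

lemma vscale_vquot:
  assumes "x \<in> vecs V"
  shows "vscale (vquot V W) c (coset x) = coset (vscale V c x)"
proof -
  have "coset (vscale V c x') = coset (vscale V c x)" if x': "x' \<in> coset x" for x'
  proof -
    obtain v where "v \<in> W" "x' = vadd V x v"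
      using x' by (auto simp: vcoset_def)
    then show ?thesis using assms mem_vecs by (simp add: scale_add coset_add_mem)
  qed
  then have "(\<Union>x'\<in>coset x. coset (vscale V c x')) = coset (vscale V c x)"
    using assms by (intro UN_coset_const) simp_all
  then show ?thesis by (simp add: vquot_def)
qed

lemma is_vspace_vquot: "is_vspace (vquot V W)"
  unfolding is_vspace_def vecs_vquot vzero_vquot
proof (intro conjI ballI allI; (elim imageE)?)
  show "\<exists>Y\<in>coset ` vecs V. vadd (vquot V W) X Y = coset (vzero V)"
    if "x \<in> vecs V" "X = coset x" for X x
    using that by (intro bexI[of _ "coset (vscale V (- 1) x)"]) (simp_all add: vadd_vquot)
qed (simp_all add: vadd_vquot vscale_vquot add_assoc scale_add add_scale scale_scale, metis add_commute)

lemma linear_coset: "is_linear V (vquot V W) coset"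
  by (simp add: is_linear_def vecs_vquot vadd_vquot vscale_vquot)

lemma linear_from_vquot:
  assumes f: "is_linear V U f" and F: "\<And>x. x \<in> vecs V \<Longrightarrow> F (coset x) = f x"
  shows "is_linear (vquot V W) U F"
  using f by (auto simp: is_linear_def vecs_vquot vadd_vquot vscale_vquot F)

end

lemma linear_comp:
  "is_linear U V f \<Longrightarrow> is_linear V W g \<Longrightarrow> is_linear U W (\<lambda>x. g (f x))"
  by (simp add: is_linear_def)

lemma linear_cong:
  "is_linear V W f \<Longrightarrow> is_vspace V \<Longrightarrow> (\<And>x. x \<in> vecs V \<Longrightarrow> f x = g x) \<Longrightarrow> is_linear V W g"
  by (auto simp: is_linear_def is_vspace_def)

lemma linear_zero:
  assumes "is_vspace V" "is_vspace W" "is_linear V W f"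
  shows "f (vzero V) = vzero W"
proof -
  interpret V: vector_space_on V by standard fact
  interpret W: vector_space_on W by standard fact
  have "f (vscale V 0 (vzero V)) = vscale W 0 (f (vzero V))"
    using assms(3) V.zero_closed unfolding is_linear_def by blast
  moreover have "f (vzero V) \<in> vecs W"
    using assms(3) V.zero_closed unfolding is_linear_def by blast
  ultimately show ?thesis by simp
qed

lemma subspace_vimage:
  assumes "is_vspace V" "is_vspace W" "is_linear V W f" "is_subspace W S"
  shows "is_subspace V {x \<in> vecs V. f x \<in> S}"
proof -
  interpret V: vector_space_on V by standard fact
  show ?thesis using assms linear_zero[OF assms(1-3)] by (auto simp: is_subspace_def is_linear_def)
qed

lemma subspace_image:
  assumes "is_vspace V" "is_vspace W" "is_linear V W f" "is_subspace V S"
  shows "is_subspace W (f ` S)"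
  unfolding is_subspace_def
proof (intro conjI allI ballI)
  note * = assms(3,4)[unfolded is_subspace_def is_linear_def]
  show "f ` S \<subseteq> vecs W" using * by auto
  show "vzero W \<in> f ` S"
    using linear_zero[OF assms(1-3)] assms(4) unfolding is_subspace_def by (metis imageI)
  show "vadd W x y \<in> f ` S" if "x \<in> f ` S" "y \<in> f ` S" for x y
  proof -
    from that obtain u v where uv: "u \<in> S" "v \<in> S" "x = f u" "y = f v" unfolding image_iff by metis
    have "u \<in> vecs V" "v \<in> vecs V" "vadd V u v \<in> S" using * uv by auto
    then show ?thesis using * uv by (metis imageI)
  qed
  show "vscale W c x \<in> f ` S" if "x \<in> f ` S" for c x
  proof -
    from that obtain u where u: "u \<in> S" "x = f u" unfolding image_iff by metis
    have "u \<in> vecs V" "vscale V c u \<in> S" using * u by auto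
    then show ?thesis using * u by (metis imageI)
  qed
qed

section \<open>Formal linear combinations\<close>

lemma lookup_fscale [simp]: "Poly_Mapping.lookup (fscale c v) t = c * Poly_Mapping.lookup v t"
  by (simp add: fscale_def Poly_Mapping.map.rep_eq when_def)

lemma fscale_add: "fscale c (v + w) = fscale c v + fscale c w"
  by (rule poly_mapping_eqI) (simp add: lookup_add distrib_left)

lemma add_fscale: "fscale (c + d) v = fscale c v + fscale d v"
  by (rule poly_mapping_eqI) (simp add: lookup_add distrib_right)

lemma fscale_diff: "fscale c (v - w) = fscale c v - fscale c w"
  by (rule poly_mapping_eqI) (simp add: lookup_minus right_diff_distrib)

lemma fscale_fscale: "fscale c (fscale d v) = fscale (c * d) v"
  by (rule poly_mapping_eqI) (simp add: mult.assoc)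

lemma fscale_one [simp]: "fscale 1 v = v"
  by (rule poly_mapping_eqI) simp

lemma fscale_zero [simp]: "fscale 0 v = 0" "fscale c 0 = 0"
  by (rule poly_mapping_eqI, simp)+

lemma fscale_uminus: "fscale (- c) v = - fscale c v" "fscale c (- v) = - fscale c v"
  by (rule poly_mapping_eqI, simp)+

lemma fscale_sum: "fscale c (sum f S) = (\<Sum>i\<in>S. fscale c (f i))"
  by (induction S rule: infinite_finite_induct) (simp_all add: fscale_add)

lemma fscale_basis: "fscale c (basis t) = Poly_Mapping.single t c"
  by (rule poly_mapping_eqI) (simp add: lookup_single when_def)

lemma keys_fscale: "Poly_Mapping.keys (fscale c v) \<subseteq> Poly_Mapping.keys v"
  by (auto simp: in_keys_iff)

lemma keys_basis [simp]: "Poly_Mapping.keys (basis t :: 'a \<Rightarrow>\<^sub>0 'k::field) = {t}"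
  by simp

lemma sum_basis: "(\<Sum>t\<in>Poly_Mapping.keys v. fscale (Poly_Mapping.lookup v t) (basis t)) = v"
  by (rule poly_mapping_eqI)
    (simp add: lookup_sum lookup_single when_def in_keys_iff if_distrib[of "(*) _"] cong: if_cong)

text \<open>Cancellation can make the keys of \<open>v + w\<close> fewer than those of
  \<open>v\<close> and \<open>w\<close>. Summing over a common finite superset reduces additivity to
  distributivity.\<close>

lemma lin_ext_superset:
  assumes "finite S" "Poly_Mapping.keys v \<subseteq> S"
  shows "lin_ext f v = (\<Sum>t\<in>S. fscale (Poly_Mapping.lookup v t) (f t))"
  unfolding lin_ext_def using assms
  by (intro sum.mono_neutral_left) (auto simp: in_keys_iff)

lemma lin_ext_basis [simp]: "lin_ext f (basis t) = f t"
  by (simp add: lin_ext_def)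

lemma lin_ext_zero [simp]: "lin_ext f 0 = 0"
  by (simp add: lin_ext_def)

lemma lin_ext_add: "lin_ext f (v + w) = lin_ext f v + lin_ext f w"
  using lin_ext_superset[of "Poly_Mapping.keys v \<union> Poly_Mapping.keys w" _ f] keys_add[of v w]
  by (simp add: lookup_add add_fscale sum.distrib)

lemma lin_ext_fscale: "lin_ext f (fscale c v) = fscale c (lin_ext f v)"
  using lin_ext_superset[of "Poly_Mapping.keys v" "fscale c v" f] keys_fscale[of c v]
  by (simp add: lin_ext_def fscale_sum fscale_fscale)

lemma lin_ext_uminus: "lin_ext f (- v) = - lin_ext f v"
  using lin_ext_fscale[of f "- 1" v] by (simp add: fscale_uminus)

lemma lin_ext_diff: "lin_ext f (v - w) = lin_ext f v - lin_ext f w"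
  using lin_ext_add[of f v "- w"] by (simp add: lin_ext_uminus)

lemma lin_ext_sum: "lin_ext f (sum g S) = (\<Sum>i\<in>S. lin_ext f (g i))"
  by (induction S rule: infinite_finite_induct) (simp_all add: lin_ext_add)

lemma lin_ext_cong:
  "v = w \<Longrightarrow> (\<And>t. t \<in> Poly_Mapping.keys w \<Longrightarrow> f t = g t) \<Longrightarrow> lin_ext f v = lin_ext g w"
  by (simp add: lin_ext_def)

lemma lin_ext_lin_ext: "lin_ext f (lin_ext g v) = lin_ext (\<lambda>t. lin_ext f (g t)) v"
  by (simp add: lin_ext_def[of g] lin_ext_def[of "\<lambda>t. lin_ext f (g t)"] lin_ext_sum lin_ext_fscale)

lemma lin_ext_id: "lin_ext basis v = v"
  by (simp add: lin_ext_def sum_basis)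

lemma lin_ext_fun_add: "lin_ext (\<lambda>t. f t + g t) v = lin_ext f v + lin_ext g v"
  by (simp add: lin_ext_def fscale_add sum.distrib)

lemma lin_ext_fun_fscale: "lin_ext (\<lambda>t. fscale c (f t)) v = fscale c (lin_ext f v)"
  by (simp add: lin_ext_def fscale_sum fscale_fscale mult.commute)

lemma lin_ext_swap:
  "lin_ext (\<lambda>s. lin_ext (\<lambda>t. f s t) w) v = lin_ext (\<lambda>t. lin_ext (\<lambda>s. f s t) v) w"
  by (simp add: lin_ext_def fscale_sum fscale_fscale mult.commute sum.swap[of _ "Poly_Mapping.keys w"])

lemma keys_lin_ext: "Poly_Mapping.keys (lin_ext f v) \<subseteq> (\<Union>t\<in>Poly_Mapping.keys v. Poly_Mapping.keys (f t))"
proof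
  fix s assume "s \<in> Poly_Mapping.keys (lin_ext f v)"
  then have "(\<Sum>t\<in>Poly_Mapping.keys v. Poly_Mapping.lookup v t * Poly_Mapping.lookup (f t) s) \<noteq> 0"
    by (simp add: lin_ext_def lookup_sum in_keys_iff)
  then obtain t where "t \<in> Poly_Mapping.keys v" "Poly_Mapping.lookup (f t) s \<noteq> 0"
    by (metis (no_types, lifting) mult_zero_right sum.neutral)
  then show "s \<in> (\<Union>t\<in>Poly_Mapping.keys v. Poly_Mapping.keys (f t))"
    by (auto simp: in_keys_iff)
qed

lemma keys_subset_add: "Poly_Mapping.keys v \<subseteq> S \<Longrightarrow> Poly_Mapping.keys w \<subseteq> S \<Longrightarrow> Poly_Mapping.keys (v + w) \<subseteq> S"
  by (rule subset_trans[OF keys_add]) simp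

lemma keys_subset_fscale: "Poly_Mapping.keys v \<subseteq> S \<Longrightarrow> Poly_Mapping.keys (fscale c v) \<subseteq> S"
  by (rule subset_trans[OF keys_fscale])

lemma free_vspace_sel [simp]:
  "vecs (free_vspace S) = {v. Poly_Mapping.keys v \<subseteq> S}" "vzero (free_vspace S) = 0"
  "vadd (free_vspace S) = (+)" "vscale (free_vspace S) = fscale"
  by (simp_all add: free_vspace_def)

lemma is_vspace_free: "is_vspace (free_vspace S :: ('k::field, 'a \<Rightarrow>\<^sub>0 'k) vspace)"
proof -
  have "\<exists>y. Poly_Mapping.keys y \<subseteq> S \<and> x + y = 0" if "Poly_Mapping.keys x \<subseteq> S" for x :: "'a \<Rightarrow>\<^sub>0 'k"
    using that by (intro exI[of _ "- x"]) (auto simp: in_keys_iff)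
  then show ?thesis
    by (simp add: is_vspace_def fscale_add add_fscale fscale_fscale add.commute add.assoc
        keys_subset_add keys_subset_fscale)
qed

lemma linear_lin_ext:
  assumes "\<And>t. t \<in> S \<Longrightarrow> Poly_Mapping.keys (f t) \<subseteq> T"
  shows "is_linear (free_vspace S) (free_vspace T) (lin_ext f)"
proof -
  have "Poly_Mapping.keys (lin_ext f v) \<subseteq> T" if "Poly_Mapping.keys v \<subseteq> S" for v
    by (rule subset_trans[OF keys_lin_ext]) (use that assms in blast)
  then show ?thesis by (simp add: is_linear_def lin_ext_add lin_ext_fscale)
qed

section \<open>Morphisms, ideals and quotients of operads\<close>

text \<open>\<open>operad_iso\<close> without bijectivity, so that it also covers the projections
  onto quotients.\<close>

definition operad_hom ::
    "('k::field, 'x) operad \<Rightarrow> ('k, 'y) operad \<Rightarrow> (nat set \<Rightarrow> 'x \<Rightarrow> 'y) \<Rightarrow> bool" where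
  "operad_hom P Q \<phi> \<longleftrightarrow>
     (\<forall>I. finite I \<longrightarrow> is_linear (space P I) (space Q I) (\<phi> I)) \<and>
     (\<forall>I f. \<forall>x\<in>ops P I. finite I \<and> inj_on f I \<longrightarrow>
        \<phi> (f ` I) (relabel P I f x) = relabel Q I f (\<phi> I x)) \<and>
     (\<forall>I a J. \<forall>x\<in>ops P I. \<forall>y\<in>ops P J. composable I a J \<longrightarrow>
        \<phi> (I - {a} \<union> J) (compose P I a J x y) = compose Q I a J (\<phi> I x) (\<phi> J y)) \<and>
     (\<forall>a. \<phi> {a} (unit P a) = unit Q a)"

lemma operad_iso_iff:
  "operad_iso P Q \<phi> \<longleftrightarrow>
     operad_hom P Q \<phi> \<and> (\<forall>I. finite I \<longrightarrow> bij_betw (\<phi> I) (ops P I) (ops Q I))"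
  by (simp only: operad_iso_def operad_hom_def imp_conjR all_conj_distrib conj_assoc conj_comms
      conj_left_commute)

lemma composable_finite:
  "composable I a J \<Longrightarrow> finite I \<and> finite J \<and> finite (I - {a}) \<and> finite (I - {a} \<union> J)"
  by (simp add: composable_def)

lemma operad_homD:
  assumes "operad_hom P Q \<phi>"
  shows "finite I \<Longrightarrow> is_linear (space P I) (space Q I) (\<phi> I)"
    and "finite I \<Longrightarrow> x \<in> ops P I \<Longrightarrow> \<phi> I x \<in> ops Q I"
    and "finite I \<Longrightarrow> inj_on f I \<Longrightarrow> x \<in> ops P I \<Longrightarrow>
      \<phi> (f ` I) (relabel P I f x) = relabel Q I f (\<phi> I x)"
    and "composable I a J \<Longrightarrow> x \<in> ops P I \<Longrightarrow> y \<in> ops P J \<Longrightarrow>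
      \<phi> (I - {a} \<union> J) (compose P I a J x y) = compose Q I a J (\<phi> I x) (\<phi> J y)"
    and "\<phi> {a} (unit P a) = unit Q a"
proof -
  note * = assms[unfolded operad_hom_def]
  note 1 = *[THEN conjunct1, rule_format]
  show "finite I \<Longrightarrow> is_linear (space P I) (space Q I) (\<phi> I)"
    by (rule 1)
  then show "finite I \<Longrightarrow> x \<in> ops P I \<Longrightarrow> \<phi> I x \<in> ops Q I"
    by (simp add: is_linear_def)
  show "finite I \<Longrightarrow> inj_on f I \<Longrightarrow> x \<in> ops P I \<Longrightarrow>
      \<phi> (f ` I) (relabel P I f x) = relabel Q I f (\<phi> I x)"
    by (rule *[THEN conjunct2, THEN conjunct1, rule_format]) simp_all
  show "composable I a J \<Longrightarrow> x \<in> ops P I \<Longrightarrow> y \<in> ops P J \<Longrightarrow>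
      \<phi> (I - {a} \<union> J) (compose P I a J x y) = compose Q I a J (\<phi> I x) (\<phi> J y)"
    by (rule *[THEN conjunct2, THEN conjunct2, THEN conjunct1, rule_format])
  show "\<phi> {a} (unit P a) = unit Q a"
    by (rule *[THEN conjunct2, THEN conjunct2, THEN conjunct2, rule_format])
qed

lemma operad_idealD:
  assumes "operad_ideal P N"
  shows "finite I \<Longrightarrow> is_subspace (space P I) (N I)"
    and "finite I \<Longrightarrow> x \<in> N I \<Longrightarrow> x \<in> ops P I"
    and "finite I \<Longrightarrow> inj_on f I \<Longrightarrow> x \<in> N I \<Longrightarrow> relabel P I f x \<in> N (f ` I)"
    and "composable I a J \<Longrightarrow> x \<in> N I \<Longrightarrow> y \<in> ops P J \<Longrightarrow> compose P I a J x y \<in> N (I - {a} \<union> J)"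
    and "composable I a J \<Longrightarrow> x \<in> ops P I \<Longrightarrow> y \<in> N J \<Longrightarrow> compose P I a J x y \<in> N (I - {a} \<union> J)"
proof -
  note * = assms[unfolded operad_ideal_def]
  note 3 = *[THEN conjunct2, THEN conjunct2, rule_format]
  show "finite I \<Longrightarrow> is_subspace (space P I) (N I)"
    by (rule *[THEN conjunct1, rule_format])
  then show "finite I \<Longrightarrow> x \<in> N I \<Longrightarrow> x \<in> ops P I"
    by (auto simp: is_subspace_def)
  show "finite I \<Longrightarrow> inj_on f I \<Longrightarrow> x \<in> N I \<Longrightarrow> relabel P I f x \<in> N (f ` I)"
    by (rule *[THEN conjunct2, THEN conjunct1, rule_format]) simp_all
  show "composable I a J \<Longrightarrow> x \<in> N I \<Longrightarrow> y \<in> ops P J \<Longrightarrow> compose P I a J x y \<in> N (I - {a} \<union> J)"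
    by (rule 3[THEN conjunct1, rule_format])
  show "composable I a J \<Longrightarrow> x \<in> ops P I \<Longrightarrow> y \<in> N J \<Longrightarrow> compose P I a J x y \<in> N (I - {a} \<union> J)"
    by (rule 3[THEN conjunct2, rule_format])
qed

context symmetric_operad
begin

lemma relabel_closed: "finite I \<Longrightarrow> inj_on f I \<Longrightarrow> x \<in> ops P I \<Longrightarrow> relabel P I f x \<in> ops P (f ` I)"
  using relabel_linear[of I f] by (simp add: is_linear_def)

lemma compose_closed:
  "composable I a J \<Longrightarrow> x \<in> ops P I \<Longrightarrow> y \<in> ops P J \<Longrightarrow> compose P I a J x y \<in> ops P (I - {a} \<union> J)"
  using compose_linear_left[of I a J y] by (simp add: is_linear_def)

lemma compose_add_left:
  "composable I a J \<Longrightarrow> x \<in> ops P I \<Longrightarrow> x' \<in> ops P I \<Longrightarrow> y \<in> ops P J \<Longrightarrow>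
   compose P I a J (vadd (space P I) x x') y =
   vadd (space P (I - {a} \<union> J)) (compose P I a J x y) (compose P I a J x' y)"
  using compose_linear_left[of I a J y] by (simp add: is_linear_def)

lemma compose_add_right:
  "composable I a J \<Longrightarrow> x \<in> ops P I \<Longrightarrow> y \<in> ops P J \<Longrightarrow> y' \<in> ops P J \<Longrightarrow>
   compose P I a J x (vadd (space P J) y y') =
   vadd (space P (I - {a} \<union> J)) (compose P I a J x y) (compose P I a J x y')"
  using compose_linear_right[of I a J x] by (simp add: is_linear_def)

lemma operad_ideal_generated: "operad_ideal P (ideal_generated P S)"
  unfolding operad_ideal_def
proof (intro conjI allI impI ballI)
  show "is_subspace (space P I) (ideal_generated P S I)" if "finite I" for I
  proof -
    interpret vector_space_on "space P I" by standard (rule vspace[OF that])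
    have "is_subspace (space P I) (N I)" if "operad_ideal P N" for N
      using that \<open>finite I\<close> by (rule operad_idealD)
    then show ?thesis unfolding is_subspace_def ideal_generated_def by auto
  qed
  show "relabel P I f x \<in> ideal_generated P S (f ` I)"
    if "x \<in> ideal_generated P S I" "finite I \<and> inj_on f I" for I f x
    using that unfolding ideal_generated_def by (auto intro!: relabel_closed operad_idealD(3)[of P])
  show "compose P I a J x y \<in> ideal_generated P S (I - {a} \<union> J)"
    if "composable I a J" "x \<in> ideal_generated P S I" "y \<in> ops P J" for I a J x y
    using that unfolding ideal_generated_def by (auto intro!: compose_closed operad_idealD(4)[of P])
  show "compose P I a J x y \<in> ideal_generated P S (I - {a} \<union> J)"
    if "composable I a J" "x \<in> ops P I" "y \<in> ideal_generated P S J" for I a J x y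
    using that unfolding ideal_generated_def by (auto intro!: compose_closed operad_idealD(5)[of P])
qed

end

lemma ideal_generated_least:
  "operad_ideal P N \<Longrightarrow> (\<And>J. S J \<subseteq> N J) \<Longrightarrow> ideal_generated P S I \<subseteq> N I"
  unfolding ideal_generated_def by blast

lemma ideal_generated_generator: "x \<in> S I \<Longrightarrow> x \<in> ops P I \<Longrightarrow> x \<in> ideal_generated P S I"
  unfolding ideal_generated_def by blast

text \<open>Used along projections: an ideal of a quotient is pulled back to representatives, where
  one can compute with linear combinations of trees.\<close>

lemma operad_ideal_vimage:
  assumes P: "symmetric_operad P" and Q: "symmetric_operad Q" and hom: "operad_hom P Q \<phi>"
    and N: "operad_ideal Q N"
  shows "operad_ideal P (\<lambda>I. {x \<in> ops P I. \<phi> I x \<in> N I})"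
proof -
  interpret P: symmetric_operad P by fact
  interpret Q: symmetric_operad Q by fact
  note h = operad_homD[OF hom] and n = operad_idealD[OF N]
  show ?thesis
    unfolding operad_ideal_def
  proof (intro conjI allI impI ballI)
    show "is_subspace (space P I) {x \<in> ops P I. \<phi> I x \<in> N I}" if "finite I" for I
      by (rule subspace_vimage[OF P.vspace[OF that] Q.vspace[OF that] h(1)[OF that] n(1)[OF that]])
    show "relabel P I f x \<in> {x \<in> ops P (f ` I). \<phi> (f ` I) x \<in> N (f ` I)}"
      if "x \<in> {x \<in> ops P I. \<phi> I x \<in> N I}" "finite I \<and> inj_on f I" for I f x
      using that by (simp add: h(3) n(3) P.relabel_closed)
    fix I a J x y assume c: "composable I a J"
    {
      assume "x \<in> {x \<in> ops P I. \<phi> I x \<in> N I}" "y \<in> ops P J"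
      then show "compose P I a J x y \<in> {x \<in> ops P (I - {a} \<union> J). \<phi> (I - {a} \<union> J) x \<in> N (I - {a} \<union> J)}"
        using c composable_finite[OF c] by (simp add: h(2,4) n(4) P.compose_closed)
    next
      assume "x \<in> ops P I" "y \<in> {x \<in> ops P J. \<phi> J x \<in> N J}"
      then show "compose P I a J x y \<in> {x \<in> ops P (I - {a} \<union> J). \<phi> (I - {a} \<union> J) x \<in> N (I - {a} \<union> J)}"
        using c composable_finite[OF c] by (simp add: h(2,4) n(5) P.compose_closed)
    }
  qed
qed

text \<open>Surjectivity lets the image absorb composition with every operation of \<open>Q\<close>,
  since each of them has a preimage in \<open>P\<close>.\<close>

lemma operad_ideal_image:
  assumes P: "symmetric_operad P" and Q: "symmetric_operad Q" and hom: "operad_hom P Q \<phi>"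
    and surj: "\<And>I. finite I \<Longrightarrow> \<phi> I ` ops P I = ops Q I" and N: "operad_ideal P N"
  shows "operad_ideal Q (\<lambda>I. \<phi> I ` N I)"
proof -
  interpret P: symmetric_operad P by fact
  interpret Q: symmetric_operad Q by fact
  note h = operad_homD[OF hom] and n = operad_idealD[OF N]
  show ?thesis
    unfolding operad_ideal_def
  proof (intro conjI allI impI ballI)
    show "is_subspace (space Q I) (\<phi> I ` N I)" if "finite I" for I
      by (rule subspace_image[OF P.vspace[OF that] Q.vspace[OF that] h(1)[OF that] n(1)[OF that]])
    show "relabel Q I f y \<in> \<phi> (f ` I) ` N (f ` I)"
      if y: "y \<in> \<phi> I ` N I" and I: "finite I \<and> inj_on f I" for I f y
    proof -
      obtain x where x: "x \<in> N I" "y = \<phi> I x" using y by blast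
      then have "relabel Q I f y = \<phi> (f ` I) (relabel P I f x)"
        using I n(2)[of I x] by (simp add: h(3))
      then show ?thesis using I x n(3)[of I f x] by simp
    qed
    fix I a J x y assume c: "composable I a J"
    then have fin: "finite I" "finite J" by (simp_all add: composable_def)
    {
      assume xy: "x \<in> \<phi> I ` N I" "y \<in> ops Q J"
      obtain u where u: "u \<in> N I" "x = \<phi> I u" using xy by blast
      obtain v where v: "v \<in> ops P J" "y = \<phi> J v" using xy surj[OF fin(2)] by blast
      have "compose Q I a J x y = \<phi> (I - {a} \<union> J) (compose P I a J u v)"
        using u v c n(2)[OF fin(1)] by (simp add: h(4))
      then show "compose Q I a J x y \<in> \<phi> (I - {a} \<union> J) ` N (I - {a} \<union> J)"
        using n(4)[OF c u(1) v(1)] by simp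
    next
      assume xy: "x \<in> ops Q I" "y \<in> \<phi> J ` N J"
      obtain u where u: "u \<in> ops P I" "x = \<phi> I u" using xy surj[OF fin(1)] by blast
      obtain v where v: "v \<in> N J" "y = \<phi> J v" using xy by blast
      have "compose Q I a J x y = \<phi> (I - {a} \<union> J) (compose P I a J u v)"
        using u v c n(2)[OF fin(2)] by (simp add: h(4))
      then show "compose Q I a J x y \<in> \<phi> (I - {a} \<union> J) ` N (I - {a} \<union> J)"
        using n(5)[OF c u(1) v(1)] by simp
    }
  qed
qed

text \<open>Ideals say nothing about the infinite input sets, hence the condition on \<open>S\<close>.\<close>

lemma ideal_generated_iso:
  assumes P: "symmetric_operad P" and Q: "symmetric_operad Q" and iso: "operad_iso P Q \<phi>"
    and S: "\<And>J. S J \<subseteq> ops P J" "\<And>J. infinite J \<Longrightarrow> S J = {}" and I: "finite I"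
  shows "ideal_generated Q (\<lambda>J. \<phi> J ` S J) I = \<phi> I ` ideal_generated P S I"
proof
  interpret P: symmetric_operad P by fact
  have hom: "operad_hom P Q \<phi>" and bij: "\<And>J. finite J \<Longrightarrow> bij_betw (\<phi> J) (ops P J) (ops Q J)"
    using iso by (simp_all add: operad_iso_iff)
  have surj: "\<phi> J ` ops P J = ops Q J" if "finite J" for J
    using bij[OF that] by (simp add: bij_betw_def)
  have "operad_ideal Q (\<lambda>J. \<phi> J ` ideal_generated P S J)"
    using P Q hom surj P.operad_ideal_generated by (rule operad_ideal_image)
  then show "ideal_generated Q (\<lambda>J. \<phi> J ` S J) I \<subseteq> \<phi> I ` ideal_generated P S I"
    using S by (intro ideal_generated_least image_mono) (auto intro: ideal_generated_generator)
  have "ideal_generated P S I \<subseteq> {x \<in> ops P I. \<phi> I x \<in> M I}"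
    if M: "operad_ideal Q M" "\<And>J. \<phi> J ` S J \<subseteq> M J" for M
  proof -
    have "operad_ideal P (\<lambda>J. {x \<in> ops P J. \<phi> J x \<in> M J})"
      by (rule operad_ideal_vimage[OF P Q hom M(1)])
    moreover have "S J \<subseteq> {x \<in> ops P J. \<phi> J x \<in> M J}" for J
      using S(1)[of J] M(2)[of J] by auto
    ultimately show ?thesis by (rule ideal_generated_least)
  qed
  then have "\<phi> I x \<in> M I"
    if "x \<in> ideal_generated P S I" "operad_ideal Q M" "\<And>J. \<phi> J ` S J \<subseteq> M J" for x M
    using that by (metis (no_types, lifting) mem_Collect_eq subsetD)
  moreover have "\<phi> I x \<in> ops Q I" if "x \<in> ideal_generated P S I" for x
    using that surj[OF I] by (auto simp: ideal_generated_def)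
  ultimately show "\<phi> I ` ideal_generated P S I \<subseteq> ideal_generated Q (\<lambda>J. \<phi> J ` S J) I"
    by (auto simp only: ideal_generated_def[of Q] mem_Collect_eq image_subset_iff)
qed

locale operad_with_ideal = symmetric_operad P for P :: "('k::field, 'x) operad" +
  fixes N :: "nat set \<Rightarrow> 'x set"
  assumes ideal: "operad_ideal P N"
begin

abbreviation proj :: "nat set \<Rightarrow> 'x \<Rightarrow> 'x set" where
  "proj I \<equiv> vcoset (space P I) (N I)"

abbreviation quot :: "('k, 'x set) operad" where
  "quot \<equiv> quotient_operad P N"

lemma subspace_on: "finite I \<Longrightarrow> subspace_on (space P I) (N I)"
  using ideal vspace by unfold_locales (auto dest: operad_idealD)

lemma ops_quot: "ops quot I = proj I ` ops P I"
  by (simp add: quotient_operad_def vquot_def)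

lemma space_quot: "space quot I = vquot (space P I) (N I)"
  by (simp add: quotient_operad_def)

lemma proj_add:
  "finite I \<Longrightarrow> x \<in> ops P I \<Longrightarrow> w \<in> N I \<Longrightarrow> proj I (vadd (space P I) x w) = proj I x"
  by (rule subspace_on.coset_add_mem[OF subspace_on])

lemma proj_eq_iff:
  assumes "finite I" "x \<in> ops P I" "y \<in> ops P I"
  shows "proj I x = proj I y \<longleftrightarrow> (\<exists>w\<in>N I. x = vadd (space P I) y w)"
proof -
  interpret subspace_on "space P I" "N I" using assms(1) by (rule subspace_on)
  show ?thesis using assms coset_eq_iff[of y x] by (auto simp: vcoset_def)
qed

lemma proj_eq_zero_iff:
  assumes "finite I" "x \<in> ops P I"
  shows "proj I x = vzero (space quot I) \<longleftrightarrow> x \<in> N I"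
proof -
  interpret subspace_on "space P I" "N I" using assms(1) by (rule subspace_on)
  show ?thesis using assms coset_eq_zero_iff by (simp add: space_quot vzero_vquot)
qed

lemma relabel_quot:
  assumes I: "finite I" "inj_on f I" and x: "x \<in> ops P I"
  shows "relabel quot I f (proj I x) = proj (f ` I) (relabel P I f x)"
proof -
  interpret I: subspace_on "space P I" "N I" using I(1) by (rule subspace_on)
  have "proj (f ` I) (relabel P I f x') = proj (f ` I) (relabel P I f x)" if x': "x' \<in> proj I x" for x'
  proof -
    obtain w where w: "w \<in> N I" "x' = vadd (space P I) x w" using x' by (auto simp: vcoset_def)
    then have "relabel P I f x' = vadd (space P (f ` I)) (relabel P I f x) (relabel P I f w)"
      using relabel_linear[OF I] x I.mem_vecs by (simp add: is_linear_def)
    moreover have "relabel P I f w \<in> N (f ` I)" using ideal I w(1) by (rule operad_idealD)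
    ultimately show ?thesis
      using I x by (simp add: proj_add relabel_closed)
  qed
  then have "(\<Union>x'\<in>proj I x. proj (f ` I) (relabel P I f x')) = proj (f ` I) (relabel P I f x)"
    using x by (intro I.UN_coset_const)
  then show ?thesis by (simp add: quotient_operad_def)
qed

lemma compose_quot:
  assumes c: "composable I a J" and x: "x \<in> ops P I" and y: "y \<in> ops P J"
  shows "compose quot I a J (proj I x) (proj J y) = proj (I - {a} \<union> J) (compose P I a J x y)"
proof -
  have fin: "finite I" "finite J" "finite (I - {a} \<union> J)"
    using c by (simp_all add: composable_def)
  interpret I: subspace_on "space P I" "N I" using fin(1) by (rule subspace_on)
  interpret J: subspace_on "space P J" "N J" using fin(2) by (rule subspace_on)
  interpret K: subspace_on "space P (I - {a} \<union> J)" "N (I - {a} \<union> J)"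
    using fin(3) by (rule subspace_on)
  have "proj (I - {a} \<union> J) (compose P I a J x' y') = proj (I - {a} \<union> J) (compose P I a J x y)"
    if x': "x' \<in> proj I x" and y': "y' \<in> proj J y" for x' y'
  proof -
    obtain v where v: "v \<in> N I" "x' = vadd (space P I) x v" using x' by (auto simp: vcoset_def)
    obtain w where w: "w \<in> N J" "y' = vadd (space P J) y w" using y' by (auto simp: vcoset_def)
    have vw: "v \<in> ops P I" "w \<in> ops P J" using v w I.mem_vecs J.mem_vecs by auto
    \<comment> \<open>Expanding the second argument only next to \<open>x\<close> leaves two
      correction terms, \<open>x\<close> with \<open>w\<close> and \<open>v\<close> with all of
      \<open>y'\<close>; each has one factor in the ideal.\<close>
    have 1: "compose P I a J x w \<in> N (I - {a} \<union> J)" "compose P I a J v y' \<in> N (I - {a} \<union> J)"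
      using operad_idealD[OF ideal] c x y v w vw by auto
    have "compose P I a J x' y' = vadd (space P (I - {a} \<union> J)) (compose P I a J x y)
        (vadd (space P (I - {a} \<union> J)) (compose P I a J x w) (compose P I a J v y'))"
      using c x y v(2) w(2) vw by (simp add: compose_add_left compose_add_right compose_closed K.add_assoc
          K.add_left_commute)
    then show ?thesis
      using 1 x y c fin by (simp add: proj_add compose_closed)
  qed
  then have "(\<Union>x'\<in>proj I x. \<Union>y'\<in>proj J y. proj (I - {a} \<union> J) (compose P I a J x' y')) =
      proj (I - {a} \<union> J) (compose P I a J x y)"
    using x y by (intro I.UN_coset_const J.UN_coset_const)
  then show ?thesis by (simp add: quotient_operad_def)
qed

lemma unit_quot: "unit quot a = proj {a} (unit P a)"
  by (simp add: quotient_operad_def)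

lemma hom_proj: "operad_hom P quot proj"
  unfolding operad_hom_def
  by (simp add: space_quot subspace_on.linear_coset subspace_on relabel_quot compose_quot unit_quot)

lemma symmetric_operad_quot: "symmetric_operad quot"
proof
  note s [simp] = relabel_quot compose_quot relabel_closed compose_closed unit_quot unit_closed
  show "is_vspace (space quot I)" if "finite I" for I
    using that by (simp add: space_quot subspace_on.is_vspace_vquot subspace_on)
  show "is_linear (space quot I) (space quot (f ` I)) (relabel quot I f)"
    if "finite I" "inj_on f I" for I f
    unfolding space_quot
    by (rule subspace_on.linear_from_vquot[OF subspace_on linear_comp[OF relabel_linear
        subspace_on.linear_coset[OF subspace_on]]])
      (use that in simp_all)
  show "relabel quot I f x = relabel quot I g x"
    if "finite I" "inj_on f I" "\<And>i. i \<in> I \<Longrightarrow> f i = g i" "x \<in> ops quot I" for I f g x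
  proof -
    have "inj_on g I" "g ` I = f ` I" using that inj_on_cong[of I f g] by auto
    then show ?thesis using that relabel_cong[of I f g] by (auto simp: ops_quot)
  qed
  show "relabel quot I id x = x" if "finite I" "x \<in> ops quot I" for I x
    using that by (auto simp: ops_quot relabel_id)
  show "relabel quot (f ` I) g (relabel quot I f x) = relabel quot I (g \<circ> f) x"
    if "finite I" "inj_on f I" "inj_on g (f ` I)" "x \<in> ops quot I" for I f g x
    using that by (auto simp: ops_quot relabel_relabel comp_inj_on image_comp)
  show "is_linear (space quot I) (space quot (I - {a} \<union> J)) (\<lambda>x. compose quot I a J x y)"
    if c: "composable I a J" and y: "y \<in> ops quot J" for I a J y
  proof -
    obtain v where v: "v \<in> ops P J" "y = proj J v" using y by (auto simp: ops_quot)
    show ?thesis unfolding space_quot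
      by (rule subspace_on.linear_from_vquot[OF subspace_on linear_comp[OF compose_linear_left
          subspace_on.linear_coset[OF subspace_on]]])
        (use c v composable_finite[OF c] in simp_all)
  qed
  show "is_linear (space quot J) (space quot (I - {a} \<union> J)) (compose quot I a J x)"
    if c: "composable I a J" and x: "x \<in> ops quot I" for I a J x
  proof -
    obtain v where v: "v \<in> ops P I" "x = proj I v" using x by (auto simp: ops_quot)
    show ?thesis unfolding space_quot
      by (rule subspace_on.linear_from_vquot[OF subspace_on linear_comp[OF compose_linear_right
          subspace_on.linear_coset[OF subspace_on]]])
        (use c v composable_finite[OF c] in simp_all)
  qed
  show "unit quot a \<in> ops quot {a}" for a
    by (simp add: ops_quot)
  show "relabel quot {a} f (unit quot a) = unit quot (f a)" for a f
    by (simp add: relabel_unit)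
  show "compose quot {a} a J (unit quot a) y = y" if "finite J" "y \<in> ops quot J" for a J y
  proof -
    have "composable {a} a J" using that by (simp add: composable_def)
    then show ?thesis using that by (auto simp: ops_quot unit_left)
  qed
  show "compose quot I a {b} x (unit quot b) = relabel quot I (id(a := b)) x"
    if "composable I a {b}" "x \<in> ops quot I" for I a b x
  proof -
    have "inj_on (id(a := b)) I" "id(a := b) ` I = I - {a} \<union> {b}"
      using that by (auto simp: composable_def inj_on_def)
    then show ?thesis using that composable_finite[OF that(1)] by (auto simp: ops_quot unit_right)
  qed
  show "compose quot (f ` I) (f a) (g ` J) (relabel quot I f x) (relabel quot J g y) =
      relabel quot (I - {a} \<union> J) (\<lambda>i. if i \<in> J then g i else f i) (compose quot I a J x y)"
    if "composable I a J" "composable (f ` I) (f a) (g ` J)" "inj_on f I" "inj_on g J"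
      "x \<in> ops quot I" "y \<in> ops quot J" for I a J f g x y
  proof -
    have a: "a \<in> I" "(f ` I - {f a}) \<inter> g ` J = {}" using that by (auto simp: composable_def)
    \<comment> \<open>Injectivity gives \<open>f i \<noteq> f a\<close>, and composability of the
      images then separates \<open>f i\<close> from \<open>g j\<close>. This is why the glued
      relabelling is injective.\<close>
    have "f i \<noteq> g j" if "i \<in> I - {a}" "j \<in> J" for i j
      using that a inj_onD[OF \<open>inj_on f I\<close>, of i a] by auto
    note ne = this
    have "inj_on (\<lambda>i. if i \<in> J then g i else f i) (I - {a} \<union> J)"
    proof (rule inj_onI)
      fix i j assume ij: "i \<in> I - {a} \<union> J" "j \<in> I - {a} \<union> J"
        "(if i \<in> J then g i else f i) = (if j \<in> J then g j else f j)"
      then show "i = j"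
        using ne[of i j] ne[of j i] inj_onD[OF that(3), of i j] inj_onD[OF that(4), of i j]
        by (cases "i \<in> J"; cases "j \<in> J") auto
    qed
    moreover have "(\<lambda>i. if i \<in> J then g i else f i) ` (I - {a} \<union> J) = f ` I - {f a} \<union> g ` J"
    proof -
      have *: "f ` I - {f a} = f ` (I - {a})"
        using inj_on_image_set_diff[OF that(3), of I "{a}"] a(1) by simp
      have "(I - {a}) \<inter> J = {}" using that(1) by (simp add: composable_def)
      then have "(\<lambda>i. if i \<in> J then g i else f i) ` (I - {a}) = f ` (I - {a})"
        by (intro image_cong) auto
      moreover have "(\<lambda>i. if i \<in> J then g i else f i) ` J = g ` J"
        by (intro image_cong) auto
      ultimately show ?thesis by (simp only: image_Un *)
    qed
    ultimately show ?thesis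
      using that composable_finite[OF that(1)] composable_finite[OF that(2)]
      by (auto simp: ops_quot compose_equivariant)
  qed
  show "compose quot (I - {a} \<union> J) b L (compose quot I a J x y) z =
      compose quot I a (J - {b} \<union> L) x (compose quot J b L y z)"
    if c: "composable I a J" "composable J b L" "(I - {a}) \<inter> L = {}"
      and xyz: "x \<in> ops quot I" "y \<in> ops quot J" "z \<in> ops quot L" for I a J b L x y z
  proof -
    obtain u v w where uvw: "u \<in> ops P I" "v \<in> ops P J" "w \<in> ops P L"
      "x = proj I u" "y = proj J v" "z = proj L w"
      using xyz by (auto simp: ops_quot)
    have "composable (I - {a} \<union> J) b L" "composable I a (J - {b} \<union> L)"
      and eq: "I - {a} \<union> J - {b} \<union> L = I - {a} \<union> (J - {b} \<union> L)"
      using c by (auto simp: composable_def)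
    then show ?thesis
      using c uvw(1-3) unfolding uvw(4-)
      by (simp only: compose_quot compose_closed compose_sequential eq)
  qed
  show "compose quot (I - {a} \<union> J) b L (compose quot I a J x y) z =
      compose quot (I - {b} \<union> L) a J (compose quot I b L x z) y"
    if c: "composable I a J" "composable I b L" "a \<noteq> b" "J \<inter> L = {}"
      and xyz: "x \<in> ops quot I" "y \<in> ops quot J" "z \<in> ops quot L" for I a J b L x y z
  proof -
    obtain u v w where uvw: "u \<in> ops P I" "v \<in> ops P J" "w \<in> ops P L"
      "x = proj I u" "y = proj J v" "z = proj L w"
      using xyz by (auto simp: ops_quot)
    have cs: "composable (I - {a} \<union> J) b L" "composable (I - {b} \<union> L) a J"
      and eq: "I - {a} \<union> J - {b} \<union> L = I - {b} \<union> L - {a} \<union> J"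
      using c by (auto simp: composable_def)
    have "compose quot (I - {a} \<union> J) b L (compose quot I a J x y) z =
        proj (I - {a} \<union> J - {b} \<union> L) (compose P (I - {a} \<union> J) b L (compose P I a J u v) w)"
      using c cs uvw(1-3) unfolding uvw(4-) by (simp only: compose_quot compose_closed)
    also have "\<dots> = compose quot (I - {b} \<union> L) a J (compose quot I b L x z) y"
      using c cs uvw(1-3) unfolding uvw(4-) compose_parallel[OF c uvw(1-3)] eq
      by (simp only: compose_quot compose_closed)
    finally show ?thesis .
  qed
qed

end

text \<open>Since \<open>M I\<close> is exactly the image of \<open>N I\<close>, the image of a
  coset under \<open>\<phi> I\<close> is again a full coset, so the induced map is simply the image
  of sets.\<close>

lemma operad_iso_quotient:
  assumes P: "operad_with_ideal P N" and Q: "operad_with_ideal Q M" and iso: "operad_iso P Q \<phi>"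
    and M: "\<And>I. finite I \<Longrightarrow> M I = \<phi> I ` N I"
  shows "operad_iso (quotient_operad P N) (quotient_operad Q M) (\<lambda>I X. \<phi> I ` X)"
proof -
  interpret P: operad_with_ideal P N by fact
  interpret Q: operad_with_ideal Q M by fact
  have hom: "operad_hom P Q \<phi>" and bij: "\<And>J. finite J \<Longrightarrow> bij_betw (\<phi> J) (ops P J) (ops Q J)"
    using iso by (simp_all add: operad_iso_iff)
  note h = operad_homD[OF hom]
  have proj [simp]: "\<phi> I ` P.proj I x = Q.proj I (\<phi> I x)" if "finite I" "x \<in> ops P I" for I x
    using that h(1)[OF that(1)] operad_idealD(2)[OF P.ideal]
    by (auto simp: vcoset_def M is_linear_def image_image intro!: image_cong)
  note [simp] = P.relabel_quot Q.relabel_quot P.compose_quot Q.compose_quot P.unit_quot Q.unit_quot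
    P.relabel_closed P.compose_closed P.unit_closed h(2-5)
  have "operad_hom P.quot Q.quot (\<lambda>I X. \<phi> I ` X)"
    unfolding operad_hom_def
  proof (intro conjI allI impI ballI)
    show "is_linear (space P.quot I) (space Q.quot I) ((`) (\<phi> I))" if "finite I" for I
      unfolding P.space_quot Q.space_quot using that
      by (intro subspace_on.linear_from_vquot[OF P.subspace_on
          linear_comp[OF h(1) subspace_on.linear_coset[OF Q.subspace_on]]]) simp_all
    show "\<phi> (f ` I) ` relabel P.quot I f X = relabel Q.quot I f (\<phi> I ` X)"
      if X: "X \<in> ops P.quot I" and fin: "finite I \<and> inj_on f I" for I f X
    proof -
      obtain x where "x \<in> ops P I" "X = P.proj I x" using X by (auto simp: P.ops_quot)
      then show ?thesis using fin by simp
    qed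
    show "\<phi> (I - {a} \<union> J) ` compose P.quot I a J X Y = compose Q.quot I a J (\<phi> I ` X) (\<phi> J ` Y)"
      if X: "X \<in> ops P.quot I" and Y: "Y \<in> ops P.quot J" and c: "composable I a J" for I a J X Y
    proof -
      obtain x where "x \<in> ops P I" "X = P.proj I x" using X by (auto simp: P.ops_quot)
      moreover obtain y where "y \<in> ops P J" "Y = P.proj J y" using Y by (auto simp: P.ops_quot)
      ultimately show ?thesis using composable_finite[OF c] c by simp
    qed
    show "\<phi> {a} ` unit P.quot a = unit Q.quot a" for a
      by simp
  qed
  moreover have "bij_betw ((`) (\<phi> I)) (ops P.quot I) (ops Q.quot I)" if I: "finite I" for I
  proof (rule bij_betwI')
    have sub: "X \<subseteq> ops P I" if "X \<in> ops P.quot I" for X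
      using that subspace_on.coset_subset[OF P.subspace_on[OF I]] unfolding P.ops_quot by blast
    show "\<phi> I ` X = \<phi> I ` Y \<longleftrightarrow> X = Y" if "X \<in> ops P.quot I" "Y \<in> ops P.quot I" for X Y
      using bij[OF I] sub[OF that(1)] sub[OF that(2)]
      by (intro inj_on_image_eq_iff[of _ "ops P I"]) (simp_all add: bij_betw_def)
    show "\<phi> I ` X \<in> ops Q.quot I" if "X \<in> ops P.quot I" for X
      using that I by (auto simp: P.ops_quot Q.ops_quot)
    show "\<exists>X\<in>ops P.quot I. Y = \<phi> I ` X" if Y: "Y \<in> ops Q.quot I" for Y
    proof -
      obtain y where y: "y \<in> ops Q I" "Y = Q.proj I y" using Y by (auto simp: Q.ops_quot)
      obtain x where x: "x \<in> ops P I" "y = \<phi> I x"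
        using bij[OF I] y unfolding bij_betw_def by blast
      then show ?thesis using y I by (intro bexI[of _ "P.proj I x"]) (simp_all add: P.ops_quot)
    qed
  qed
  ultimately show ?thesis by (simp add: operad_iso_iff)
qed

section \<open>The operad of trees\<close>

abbreviation tree_space :: "'e set \<Rightarrow> nat set \<Rightarrow> (('e, nat) btree \<Rightarrow>\<^sub>0 'k::field) set" where
  "tree_space X I \<equiv> {v. Poly_Mapping.keys v \<subseteq> trees X I}"

definition insert_trees ::
    "'l \<Rightarrow> (('e, 'l) btree \<Rightarrow>\<^sub>0 'k::field) \<Rightarrow> (('e, 'l) btree \<Rightarrow>\<^sub>0 'k) \<Rightarrow> (('e, 'l) btree \<Rightarrow>\<^sub>0 'k)" where
  "insert_trees a v w = lin_ext (\<lambda>s. lin_ext (\<lambda>t. basis (graft a t s)) w) v"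

lemma tree_operad_sel [simp]:
  "space (tree_operad X) I = free_vspace (trees X I)"
  "relabel (tree_operad X) I f = lin_ext (\<lambda>t. basis (map_btree id f t))"
  "compose (tree_operad X) I a J = insert_trees a"
  "unit (tree_operad X) a = basis (Leaf a)"
  by (simp_all add: tree_operad_def insert_trees_def fun_eq_iff)

lemma insert_trees_basis [simp]: "insert_trees a (basis s) (basis t) = basis (graft a t s)"
  by (simp add: insert_trees_def)

lemma insert_trees_linear:
  "insert_trees a (v + v') w = insert_trees a v w + insert_trees a v' w"
  "insert_trees a (v - v') w = insert_trees a v w - insert_trees a v' w"
  "insert_trees a (fscale c v) w = fscale c (insert_trees a v w)"
  "insert_trees a v (w + w') = insert_trees a v w + insert_trees a v w'"
  "insert_trees a v (w - w') = insert_trees a v w - insert_trees a v w'"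
  "insert_trees a v (fscale c w) = fscale c (insert_trees a v w)"
  "insert_trees a 0 w = 0" "insert_trees a v 0 = 0"
proof -
  show "insert_trees a v (w - w') = insert_trees a v w - insert_trees a v w'" for w'
    using lin_ext_fun_add[of "\<lambda>s. lin_ext (\<lambda>t. basis (graft a t s)) (w - w')"
        "\<lambda>s. lin_ext (\<lambda>t. basis (graft a t s)) w'" v]
    by (simp add: insert_trees_def lin_ext_diff)
  show "insert_trees a v 0 = 0"
    by (simp add: insert_trees_def lin_ext_def[of "\<lambda>s. 0"])
qed (simp_all add: insert_trees_def lin_ext_add lin_ext_diff lin_ext_fscale lin_ext_fun_add lin_ext_fun_fscale)

text \<open>Linear maps and bilinear maps are determined by their values on trees.\<close>

lemma lin_ext_eqI:
  assumes "\<And>v w. F (v + w) = F v + F w" "\<And>c v. F (fscale c v) = fscale c (F v)"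
    and "\<And>t. t \<in> Poly_Mapping.keys v \<Longrightarrow> F (basis t) = f t"
  shows "F v = lin_ext f v"
proof -
  have F0: "F 0 = 0" using assms(1)[of 0 0] by simp
  have "F (\<Sum>t\<in>S. fscale (c t) (basis t)) = (\<Sum>t\<in>S. fscale (c t) (F (basis t)))" for S c
    by (induction S rule: infinite_finite_induct) (simp_all add: F0 assms(1,2))
  from this[of "Poly_Mapping.lookup v" "Poly_Mapping.keys v"] show ?thesis
    using assms(3) by (simp add: sum_basis lin_ext_def)
qed

lemma apply_lin_ext:
  assumes "\<And>v w. F (v + w) = F v + F w" "\<And>c v. F (fscale c v) = fscale c (F v)"
  shows "F (lin_ext f v) = lin_ext (\<lambda>t. F (f t)) v"
proof -
  have F0: "F 0 = 0" using assms(1)[of 0 0] by simp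
  have "F (\<Sum>t\<in>S. fscale (c t) (f t)) = (\<Sum>t\<in>S. fscale (c t) (F (f t)))" for S c
    by (induction S rule: infinite_finite_induct) (simp_all add: F0 assms)
  then show ?thesis by (simp add: lin_ext_def)
qed

lemma linear_eq_on_keys:
  assumes "\<And>v w. F (v + w) = F v + F w" "\<And>c v. F (fscale c v) = fscale c (F v)"
    and "\<And>v w. G (v + w) = G v + G w" "\<And>c v. G (fscale c v) = fscale c (G v)"
    and "\<And>t. t \<in> Poly_Mapping.keys v \<Longrightarrow> F (basis t) = G (basis t)"
  shows "F v = G v"
proof -
  have "F v = lin_ext (\<lambda>t. F (basis t)) v" by (rule lin_ext_eqI) (simp_all add: assms)
  moreover have "G v = lin_ext (\<lambda>t. F (basis t)) v" by (rule lin_ext_eqI) (simp_all add: assms)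
  ultimately show ?thesis by simp
qed

lemma leaves_nonempty: "leaves t \<noteq> {}"
  by (induction t) simp_all

lemma trees_empty [simp]: "trees X {} = {}"
  using leaves_nonempty by (auto simp: trees_def)

lemma leaf_mem_trees [simp]: "Leaf i \<in> trees X I \<longleftrightarrow> I = {i}"
  by (auto simp: trees_def)

lemma node_mem_trees:
  "Node e s t \<in> trees X I \<longleftrightarrow>
     e \<in> X \<and> s \<in> trees X (leaves s) \<and> t \<in> trees X (leaves t) \<and>
     leaves s \<inter> leaves t = {} \<and> I = leaves s \<union> leaves t"
  by (auto simp: trees_def)

lemma leaves_trees: "t \<in> trees X I \<Longrightarrow> leaves t = I"
  by (simp add: trees_def)

lemma trees_leaves: "t \<in> trees X I \<Longrightarrow> t \<in> trees X (leaves t)"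
  by (simp add: trees_def)

lemma trees_finite: "t \<in> trees X I \<Longrightarrow> finite I"
proof -
  have "finite (leaves t)" for t :: "('a, nat) btree" by (induction t) simp_all
  then show "t \<in> trees X I \<Longrightarrow> finite I" using leaves_trees by metis
qed

lemma trees_singleton: "trees X {a} = {Leaf a}"
proof -
  have "t = Leaf a" if "t \<in> trees X {a}" for t
  proof (cases t)
    case (Node e u v)
    then have "leaves u \<union> leaves v = {a}" "leaves u \<inter> leaves v = {}"
      using that by (auto simp: node_mem_trees)
    then have "leaves u = {} \<or> leaves v = {}"
      using subset_singletonD[of "leaves u" a] subset_singletonD[of "leaves v" a] by auto
    then show ?thesis using leaves_nonempty[of u] leaves_nonempty[of v] by simp
  qed (use that in simp)
  then show ?thesis using leaf_mem_trees[of a X "{a}"] by blast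
qed

lemma graft_notin: "a \<notin> leaves s \<Longrightarrow> graft a t s = s"
  by (induction s) auto

lemma leaves_graft: "leaves (graft a t s) = (if a \<in> leaves s then leaves s - {a} \<union> leaves t else leaves s)"
  by (induction s) auto

lemma multilinear_graft:
  "multilinear_tree s \<Longrightarrow> multilinear_tree t \<Longrightarrow> (leaves s - {a}) \<inter> leaves t = {} \<Longrightarrow>
   multilinear_tree (graft a t s)"
proof (induction s)
  case (Node e u v)
  have "a \<notin> leaves u \<or> a \<notin> leaves v" using Node.prems by auto
  then show ?case
    using Node by (auto simp: leaves_graft graft_notin Int_Un_distrib Int_Un_distrib2 Un_Diff)
qed auto

lemma labels_graft: "labels (graft a t s) \<subseteq> labels s \<union> labels t"
  by (induction s) auto

lemma graft_mem_trees:
  "composable I a J \<Longrightarrow> s \<in> trees X I \<Longrightarrow> t \<in> trees X J \<Longrightarrow> graft a t s \<in> trees X (I - {a} \<union> J)"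
  using labels_graft[of a t s]
  by (auto simp: trees_def composable_def leaves_graft multilinear_graft)

lemma multilinear_map:
  "multilinear_tree t \<Longrightarrow> inj_on f (leaves t) \<Longrightarrow> multilinear_tree (map_btree g f t)"
proof (induction t)
  case (Node e u v)
  have "f ` leaves u \<inter> f ` leaves v = {}"
    using Node.prems inj_on_image_Int[of f "leaves (Node e u v)" "leaves u" "leaves v"] by simp
  then show ?case using Node by (auto simp: btree.set_map inj_on_Un)
qed simp

lemma map_mem_trees:
  "t \<in> trees X I \<Longrightarrow> inj_on f I \<Longrightarrow> g ` X \<subseteq> Y \<Longrightarrow> map_btree g f t \<in> trees Y (f ` I)"
  by (auto simp: trees_def btree.set_map multilinear_map)

lemma map_graft:
  "map_btree k (\<lambda>i. if i \<in> leaves t then g i else f i) (graft a t s) =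
   graft (f a) (map_btree k g t) (map_btree k f s)"
  if "inj_on f (leaves s)" "a \<in> leaves s" "(leaves s - {a}) \<inter> leaves t = {}"
proof -
  have t: "map_btree k (\<lambda>i. if i \<in> leaves t then g i else f i) t = map_btree k g t"
    by (rule btree.map_cong0) simp_all
  \<comment> \<open>The induction runs over a separate tree \<open>u\<close> with leaves among those
    of \<open>s\<close>, so that the hypotheses about \<open>s\<close> stay fixed.\<close>
  have "map_btree k (\<lambda>i. if i \<in> leaves t then g i else f i) (graft a t u) =
      graft (f a) (map_btree k g t) (map_btree k f u)" if "leaves u \<subseteq> leaves s" for u
    using that
  proof (induction u)
    case (Leaf i)
    then show ?case using t that inj_onD[of f "leaves s" i a] \<open>inj_on f (leaves s)\<close>
        \<open>a \<in> leaves s\<close> \<open>(leaves s - {a}) \<inter> leaves t = {}\<close> by auto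
  qed auto
  then show ?thesis by blast
qed

lemma graft_leaf: "graft a (Leaf b) t = map_btree id (id(a := b)) t"
  by (induction t) auto

lemma graft_graft_sequential:
  "b \<notin> leaves s - {a} \<Longrightarrow> graft b u (graft a t s) = graft a (graft b u t) s"
  by (induction s) auto

lemma graft_graft_parallel:
  "a \<noteq> b \<Longrightarrow> b \<notin> leaves t \<Longrightarrow> a \<notin> leaves u \<Longrightarrow> graft b u (graft a t s) = graft a t (graft b u s)"
  by (induction s) (auto simp: graft_notin)

lemma insert_trees_closed:
  assumes "composable I a J" "v \<in> tree_space X I" "w \<in> tree_space X J"
  shows "insert_trees a v w \<in> tree_space X (I - {a} \<union> J)"
proof -
  have "Poly_Mapping.keys (lin_ext (\<lambda>t. basis (graft a t s) :: _ \<Rightarrow>\<^sub>0 'b) w) \<subseteq> trees X (I - {a} \<union> J)"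
    if "s \<in> trees X I" for s
    using assms graft_mem_trees[OF assms(1) that] by (intro subset_trans[OF keys_lin_ext]) auto
  then show ?thesis
    unfolding insert_trees_def mem_Collect_eq
    by (intro subset_trans[OF keys_lin_ext]) (use assms in auto)
qed

lemma symmetric_operad_tree: "symmetric_operad (tree_operad X :: ('k::field, ('e, nat) btree \<Rightarrow>\<^sub>0 'k) operad)"
proof
  note lin = insert_trees_linear lin_ext_add lin_ext_fscale
  let ?P = "tree_operad X :: ('k, ('e, nat) btree \<Rightarrow>\<^sub>0 'k) operad"
  show "is_vspace (space ?P I)" for I
    by (simp add: is_vspace_free)
  show "is_linear (space ?P I) (space ?P (f ` I)) (relabel ?P I f)" if "inj_on f I" for I f
    using that by (auto intro!: linear_lin_ext map_mem_trees)
  show "relabel ?P I f x = relabel ?P I g x"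
    if "\<And>i. i \<in> I \<Longrightarrow> f i = g i" "x \<in> ops ?P I" for I f g x
  proof -
    have "map_btree id f t = map_btree id g t" if "t \<in> trees X I" for t
      using that \<open>\<And>i. i \<in> I \<Longrightarrow> f i = g i\<close> leaves_trees[OF that] by (intro btree.map_cong0) auto
    then show ?thesis using that by (auto intro!: lin_ext_cong)
  qed
  show "relabel ?P I id x = x" for I x
    by (simp add: btree.map_id lin_ext_id)
  show "relabel ?P (f ` I) g (relabel ?P I f x) = relabel ?P I (g \<circ> f) x" for I f g x
    by (simp add: lin_ext_lin_ext btree.map_comp)
  show "is_linear (space ?P I) (space ?P (I - {a} \<union> J)) (\<lambda>x. compose ?P I a J x y)"
    if "composable I a J" "y \<in> ops ?P J" for I a J y
    using that by (simp add: is_linear_def insert_trees_linear insert_trees_closed[simplified])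
  show "is_linear (space ?P J) (space ?P (I - {a} \<union> J)) (compose ?P I a J x)"
    if "composable I a J" "x \<in> ops ?P I" for I a J x
    using that by (simp add: is_linear_def insert_trees_linear insert_trees_closed[simplified])
  show "unit ?P a \<in> ops ?P {a}" "relabel ?P {a} f (unit ?P a) = unit ?P (f a)" for a f
    by simp_all
  show "compose ?P {a} a J (unit ?P a) y = y" for a J y
    by (simp add: insert_trees_def lin_ext_id)
  show "compose ?P I a {b} x (unit ?P b) = relabel ?P I (id(a := b)) x" for I a b x
    by (simp add: insert_trees_def graft_leaf)
  show "compose ?P (f ` I) (f a) (g ` J) (relabel ?P I f x) (relabel ?P J g y) =
      relabel ?P (I - {a} \<union> J) (\<lambda>i. if i \<in> J then g i else f i) (compose ?P I a J x y)"
    if c: "composable I a J" "inj_on f I" and x: "x \<in> ops ?P I" and y: "y \<in> ops ?P J"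
    for I a J f g x y
  proof -
    have "graft (f a) (map_btree id g t) (map_btree id f s) =
        map_btree id (\<lambda>i. if i \<in> J then g i else f i) (graft a t s)"
      if "s \<in> trees X I" "t \<in> trees X J" for s t
      using map_graft[of f s a t id g] c that by (simp add: trees_def composable_def)
    then show ?thesis
      using x y by (auto simp: insert_trees_def lin_ext_lin_ext subset_iff intro!: lin_ext_cong)
  qed
  show "compose ?P (I - {a} \<union> J) b L (compose ?P I a J x y) z =
      compose ?P I a (J - {b} \<union> L) x (compose ?P J b L y z)"
    if c: "composable I a J" "composable J b L" and x: "x \<in> ops ?P I" for I a J b L x y z
  proof -
    have "graft b u (graft a t s) = graft a (graft b u t) s" if "s \<in> trees X I" for s t u
      using c that by (intro graft_graft_sequential) (auto simp: trees_def composable_def)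
    then show ?thesis
      using x by (auto simp: insert_trees_def lin_ext_lin_ext subset_iff intro!: lin_ext_cong)
  qed
  show "compose ?P (I - {a} \<union> J) b L (compose ?P I a J x y) z =
      compose ?P (I - {b} \<union> L) a J (compose ?P I b L x z) y"
    if c: "composable I a J" "composable I b L" "a \<noteq> b" and y: "y \<in> ops ?P J" and z: "z \<in> ops ?P L"
    for I a J b L x y z
  proof -
    have "graft b u (graft a t s) = graft a t (graft b u s)" if "t \<in> trees X J" "u \<in> trees X L" for s t u
      using c that by (intro graft_graft_parallel) (auto simp: trees_def composable_def)
    then have "lin_ext (\<lambda>t. lin_ext (\<lambda>u. basis (graft b u (graft a t s))) z) y =
        lin_ext (\<lambda>u. lin_ext (\<lambda>t. basis (graft a t (graft b u s)) :: _ \<Rightarrow>\<^sub>0 'k) y) z" for s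
      using y z by (subst lin_ext_swap) (auto simp: subset_iff intro!: lin_ext_cong)
    then show ?thesis
      by (simp add: insert_trees_def lin_ext_lin_ext)
  qed
qed

section \<open>Free and quadratic operads\<close>

definition s2_hom :: "('k::field, 'e) s2_module \<Rightarrow> ('k, 'f) s2_module \<Rightarrow> ('e \<Rightarrow> 'f) \<Rightarrow> bool" where
  "s2_hom E F \<psi> \<longleftrightarrow> is_linear E F \<psi> \<and> (\<forall>e\<in>vecs E. \<psi> (swap E e) = swap F (\<psi> e))"

text \<open>Just enough structure for the free relations to be combinations of trees with labels in
  \<open>vecs E\<close>.\<close>

definition closed_s2_module :: "('k::field, 'e) s2_module \<Rightarrow> bool" where
  "closed_s2_module E \<longleftrightarrow>
     (\<forall>e\<in>vecs E. \<forall>f\<in>vecs E. vadd E e f \<in> vecs E) \<and> (\<forall>c. \<forall>e\<in>vecs E. vscale E c e \<in> vecs E) \<and>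
     (\<forall>e\<in>vecs E. swap E e \<in> vecs E)"

lemma mem_free_relations:
  "v \<in> free_relations E I \<longleftrightarrow>
     (\<exists>a b. a \<noteq> b \<and> I = {a, b} \<and>
       ((\<exists>e\<in>vecs E. \<exists>f\<in>vecs E. v = basis (Node (vadd E e f) (Leaf a) (Leaf b)) -
           basis (Node e (Leaf a) (Leaf b)) - basis (Node f (Leaf a) (Leaf b))) \<or>
        (\<exists>k. \<exists>e\<in>vecs E. v = basis (Node (vscale E k e) (Leaf a) (Leaf b)) -
           fscale k (basis (Node e (Leaf a) (Leaf b)))) \<or>
        (\<exists>e\<in>vecs E. v = basis (Node (swap E e) (Leaf a) (Leaf b)) - basis (Node e (Leaf b) (Leaf a)))))"
  unfolding free_relations_def Let_def by fastforce

lemma free_relations_cases [consumes 1, case_names add scale swap]: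
  assumes "v \<in> free_relations E I"
  obtains
    a b e f where "a \<noteq> b" "I = {a, b}" "e \<in> vecs E" "f \<in> vecs E"
      "v = basis (Node (vadd E e f) (Leaf a) (Leaf b)) - basis (Node e (Leaf a) (Leaf b)) -
        basis (Node f (Leaf a) (Leaf b))"
  | a b k e where "a \<noteq> b" "I = {a, b}" "e \<in> vecs E"
      "v = basis (Node (vscale E k e) (Leaf a) (Leaf b)) - fscale k (basis (Node e (Leaf a) (Leaf b)))"
  | a b e where "a \<noteq> b" "I = {a, b}" "e \<in> vecs E"
      "v = basis (Node (swap E e) (Leaf a) (Leaf b)) - basis (Node e (Leaf b) (Leaf a))"
  using assms unfolding mem_free_relations by (elim exE conjE disjE bexE) assumption+

lemma free_relations_intros:
  assumes "a \<noteq> b" "e \<in> vecs E"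
  shows "f \<in> vecs E \<Longrightarrow> basis (Node (vadd E e f) (Leaf a) (Leaf b)) - basis (Node e (Leaf a) (Leaf b)) -
      basis (Node f (Leaf a) (Leaf b)) \<in> free_relations E {a, b}"
    and "basis (Node (vscale E k e) (Leaf a) (Leaf b)) - fscale k (basis (Node e (Leaf a) (Leaf b)))
      \<in> free_relations E {a, b}"
    and "basis (Node (swap E e) (Leaf a) (Leaf b)) - basis (Node e (Leaf b) (Leaf a))
      \<in> free_relations E {a, b}"
  unfolding mem_free_relations using assms
  by (intro exI[of _ a] exI[of _ b] conjI refl disjI1 disjI2; force)+

lemma keys_subset_diff:
  "Poly_Mapping.keys v \<subseteq> S \<Longrightarrow> Poly_Mapping.keys w \<subseteq> S \<Longrightarrow>
   Poly_Mapping.keys (v - w :: 'a \<Rightarrow>\<^sub>0 'k::field) \<subseteq> S"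
  by (rule subset_trans[OF keys_diff]) simp

lemma free_relations_closed:
  assumes "closed_s2_module E"
  shows "free_relations E I \<subseteq> ops (tree_operad (vecs E)) I"
proof
  have [simp]: "Node e (Leaf a) (Leaf b) \<in> trees (vecs E) {a, b}"
    "Node e (Leaf b) (Leaf a) \<in> trees (vecs E) {a, b}" if "e \<in> vecs E" "a \<noteq> b" for e a b
    using that by (auto simp: trees_def)
  fix v assume "v \<in> free_relations E I"
  then show "v \<in> ops (tree_operad (vecs E)) I"
    using assms unfolding closed_s2_module_def
    by (cases rule: free_relations_cases) (simp_all add: keys_subset_diff keys_subset_fscale)
qed

lemma operad_with_ideal_free: "operad_with_ideal (tree_operad (vecs E)) (free_kernel E)"
  by (intro operad_with_ideal.intro operad_with_ideal_axioms.intro symmetric_operad_tree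
      symmetric_operad.operad_ideal_generated)

lemma symmetric_operad_free: "symmetric_operad (free_operad E)"
  unfolding free_operad_def by (rule operad_with_ideal.symmetric_operad_quot[OF operad_with_ideal_free])

abbreviation quadratic_ideal ::
    "('k::field, 'e) quadratic_data \<Rightarrow> nat set \<Rightarrow> (('e, nat) btree \<Rightarrow>\<^sub>0 'k) set set" where
  "quadratic_ideal D \<equiv>
     ideal_generated (free_operad (gens D)) (\<lambda>I. if I = {1, 2, 3} then rels D else {})"

lemma operad_with_ideal_quadratic: "operad_with_ideal (free_operad (gens D)) (quadratic_ideal D)"
  by (intro operad_with_ideal.intro operad_with_ideal_axioms.intro symmetric_operad_free
      symmetric_operad.operad_ideal_generated)

lemma symmetric_operad_quadratic: "symmetric_operad (quadratic_operad D)"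
  unfolding quadratic_operad_def
  by (rule operad_with_ideal.symmetric_operad_quot[OF operad_with_ideal_quadratic])

section \<open>Functoriality in the generators\<close>

definition map_labels ::
    "('e \<Rightarrow> 'f) \<Rightarrow> (('e, nat) btree \<Rightarrow>\<^sub>0 'k::field) \<Rightarrow> (('f, nat) btree \<Rightarrow>\<^sub>0 'k)" where
  "map_labels \<psi> = lin_ext (\<lambda>t. basis (map_btree \<psi> id t))"

lemma map_labels_basis [simp]: "map_labels \<psi> (basis t) = basis (map_btree \<psi> id t)"
  by (simp add: map_labels_def)

lemma map_labels_linear:
  "map_labels \<psi> (v + w) = map_labels \<psi> v + map_labels \<psi> w"
  "map_labels \<psi> (v - w) = map_labels \<psi> v - map_labels \<psi> w"
  "map_labels \<psi> (fscale c v) = fscale c (map_labels \<psi> v)"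
  by (simp_all add: map_labels_def lin_ext_add lin_ext_diff lin_ext_fscale)

lemma map_labels_inverse:
  assumes "\<And>e. e \<in> X \<Longrightarrow> \<chi> (\<psi> e) = e" "v \<in> tree_space X I"
  shows "map_labels \<chi> (map_labels \<psi> v) = v"
proof -
  have "map_btree (\<chi> \<circ> \<psi>) id t = t" if "t \<in> trees X I" for t
    using that assms(1) btree.map_cong0[of t "\<chi> \<circ> \<psi>" id id id]
    by (auto simp: trees_def btree.map_id subset_iff)
  then have "lin_ext (\<lambda>t. basis (map_btree (\<chi> \<circ> \<psi>) id t)) v = lin_ext basis v"
    using assms(2) by (intro lin_ext_cong) (auto simp: subset_iff)
  then show ?thesis
    by (simp add: map_labels_def lin_ext_lin_ext btree.map_comp lin_ext_id)
qed

lemma map_labels_graft: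
  "map_btree \<psi> id (graft a t s) = graft a (map_btree \<psi> id t) (map_btree \<psi> id s)"
  by (induction s) auto

lemma map_labels_insert:
  "map_labels \<psi> (insert_trees a v w) = insert_trees a (map_labels \<psi> v) (map_labels \<psi> w)"
  by (simp add: map_labels_def insert_trees_def lin_ext_lin_ext map_labels_graft)

lemma tree_operad_iso:
  assumes "\<And>e. e \<in> X \<Longrightarrow> \<psi> e \<in> Y \<and> \<chi> (\<psi> e) = e" "\<And>e. e \<in> Y \<Longrightarrow> \<chi> e \<in> X \<and> \<psi> (\<chi> e) = e"
  shows "operad_iso (tree_operad X) (tree_operad Y :: ('k::field, _) operad) (\<lambda>I. map_labels \<psi>)"
proof -
  have closed: "map_labels \<phi> ` tree_space U I \<subseteq> (tree_space V I :: (_ \<Rightarrow>\<^sub>0 'k) set)"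
    if "\<And>e. e \<in> U \<Longrightarrow> \<phi> e \<in> V" for I U V and \<phi> :: "'c \<Rightarrow> 'd"
  proof -
    have "map_btree \<phi> id t \<in> trees V I" if "t \<in> trees U I" for t
      using that \<open>\<And>e. e \<in> U \<Longrightarrow> \<phi> e \<in> V\<close> map_mem_trees[of t U I id \<phi> V] by auto
    then show ?thesis
      unfolding map_labels_def by (intro image_subsetI CollectI subset_trans[OF keys_lin_ext]) auto
  qed
  have "bij_betw (map_labels \<psi>) (tree_space X I) (tree_space Y I :: (_ \<Rightarrow>\<^sub>0 'k) set)" for I
    using assms by (intro bij_betw_byWitness[where f' = "map_labels \<chi>"] closed)
      (auto intro!: map_labels_inverse[of X] map_labels_inverse[of Y])
  moreover have "map_labels \<psi> (lin_ext (\<lambda>t. basis (map_btree id f t)) v) =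
      lin_ext (\<lambda>t. basis (map_btree id f t)) (map_labels \<psi> v)" for f and v :: "_ \<Rightarrow>\<^sub>0 'k"
    by (simp add: map_labels_def lin_ext_lin_ext btree.map_comp)
  moreover have "Poly_Mapping.keys (map_labels \<psi> v) \<subseteq> trees Y I"
    if "Poly_Mapping.keys v \<subseteq> trees X I" for I and v :: "_ \<Rightarrow>\<^sub>0 'k"
    using closed[of X \<psi> Y I] assms(1) that by (simp add: image_subset_iff)
  ultimately show ?thesis
    by (simp add: operad_iso_def is_linear_def map_labels_linear map_labels_insert)
qed

lemma map_free_relations:
  assumes "s2_hom E F \<psi>"
  shows "map_labels \<psi> ` free_relations E I \<subseteq> free_relations F I"
proof -
  have \<psi>: "\<And>e. e \<in> vecs E \<Longrightarrow> \<psi> e \<in> vecs F \<and> \<psi> (swap E e) = swap F (\<psi> e)"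
    "\<And>e f. e \<in> vecs E \<Longrightarrow> f \<in> vecs E \<Longrightarrow> \<psi> (vadd E e f) = vadd F (\<psi> e) (\<psi> f)"
    "\<And>c e. e \<in> vecs E \<Longrightarrow> \<psi> (vscale E c e) = vscale F c (\<psi> e)"
    using assms by (auto simp: s2_hom_def is_linear_def)
  show ?thesis
  proof (intro image_subsetI)
    fix v assume "v \<in> free_relations E I"
    then show "map_labels \<psi> v \<in> free_relations F I"
      by (cases rule: free_relations_cases)
        (simp_all add: map_labels_linear \<psi> free_relations_intros)
  qed
qed

locale s2_iso =
  fixes E :: "('k::field, 'e) s2_module" and F :: "('k, 'f) s2_module"
    and \<psi> :: "'e \<Rightarrow> 'f" and \<chi> :: "'f \<Rightarrow> 'e"
  assumes hom: "s2_hom E F \<psi>" "s2_hom F E \<chi>"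
    and inverse: "\<And>e. e \<in> vecs E \<Longrightarrow> \<chi> (\<psi> e) = e" "\<And>f. f \<in> vecs F \<Longrightarrow> \<psi> (\<chi> f) = f"
    and closed: "closed_s2_module E" "closed_s2_module F"
begin

lemma maps_to: "e \<in> vecs E \<Longrightarrow> \<psi> e \<in> vecs F" "f \<in> vecs F \<Longrightarrow> \<chi> f \<in> vecs E"
  using hom by (auto simp: s2_hom_def is_linear_def)

lemma iso_trees:
  "operad_iso (tree_operad (vecs E)) (tree_operad (vecs F) :: ('k, _) operad) (\<lambda>I. map_labels \<psi>)"
  by (rule tree_operad_iso[of _ _ _ \<chi>]) (simp_all add: maps_to inverse)

lemma image_free_kernel:
  assumes "finite I"
  shows "map_labels \<psi> ` free_kernel E I = free_kernel F I"
proof -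
  have "map_labels \<psi> ` free_relations E J = free_relations F J" for J
  proof
    show "free_relations F J \<subseteq> map_labels \<psi> ` free_relations E J"
    proof
      fix v assume v: "v \<in> free_relations F J"
      then have "map_labels \<psi> (map_labels \<chi> v) = v"
        using free_relations_closed[OF closed(2)] inverse
        by (intro map_labels_inverse[of "vecs F" _ _ _ J]) auto
      then show "v \<in> map_labels \<psi> ` free_relations E J"
        using v map_free_relations[OF hom(2), of J] by (metis imageI subsetD)
    qed
  qed (rule map_free_relations[OF hom(1)])
  moreover have "free_relations E J = {}" if "infinite J" for J
    using that by (auto simp: mem_free_relations)
  ultimately show ?thesis
    using ideal_generated_iso[OF symmetric_operad_tree symmetric_operad_tree iso_trees
        free_relations_closed[OF closed(1)] _ assms] by simp
qed

lemma iso_free: "operad_iso (free_operad E) (free_operad F) (\<lambda>I X. map_labels \<psi> ` X)"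
  unfolding free_operad_def
  by (rule operad_iso_quotient[OF operad_with_ideal_free operad_with_ideal_free iso_trees])
    (simp add: image_free_kernel)

text \<open>This reduces self-duality to arity three: it remains to match the two spaces of
  relations under an isomorphism of the generators.\<close>

lemma isomorphic_quadratic:
  assumes gens: "gens C = E" "gens D = F" and rels: "rels C \<subseteq> ops (free_operad E) {1, 2, 3}"
    "rels D = image (map_labels \<psi>) ` rels C"
  shows "isomorphic_operads (quadratic_operad C) (quadratic_operad D)"
proof -
  let ?rels = "\<lambda>D (I :: nat set). if I = {1, 2, 3} then rels D else {}"
  have "quadratic_ideal D I = image (map_labels \<psi>) ` quadratic_ideal C I" if I: "finite I" for I
  proof -
    have "ideal_generated (free_operad F) (\<lambda>J. image (map_labels \<psi>) ` ?rels C J) I =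
        image (map_labels \<psi>) ` ideal_generated (free_operad E) (?rels C) I"
      using rels(1) I by (intro ideal_generated_iso[OF symmetric_operad_free symmetric_operad_free iso_free])
        (auto split: if_splits)
    moreover have "(\<lambda>J. image (map_labels \<psi>) ` (if J = {1, 2, 3 :: nat} then rels C else {})) =
        (\<lambda>J. if J = {1, 2, 3} then rels D else {})"
      by (rule ext) (simp add: rels(2))
    ultimately show ?thesis using gens by simp
  qed
  then have "operad_iso (quadratic_operad C) (quadratic_operad D) (\<lambda>I X. image (map_labels \<psi>) ` X)"
    unfolding quadratic_operad_def
    using operad_with_ideal_quadratic[of C] operad_with_ideal_quadratic[of D] iso_free gens
    by (intro operad_iso_quotient) simp_all
  then show ?thesis
    unfolding isomorphic_operads_def
    using symmetric_operad_quadratic[of C] symmetric_operad_quadratic[of D] by blast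
qed

end

section \<open>The free operad on one binary operation\<close>

type_synonym 'k magma_comb = "('k \<times> 'k, nat) btree \<Rightarrow>\<^sub>0 'k"

lemma regular_s2_sel [simp]:
  "vecs regular_s2 = UNIV" "vzero regular_s2 = (0, 0)"
  "vadd regular_s2 u v = (fst u + fst v, snd u + snd v)"
  "vscale regular_s2 c u = (c * fst u, c * snd u)"
  "swap regular_s2 u = (snd u, fst u)"
  by (simp_all add: regular_s2_def)

lemma closed_regular_s2: "closed_s2_module regular_s2"
  by (simp add: closed_s2_module_def)

definition node_prod :: "'k::field magma_comb \<Rightarrow> 'k magma_comb \<Rightarrow> 'k magma_comb" (infixl "\<odot>" 75) where
  "v \<odot> w = lin_ext (\<lambda>s. lin_ext (\<lambda>t. basis (s \<star> t)) w) v"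

lemma node_prod_basis: "basis s \<odot> basis t = basis (s \<star> t)"
  by (simp add: node_prod_def)

lemma node_prod_linear:
  "(v + v') \<odot> w = v \<odot> w + v' \<odot> w" "(v - v') \<odot> w = v \<odot> w - v' \<odot> w"
  "fscale c v \<odot> w = fscale c (v \<odot> w)"
  "v \<odot> (w + w') = v \<odot> w + v \<odot> w'" "v \<odot> (w - w') = v \<odot> w - v \<odot> w'"
  "v \<odot> fscale c w = fscale c (v \<odot> w)"
proof -
  show "v \<odot> (w - w') = v \<odot> w - v \<odot> w'"
    using lin_ext_fun_add[of "\<lambda>s. lin_ext (\<lambda>t. basis (s \<star> t)) (w - w')"
        "\<lambda>s. lin_ext (\<lambda>t. basis (s \<star> t)) w'" v]
    by (simp add: node_prod_def lin_ext_diff)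
qed (simp_all add: node_prod_def lin_ext_add lin_ext_diff lin_ext_fscale lin_ext_fun_add lin_ext_fun_fscale)

lemma times_tree_mem: "s \<in> trees X I \<Longrightarrow> t \<in> trees X J \<Longrightarrow> (1, 0) \<in> X \<Longrightarrow> I \<inter> J = {} \<Longrightarrow>
    s \<star> t \<in> trees X (I \<union> J)"
  by (auto simp: times_tree_def trees_def)

lemma node_prod_closed:
  assumes "v \<in> tree_space X I" "w \<in> tree_space X J" "(1, 0) \<in> X" "I \<inter> J = {}"
  shows "v \<odot> w \<in> tree_space X (I \<union> J)"
proof -
  have "Poly_Mapping.keys (lin_ext (\<lambda>t. basis (s \<star> t)) w) \<subseteq> trees X (I \<union> J)" if "s \<in> trees X I" for s
    using assms times_tree_mem[OF that _ assms(3,4)] by (intro subset_trans[OF keys_lin_ext]) auto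
  then show ?thesis
    unfolding node_prod_def mem_Collect_eq
    by (intro subset_trans[OF keys_lin_ext]) (use assms in auto)
qed

lemma graft_times: "graft a u (s \<star> t) = graft a u s \<star> graft a u t"
  by (simp add: times_tree_def)

definition avoids :: "'l \<Rightarrow> (('e, 'l) btree \<Rightarrow>\<^sub>0 'k::zero) \<Rightarrow> bool" where
  "avoids a v \<longleftrightarrow> (\<forall>t\<in>Poly_Mapping.keys v. a \<notin> leaves t)"

lemma avoids_basis [simp]: "avoids a (basis t) \<longleftrightarrow> a \<notin> leaves t"
  by (simp add: avoids_def)

lemma avoids_tree_space: "v \<in> tree_space X I \<Longrightarrow> a \<notin> I \<Longrightarrow> avoids a v"
  by (auto simp: avoids_def trees_def)

lemma avoids_prod [simp]:
  assumes "avoids a v" "avoids a w"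
  shows "avoids a (v \<odot> w)"
proof -
  have "Poly_Mapping.keys (v \<odot> w) \<subseteq> {t. a \<notin> leaves t}"
    unfolding node_prod_def
    by (intro subset_trans[OF keys_lin_ext] UN_least)
      (use assms in \<open>auto simp: avoids_def times_tree_def\<close>)
  then show ?thesis by (auto simp: avoids_def)
qed

text \<open>Grafting at \<open>a\<close> acts only on the factor in which \<open>a\<close> occurs.
  In the first claim the sums over \<open>w\<close> and \<open>y\<close> have to be
  exchanged.\<close>

lemma insert_trees_prod:
  "avoids a w \<Longrightarrow> insert_trees a (v \<odot> w) y = insert_trees a v y \<odot> w"
  "avoids a v \<Longrightarrow> insert_trees a (v \<odot> w) y = v \<odot> insert_trees a w y"
proof -
  assume "avoids a w"
  then have "lin_ext (\<lambda>t. lin_ext (\<lambda>u. basis (graft a u s \<star> graft a u t)) y) w =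
      lin_ext (\<lambda>u. lin_ext (\<lambda>t. basis (graft a u s \<star> t)) w) y" for s
    by (subst lin_ext_swap) (auto simp: avoids_def graft_notin intro!: lin_ext_cong)
  then show "insert_trees a (v \<odot> w) y = insert_trees a v y \<odot> w"
    by (simp add: insert_trees_def node_prod_def lin_ext_lin_ext graft_times)
next
  assume "avoids a v"
  then show "insert_trees a (v \<odot> w) y = v \<odot> insert_trees a w y"
    by (auto simp: insert_trees_def node_prod_def lin_ext_lin_ext graft_times avoids_def graft_notin
        intro!: lin_ext_cong)
qed

lemma insert_trees_leaf [simp]: "insert_trees a (basis (Leaf a)) w = w"
  by (simp add: insert_trees_def lin_ext_id)

lemma relabel_prod:
  "lin_ext (\<lambda>t. basis (map_btree id f t)) (v \<odot> w) =
   lin_ext (\<lambda>t. basis (map_btree id f t)) v \<odot> lin_ext (\<lambda>t. basis (map_btree id f t)) w"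
  by (simp add: node_prod_def lin_ext_lin_ext times_tree_def)

text \<open>
  Since the regular representation is free, \<open>\<F>(E)\<close> has the basis of all trees with labels
  \<open>(1, 0)\<close>. The coordinates of a tree are obtained by expanding each label \<open>(\<alpha>, \<beta>)\<close>.
\<close>

primrec expand :: "('k::field \<times> 'k, nat) btree \<Rightarrow> 'k magma_comb" where
  "expand (Leaf i) = basis (Leaf i)"
| "expand (Node e s t) = fscale (fst e) (expand s \<odot> expand t) + fscale (snd e) (expand t \<odot> expand s)"

abbreviation magma_trees :: "nat set \<Rightarrow> ('k::field \<times> 'k, nat) btree set" where
  "magma_trees \<equiv> trees {(1, 0)}"

lemma expand_closed: "t \<in> trees X I \<Longrightarrow> expand t \<in> tree_space {(1, 0)} I"
proof (induction t arbitrary: I)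
  case (Node e s t)
  have st: "expand s \<odot> expand t \<in> tree_space {(1, 0)} I" "expand t \<odot> expand s \<in> tree_space {(1, 0)} I"
    using Node.prems node_prod_closed[OF Node.IH(1)[of "leaves s"] Node.IH(2)[of "leaves t"]]
      node_prod_closed[OF Node.IH(2)[of "leaves t"] Node.IH(1)[of "leaves s"]]
    by (auto simp: node_mem_trees Un_commute Int_commute)
  then show ?case by (simp add: keys_subset_add keys_subset_fscale)
qed simp

lemma lin_ext_closed:
  assumes "\<And>t. t \<in> S \<Longrightarrow> Poly_Mapping.keys (f t) \<subseteq> T" "Poly_Mapping.keys v \<subseteq> S"
  shows "Poly_Mapping.keys (lin_ext f v) \<subseteq> T"
  by (rule subset_trans[OF keys_lin_ext]) (use assms in blast)

lemma lin_ext_expand_closed: "v \<in> tree_space X I \<Longrightarrow> lin_ext expand v \<in> tree_space {(1, 0)} I"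
  using lin_ext_closed[of "trees X I" expand "trees {(1, 0)} I" v] expand_closed by blast

lemma tree_space_mono: "X \<subseteq> Y \<Longrightarrow> tree_space X I \<subseteq> tree_space Y I"
proof -
  assume "X \<subseteq> Y"
  then have "trees X I \<subseteq> trees Y I" by (auto simp: trees_def)
  then show ?thesis by auto
qed

lemma expand_graft:
  assumes "t \<in> trees X I" "a \<in> I"
  shows "expand (graft a u t) = insert_trees a (expand t) (expand u)"
  using assms
proof (induction t arbitrary: I)
  case (Leaf i)
  then show ?case by (simp add: insert_trees_def lin_ext_id)
next
  case (Node e s t)
  then have st: "s \<in> trees X (leaves s)" "t \<in> trees X (leaves t)" "leaves s \<inter> leaves t = {}"
    "a \<in> leaves s \<or> a \<in> leaves t"
    by (auto simp: node_mem_trees)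
  note av = avoids_tree_space[OF expand_closed[OF st(1)]] avoids_tree_space[OF expand_closed[OF st(2)]]
  show ?case
  proof (cases "a \<in> leaves s")
    case True
    then have "a \<notin> leaves t" using st by blast
    then show ?thesis
      using True Node.IH(1)[OF st(1)] by (simp add: graft_notin insert_trees_linear insert_trees_prod av)
  next
    case False
    then show ?thesis
      using st(4) Node.IH(2)[OF st(2)] by (simp add: graft_notin insert_trees_linear insert_trees_prod av)
  qed
qed

lemma expand_map: "expand (map_btree id f t) = lin_ext (\<lambda>t. basis (map_btree id f t)) (expand t)"
  by (induction t) (simp_all add: lin_ext_add lin_ext_fscale relabel_prod[unfolded id_def])

lemma lin_ext_expand_insert:
  assumes "composable I a J" "v \<in> tree_space X I"
  shows "lin_ext expand (insert_trees a v w) = insert_trees a (lin_ext expand v) (lin_ext expand w)"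
proof -
  have "lin_ext (\<lambda>t. expand (graft a t s)) w = insert_trees a (expand s) (lin_ext expand w)"
    if "s \<in> trees X I" for s
  proof -
    have "lin_ext (\<lambda>t. expand (graft a t s)) w = lin_ext (\<lambda>t. insert_trees a (expand s) (expand t)) w"
      using assms(1) that by (intro lin_ext_cong) (simp_all add: expand_graft composable_def)
    also have "\<dots> = insert_trees a (expand s) (lin_ext expand w)"
      by (rule apply_lin_ext[symmetric]) (simp_all add: insert_trees_linear)
    finally show ?thesis .
  qed
  then have "lin_ext (\<lambda>s. lin_ext (\<lambda>t. expand (graft a t s)) w) v =
      lin_ext (\<lambda>s. insert_trees a (expand s) (lin_ext expand w)) v"
    using assms(2) by (intro lin_ext_cong) auto
  also have "\<dots> = insert_trees a (lin_ext expand v) (lin_ext expand w)"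
    by (rule apply_lin_ext[symmetric]) (simp_all add: insert_trees_linear)
  finally show ?thesis by (simp add: insert_trees_def lin_ext_lin_ext)
qed

text \<open>\<open>expand\<close> commutes with relabelling and grafting, so the vectors with
  vanishing coordinates are closed under both. The ideal serves as an upper bound for
  \<open>free_kernel\<close>.\<close>

lemma expand_kernel_ideal:
  "operad_ideal (tree_operad UNIV) (\<lambda>I. {v :: 'k::field magma_comb. v \<in> tree_space UNIV I \<and> lin_ext expand v = 0})"
  unfolding operad_ideal_def
proof (intro conjI allI impI ballI)
  let ?P = "tree_operad UNIV :: ('k, 'k magma_comb) operad"
  let ?N = "\<lambda>I. {v :: 'k magma_comb. v \<in> tree_space UNIV I \<and> lin_ext expand v = 0}"
  interpret P: symmetric_operad ?P by (rule symmetric_operad_tree)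
  show "is_subspace (space ?P I) (?N I)" for I
    by (simp add: is_subspace_def lin_ext_add lin_ext_fscale keys_subset_add keys_subset_fscale)
      blast
  show "relabel ?P I f v \<in> ?N (f ` I)"
    if "v \<in> ?N I" "finite I \<and> inj_on f I" for I f v
  proof -
    have "lin_ext expand (relabel ?P I f v) = relabel ?P I f (lin_ext expand v)"
      by (simp add: lin_ext_lin_ext expand_map)
    then show ?thesis using that P.relabel_closed[of I f v] by simp
  qed
  fix I a J v w assume c: "composable I a J"
  {
    assume "v \<in> ?N I" "w \<in> ops ?P J"
    then show "compose ?P I a J v w \<in> ?N (I - {a} \<union> J)"
      using c insert_trees_closed[OF c, of v UNIV w] lin_ext_expand_insert[OF c, of v UNIV w]
      by (simp add: insert_trees_linear)
  next
    assume "v \<in> ops ?P I" "w \<in> ?N J"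
    then show "compose ?P I a J v w \<in> ?N (I - {a} \<union> J)"
      using c insert_trees_closed[OF c, of v UNIV w] lin_ext_expand_insert[OF c, of v UNIV w]
      by (simp add: insert_trees_linear)
  }
qed

lemma expand_free_relations: "v \<in> free_relations regular_s2 I \<Longrightarrow> lin_ext expand v = 0"
  by (cases rule: free_relations_cases, assumption)
    (simp_all add: lin_ext_diff lin_ext_fscale node_prod_basis add_fscale fscale_add fscale_fscale)

text \<open>Hence coordinates are well defined on classes in the free operad. The converse
  direction, that a vector and its expansion are in the same class, is
  \<open>diff_expand\<close>.\<close>

lemma expand_free_kernel:
  assumes "v \<in> free_kernel regular_s2 I"
  shows "lin_ext expand v = 0"
proof -
  have "free_relations regular_s2 J \<subseteq> {v \<in> tree_space UNIV J. lin_ext expand v = 0}" for J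
    using free_relations_closed[OF closed_regular_s2, of J] expand_free_relations by auto
  then have "free_kernel regular_s2 I \<subseteq> {v \<in> tree_space UNIV I. lin_ext expand v = 0}"
    unfolding regular_s2_sel by (intro ideal_generated_least[OF expand_kernel_ideal])
  then show ?thesis using assms by auto
qed

section \<open>Congruences on trees\<close>

text \<open>Such an \<open>N\<close> is an ideal of the free operad, seen on representatives.
  Instances are the free kernel itself and the preimages of ideals under \<open>cls\<close>, in
  particular \<open>wl_kernel\<close>.\<close>

locale tree_congruence =
  fixes N :: "nat set \<Rightarrow> ('k::field magma_comb) set"
  assumes ideal: "operad_ideal (tree_operad UNIV) N"
    and free_relations: "free_relations regular_s2 I \<subseteq> N I"
begin

lemma mem_space: "finite I \<Longrightarrow> v \<in> N I \<Longrightarrow> v \<in> tree_space UNIV I"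
  using operad_idealD(2)[OF ideal] by simp

lemma zero [simp]: "finite I \<Longrightarrow> 0 \<in> N I"
  and add: "finite I \<Longrightarrow> v \<in> N I \<Longrightarrow> w \<in> N I \<Longrightarrow> v + w \<in> N I"
  and fscale: "finite I \<Longrightarrow> v \<in> N I \<Longrightarrow> fscale c v \<in> N I"
  using operad_idealD(1)[OF ideal, of I] by (simp_all add: is_subspace_def)

lemma uminus: "finite I \<Longrightarrow> v \<in> N I \<Longrightarrow> - v \<in> N I"
  using fscale[of I v "- 1"] by (simp add: fscale_uminus)

lemma diff: "finite I \<Longrightarrow> v \<in> N I \<Longrightarrow> w \<in> N I \<Longrightarrow> v - w \<in> N I"
  using add[of I v "- w"] uminus[of I w] by simp

lemma fscale_cancel: "finite I \<Longrightarrow> fscale c v \<in> N I \<Longrightarrow> c \<noteq> 0 \<Longrightarrow> v \<in> N I"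
  using fscale[of I "fscale c v" "inverse c"] by (simp add: fscale_fscale)

lemma insert_left: "composable I a J \<Longrightarrow> v \<in> N I \<Longrightarrow> w \<in> tree_space UNIV J \<Longrightarrow>
    insert_trees a v w \<in> N (I - {a} \<union> J)"
  using operad_idealD(4)[OF ideal] by simp

lemma insert_right: "composable I a J \<Longrightarrow> v \<in> tree_space UNIV I \<Longrightarrow> w \<in> N J \<Longrightarrow>
    insert_trees a v w \<in> N (I - {a} \<union> J)"
  using operad_idealD(5)[OF ideal] by simp

text \<open>A relation between operations in two fresh inputs becomes a relation between arbitrary
  arguments. Freshness keeps both insertions composable.\<close>

lemma insert_two_leaves:
  assumes r: "r \<in> N {a, b}" and ab: "a \<noteq> b" "b \<notin> I"
    and v: "v \<in> tree_space UNIV I" and w: "w \<in> tree_space UNIV J"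
    and fin: "finite I" "finite J" "I \<inter> J = {}"
  shows "insert_trees b (insert_trees a r v) w \<in> N (I \<union> J)"
proof -
  have "insert_trees a r v \<in> N ({a, b} - {a} \<union> I)"
    using ab fin v by (intro insert_left r) (auto simp: composable_def)
  moreover have "{a, b} - {a} \<union> I = insert b I" using ab by auto
  ultimately have "insert_trees b (insert_trees a r v) w \<in> N (insert b I - {b} \<union> J)"
    using ab fin w by (intro insert_left) (auto simp: composable_def)
  then show ?thesis using ab by simp
qed

lemma fresh_nat: "finite (A :: nat set) \<Longrightarrow> \<exists>a. a \<notin> A"
  by (rule ex_new_if_finite) simp_all

lemma fresh_nats:
  assumes "finite (A :: nat set)"
  obtains a b c where "a \<notin> A" "b \<notin> A" "c \<notin> A" "a \<noteq> b" "a \<noteq> c" "b \<noteq> c"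
proof -
  obtain a where a: "a \<notin> A" using fresh_nat[OF assms] ..
  obtain b where b: "b \<notin> insert a A" using fresh_nat[of "insert a A"] assms by auto
  obtain c where "c \<notin> insert a (insert b A)" using fresh_nat[of "insert a (insert b A)"] assms by auto
  with a b show ?thesis by (intro that[of a b c]) auto
qed

text \<open>A product is \<open>Leaf a \<star> Leaf b\<close> with two fresh inputs into which
  \<open>v\<close> and \<open>w\<close> are inserted, so the closure of ideals under composition
  applies.\<close>

lemma node_prod_left:
  assumes "v \<in> N I" "w \<in> tree_space UNIV J" "finite I" "finite J" "I \<inter> J = {}"
  shows "v \<odot> w \<in> N (I \<union> J)"
proof -
  obtain a b :: nat where ab: "a \<notin> I \<union> J" "b \<notin> I \<union> J" "a \<noteq> b"
    by (rule fresh_nats[of "I \<union> J"]) (use assms in auto)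
  have leaf: "basis (Leaf a \<star> Leaf b) \<in> tree_space UNIV {a, b}"
    using ab by (auto simp: times_tree_def trees_def)
  have "insert_trees a (basis (Leaf a \<star> Leaf b)) v \<in> N ({a, b} - {a} \<union> I)"
    using ab assms leaf by (intro insert_right) (auto simp: composable_def)
  moreover have "{a, b} - {a} \<union> I = insert b I" using ab by auto
  ultimately have "insert_trees b (insert_trees a (basis (Leaf a \<star> Leaf b)) v) w \<in> N (insert b I - {b} \<union> J)"
    using ab assms by (intro insert_left) (auto simp: composable_def)
  then show ?thesis
    using ab assms mem_space[of I v] avoids_tree_space[of v UNIV I b]
    by (simp add: insert_trees_prod flip: node_prod_basis)
qed

lemma node_prod_right:
  assumes "v \<in> tree_space UNIV I" "w \<in> N J" "finite I" "finite J" "I \<inter> J = {}"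
  shows "v \<odot> w \<in> N (I \<union> J)"
proof -
  obtain a b :: nat where ab: "a \<notin> I \<union> J" "b \<notin> I \<union> J" "a \<noteq> b"
    by (rule fresh_nats[of "I \<union> J"]) (use assms in auto)
  have leaf: "basis (Leaf a \<star> Leaf b) \<in> tree_space UNIV {a, b}"
    using ab by (auto simp: times_tree_def trees_def)
  have "insert_trees a (basis (Leaf a \<star> Leaf b)) v \<in> tree_space UNIV ({a, b} - {a} \<union> I)"
    using ab assms leaf by (intro insert_trees_closed) (auto simp: composable_def)
  moreover have "{a, b} - {a} \<union> I = insert b I" using ab by auto
  ultimately have "insert_trees b (insert_trees a (basis (Leaf a \<star> Leaf b)) v) w \<in> N (insert b I - {b} \<union> J)"
    using ab assms by (intro insert_right) (auto simp: composable_def)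
  then show ?thesis
    using ab assms avoids_tree_space[of v UNIV I b]
    by (simp add: insert_trees_prod flip: node_prod_basis)
qed

lemma node_expand:
  assumes s: "s \<in> trees UNIV I" and t: "t \<in> trees UNIV J" and IJ: "I \<inter> J = {}"
  shows "basis (Node e s t) - fscale (fst e) (basis (s \<star> t)) - fscale (snd e) (basis (t \<star> s)) \<in> N (I \<union> J)"
proof -
  have fin: "finite I" "finite J" using s t by (auto dest: trees_finite)
  obtain a b :: nat where ab: "a \<notin> I \<union> J" "b \<notin> I \<union> J" "a \<noteq> b"
    by (rule fresh_nats[of "I \<union> J"]) (use fin in auto)
  let ?c = "\<lambda>e. basis (Node e (Leaf a) (Leaf b)) :: 'k magma_comb"
  let ?d = "basis (Node (1, 0) (Leaf b) (Leaf a)) :: 'k magma_comb"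
  note rel = free_relations_intros[OF ab(3), of _ regular_s2, THEN subsetD[OF free_relations]]
  \<comment> \<open>The label is split as (fst e, 0) + (0, snd e), the scalars are taken out, and
    (0, 1) is the swap of (1, 0). These are the three kinds of free relations in turn.\<close>
  have 1: "?c e - ?c (fst e, 0) - ?c (0, snd e) \<in> N {a, b}"
    using rel(1)[of "(fst e, 0)" "(0, snd e)"] by simp
  have 2: "?c (fst e, 0) - fscale (fst e) (?c (1, 0)) \<in> N {a, b}"
    "?c (0, snd e) - fscale (snd e) (?c (0, 1)) \<in> N {a, b}"
    using rel(2)[of "(1, 0)" "fst e"] rel(2)[of "(0, 1)" "snd e"] by simp_all
  have 3: "?c (0, 1) - ?d \<in> N {a, b}"
    using rel(3)[of "(1, 0)"] by simp
  have "(?c e - ?c (fst e, 0) - ?c (0, snd e)) + (?c (fst e, 0) - fscale (fst e) (?c (1, 0))) +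
      (?c (0, snd e) - fscale (snd e) (?c (0, 1))) + fscale (snd e) (?c (0, 1) - ?d) \<in> N {a, b}"
    by (intro add fscale 1 2 3) simp_all
  then have "?c e - fscale (fst e) (?c (1, 0)) - fscale (snd e) ?d \<in> N {a, b}" (is "?r \<in> _")
    by (simp add: fscale_diff)
  then have "insert_trees b (insert_trees a ?r (basis s)) (basis t) \<in> N (I \<union> J)"
    using ab s t fin IJ by (intro insert_two_leaves) auto
  moreover have "graft b t s = s"
    using ab s by (intro graft_notin) (auto simp: trees_def)
  ultimately show ?thesis
    using ab by (simp add: insert_trees_linear times_tree_def)
qed

text \<open>One vertex is expanded by \<open>node_expand\<close>; then the two factors of each
  product are replaced by their expansions one at a time, as products respect the
  congruence.\<close>

lemma diff_expand_tree:
  assumes "t \<in> trees UNIV I"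
  shows "basis t - expand t \<in> N I"
  using assms
proof (induction t arbitrary: I)
  case (Leaf i)
  then show ?case by simp
next
  case (Node e s t)
  let ?I = "leaves s" and ?J = "leaves t"
  have st: "s \<in> trees UNIV ?I" "t \<in> trees UNIV ?J" "?I \<inter> ?J = {}" and I: "I = ?I \<union> ?J"
    using Node.prems by (auto simp: node_mem_trees)
  have fin: "finite ?I" "finite ?J" using st by (auto dest: trees_finite)
  have ex: "expand s \<in> tree_space UNIV ?I" "expand t \<in> tree_space UNIV ?J"
    using expand_closed[OF st(1)] expand_closed[OF st(2)] tree_space_mono[of "{(1, 0)}" UNIV] by blast+
  note IH = Node.IH(1)[OF st(1)] Node.IH(2)[OF st(2)]
  have "basis (s \<star> t) - expand s \<odot> expand t =
      (basis s - expand s) \<odot> basis t + expand s \<odot> (basis t - expand t)"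
    by (simp add: node_prod_linear node_prod_basis)
  then have 1: "basis (s \<star> t) - expand s \<odot> expand t \<in> N I"
    using st ex fin IH unfolding I by (simp add: add node_prod_left node_prod_right)
  have "basis (t \<star> s) - expand t \<odot> expand s =
      (basis t - expand t) \<odot> basis s + expand t \<odot> (basis s - expand s)"
    by (simp add: node_prod_linear node_prod_basis)
  then have 2: "basis (t \<star> s) - expand t \<odot> expand s \<in> N I"
    using st ex fin IH unfolding I Un_commute[of ?I ?J]
    by (simp add: add node_prod_left node_prod_right Int_commute)
  have "basis (Node e s t) - expand (Node e s t) =
      (basis (Node e s t) - fscale (fst e) (basis (s \<star> t)) - fscale (snd e) (basis (t \<star> s))) +
      fscale (fst e) (basis (s \<star> t) - expand s \<odot> expand t) +
      fscale (snd e) (basis (t \<star> s) - expand t \<odot> expand s)"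
    by (simp add: fscale_diff)
  moreover have "\<dots> \<in> N I"
    using node_expand[OF st, of e] 1 2 fin unfolding I by (simp add: add fscale)
  ultimately show ?case by (simp only:)
qed

lemma diff_expand:
  assumes "v \<in> tree_space UNIV I" "finite I"
  shows "v - lin_ext expand v \<in> N I"
proof -
  have "(\<Sum>t\<in>S. fscale (Poly_Mapping.lookup v t) (basis t - expand t)) \<in> N I"
    if "S \<subseteq> trees UNIV I" for S
    using that
    by (induction S rule: infinite_finite_induct) (auto intro!: add fscale diff_expand_tree assms(2) zero)
  from this[of "Poly_Mapping.keys v"] show ?thesis
    using assms(1) sum_basis[of v] by (simp add: lin_ext_def fscale_diff sum_subtractf)
qed

end

lemma tree_congruence_free_kernel: "tree_congruence (free_kernel (regular_s2 :: ('k::field, _) s2_module))"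
proof
  show "operad_ideal (tree_operad UNIV) (free_kernel (regular_s2 :: ('k, _) s2_module))"
    using symmetric_operad.operad_ideal_generated[OF symmetric_operad_tree] by simp
  show "free_relations regular_s2 I \<subseteq> free_kernel (regular_s2 :: ('k, _) s2_module) I" for I
  proof
    fix v :: "'k magma_comb" assume v: "v \<in> free_relations regular_s2 I"
    then have "v \<in> ops (tree_operad (vecs regular_s2)) I"
      using free_relations_closed[OF closed_regular_s2] by blast
    with v show "v \<in> free_kernel regular_s2 I" by (rule ideal_generated_generator)
  qed
qed

section \<open>Evaluation of trees by polynomials\<close>

text \<open>
  In the algebra of polynomials in \<open>d\<close> and \<open>\<epsilon>\<close>, read a leaf \<open>i\<close> as \<open>exp (d i * z)\<close>, a function of
  \<open>z\<close>, and the product \<open>ab\<close> as \<open>ab + \<epsilon> (a b' - a' b)\<close>. This is a weak Leibniz algebra, in which the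
  value of a tree with leaves \<open>I\<close> is a polynomial times \<open>exp ((\<Sum>i\<in>I. d i) * z)\<close>.
\<close>

primrec ev :: "(nat \<Rightarrow> 'k::field) \<Rightarrow> ('k \<times> 'k, nat) btree \<Rightarrow> 'k poly" where
  "ev d (Leaf i) = 1"
| "ev d (Node e s t) =
     [:fst e + snd e, (fst e - snd e) * (sum d (leaves t) - sum d (leaves s)):] * ev d s * ev d t"

definition evaluate :: "(nat \<Rightarrow> 'k::field) \<Rightarrow> 'k magma_comb \<Rightarrow> 'k poly" where
  "evaluate d v = (\<Sum>t\<in>Poly_Mapping.keys v. smult (Poly_Mapping.lookup v t) (ev d t))"

lemma smult_sum_right: "smult c (sum f S) = (\<Sum>i\<in>S. smult c (f i))"
  by (induction S rule: infinite_finite_induct) (simp_all add: smult_add_right)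

lemma evaluate_superset:
  assumes "finite S" "Poly_Mapping.keys v \<subseteq> S"
  shows "evaluate d v = (\<Sum>t\<in>S. smult (Poly_Mapping.lookup v t) (ev d t))"
  unfolding evaluate_def using assms by (intro sum.mono_neutral_left) (auto simp: in_keys_iff)

lemma evaluate_basis [simp]: "evaluate d (basis t) = ev d t"
  by (simp add: evaluate_def)

lemma evaluate_zero [simp]: "evaluate d 0 = 0"
  by (simp add: evaluate_def)

lemma evaluate_add: "evaluate d (v + w) = evaluate d v + evaluate d w"
  using evaluate_superset[of "Poly_Mapping.keys v \<union> Poly_Mapping.keys w" _ d] keys_add[of v w]
  by (simp add: lookup_add smult_add_left sum.distrib)

lemma evaluate_fscale: "evaluate d (fscale c v) = smult c (evaluate d v)"
  using evaluate_superset[of "Poly_Mapping.keys v" "fscale c v" d] keys_fscale[of c v]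
  by (simp add: evaluate_def smult_sum_right)

lemma evaluate_diff: "evaluate d (v - w) = evaluate d v - evaluate d w"
  using evaluate_add[of d v "fscale (- 1) w"] evaluate_fscale[of d "- 1" w]
  by (simp add: fscale_uminus)

lemma evaluate_lin_ext:
  "evaluate d (lin_ext f v) = (\<Sum>t\<in>Poly_Mapping.keys v. smult (Poly_Mapping.lookup v t) (evaluate d (f t)))"
proof -
  have "evaluate d (\<Sum>t\<in>S. fscale (c t) (f t)) = (\<Sum>t\<in>S. smult (c t) (evaluate d (f t)))" for S c
    by (induction S rule: infinite_finite_induct) (simp_all add: evaluate_add evaluate_fscale)
  then show ?thesis by (simp add: lin_ext_def)
qed

lemma ev_cong: "(\<And>i. i \<in> leaves t \<Longrightarrow> d i = d' i) \<Longrightarrow> ev d t = ev d' t"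
proof (induction t)
  case (Node e s t)
  have "sum d (leaves s) = sum d' (leaves s)" "sum d (leaves t) = sum d' (leaves t)"
    using Node.prems by (auto intro!: sum.cong)
  then show ?case using Node by simp
qed simp

lemma evaluate_cong:
  assumes "v \<in> tree_space UNIV I" "\<And>i. i \<in> I \<Longrightarrow> d i = d' i"
  shows "evaluate d v = evaluate d' v"
  unfolding evaluate_def using assms by (intro sum.cong refl arg_cong2[of _ _ _ _ smult] ev_cong) (auto simp: trees_def)

lemma finite_leaves [simp]: "finite (leaves t)"
  by (induction t) simp_all

lemma sum_leaves_graft:
  assumes "a \<in> leaves s" "(leaves s - {a}) \<inter> leaves t = {}"
  shows "sum d (leaves (graft a t s)) = sum (d(a := sum d (leaves t))) (leaves s)"
proof -
  have "sum d (leaves (graft a t s)) = sum d (leaves s - {a}) + sum d (leaves t)"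
    using assms by (simp add: leaves_graft sum.union_disjoint)
  moreover have "sum (d(a := sum d (leaves t))) (leaves s) = sum d (leaves t) + sum d (leaves s - {a})"
    using assms(1) by (subst sum.remove[of _ a]) (auto intro!: sum.cong)
  ultimately show ?thesis by (simp only: add.commute)
qed

text \<open>An inserted tree is a multiple of the exponential with frequency
  \<open>sum d (leaves t)\<close>, so the rest of the tree sees it as a leaf \<open>a\<close> with
  that frequency.\<close>

lemma ev_graft:
  assumes "multilinear_tree s" "a \<in> leaves s" "(leaves s - {a}) \<inter> leaves t = {}"
  shows "ev d (graft a t s) = ev (d(a := sum d (leaves t))) s * ev d t"
  using assms
proof (induction s)
  case (Node e u v)
  let ?d = "d(a := sum d (leaves t))"
  have same: "ev d w = ev ?d w" "sum d (leaves w) = sum ?d (leaves w)" if "a \<notin> leaves w" for w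
    using that by (auto intro!: ev_cong sum.cong)
  show ?case
  proof (cases "a \<in> leaves u")
    case True
    then have "a \<notin> leaves v" "(leaves u - {a}) \<inter> leaves t = {}" using Node.prems by auto
    then show ?thesis
      using True Node by (simp add: graft_notin sum_leaves_graft same[of v] mult_ac
        del: mult_pCons_left mult_pCons_right fun_upd_apply)
  next
    case False
    then have "a \<in> leaves v" "(leaves v - {a}) \<inter> leaves t = {}" using Node.prems by auto
    then show ?thesis
      using False Node by (simp add: graft_notin sum_leaves_graft same[of u] mult_ac
        del: mult_pCons_left mult_pCons_right fun_upd_apply)
  qed
qed simp

lemma evaluate_insert:
  assumes c: "composable I a J" and v: "v \<in> tree_space UNIV I" and w: "w \<in> tree_space UNIV J"
  shows "evaluate d (insert_trees a v w) = evaluate (d(a := sum d J)) v * evaluate d w"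
proof -
  have "ev d (graft a t s) = ev (d(a := sum d J)) s * ev d t"
    if "s \<in> Poly_Mapping.keys v" "t \<in> Poly_Mapping.keys w" for s t
    using that c v w by (subst ev_graft) (auto simp: trees_def composable_def)
  then show ?thesis
    unfolding evaluate_def[of _ v] evaluate_def[of _ w] sum_product insert_trees_def
    by (auto intro!: sum.cong simp: evaluate_lin_ext smult_sum_right mult.commute)
qed

lemma ev_map:
  "inj_on f (leaves t) \<Longrightarrow> ev d (map_btree id f t) = ev (d \<circ> f) t"
proof (induction t)
  case (Node e s t)
  have "inj_on f (leaves s)" "inj_on f (leaves t)"
    using Node.prems by (auto simp: inj_on_Un)
  then show ?case using Node.IH by (simp add: btree.set_map sum.reindex)
qed simp

lemma evaluate_relabel:
  assumes "inj_on f I" "v \<in> tree_space UNIV I"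
  shows "evaluate d (lin_ext (\<lambda>t. basis (map_btree id f t)) v) = evaluate (d \<circ> f) v"
  unfolding evaluate_lin_ext evaluate_def[of _ v]
  using assms by (intro sum.cong refl arg_cong2[of _ _ _ _ smult]) (auto simp: trees_def ev_map)

text \<open>All \<open>d\<close> are taken at once, because composition and relabelling change the
  frequencies; for a single \<open>d\<close> the kernel would not be visibly an ideal.\<close>

definition evaluation_kernel :: "nat set \<Rightarrow> 'k::field magma_comb set" where
  "evaluation_kernel I = {v \<in> tree_space UNIV I. \<forall>d. evaluate d v = 0}"

lemma evaluation_kernel_ideal: "operad_ideal (tree_operad UNIV) (evaluation_kernel :: _ \<Rightarrow> 'k::field magma_comb set)"
  unfolding operad_ideal_def
proof (intro conjI allI impI ballI)
  let ?P = "tree_operad UNIV :: ('k, 'k magma_comb) operad"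
  interpret P: symmetric_operad ?P by (rule symmetric_operad_tree)
  show "is_subspace (space ?P I) (evaluation_kernel I)" for I
    by (simp add: is_subspace_def evaluation_kernel_def evaluate_add evaluate_fscale
        keys_subset_add keys_subset_fscale) blast
  show "relabel ?P I f v \<in> evaluation_kernel (f ` I)"
    if "v \<in> evaluation_kernel I" "finite I \<and> inj_on f I" for I f v
    using that P.relabel_closed[of I f v] evaluate_relabel[of f I v]
    by (simp add: evaluation_kernel_def)
  fix I a J and v w :: "'k magma_comb" assume c: "composable I a J"
  {
    assume "v \<in> evaluation_kernel I" "w \<in> ops ?P J"
    then show "compose ?P I a J v w \<in> evaluation_kernel (I - {a} \<union> J)"
      using c insert_trees_closed[OF c, of v UNIV w] evaluate_insert[OF c, of v w]
      by (simp add: evaluation_kernel_def)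
  next
    assume "v \<in> ops ?P I" "w \<in> evaluation_kernel J"
    then show "compose ?P I a J v w \<in> evaluation_kernel (I - {a} \<union> J)"
      using c insert_trees_closed[OF c, of v UNIV w] evaluate_insert[OF c, of v w]
      by (simp add: evaluation_kernel_def)
  }
qed

lemma free_relations_evaluate: "free_relations regular_s2 I \<subseteq> evaluation_kernel I"
proof
  fix v assume v: "v \<in> free_relations regular_s2 I"
  then have "evaluate d v = 0" for d
    by (cases rule: free_relations_cases)
      (hypsubst, simp add: evaluate_diff evaluate_fscale, simp add: algebra_simps)+
  then show "v \<in> evaluation_kernel I"
    using v free_relations_closed[OF closed_regular_s2, of I] by (auto simp: evaluation_kernel_def)
qed

lemma identities_evaluate:
  "left_identity \<in> (evaluation_kernel {1, 2, 3} :: 'k::field magma_comb set)"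
  "right_identity \<in> (evaluation_kernel {1, 2, 3} :: 'k::field magma_comb set)"
proof -
  have "left_identity \<in> (tree_space UNIV {1, 2, 3} :: 'k magma_comb set)"
    "right_identity \<in> (tree_space UNIV {1, 2, 3} :: 'k magma_comb set)"
    unfolding left_identity_def right_identity_def Let_def mem_Collect_eq times_tree_def
    by (intro keys_subset_add keys_subset_diff keys_subset_fscale; auto simp: trees_def)+
  moreover have "evaluate d left_identity = 0" "evaluate d right_identity = 0" for d :: "nat \<Rightarrow> 'k"
    by (simp add: left_identity_def right_identity_def Let_def times_tree_def evaluate_add
        evaluate_diff evaluate_fscale, simp add: algebra_simps)+
  ultimately show "left_identity \<in> (evaluation_kernel {1, 2, 3} :: 'k magma_comb set)"
    "right_identity \<in> (evaluation_kernel {1, 2, 3} :: 'k magma_comb set)"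
    by (simp_all add: evaluation_kernel_def)
qed

section \<open>Weak Leibniz congruences\<close>

locale weak_leibniz_congruence = tree_congruence N for N :: "nat set \<Rightarrow> 'k::field magma_comb set" +
  assumes left_identity: "left_identity \<in> N {1, 2, 3}"
    and right_identity: "right_identity \<in> N {1, 2, 3}"

text \<open>The two identities as trilinear expressions, into which sums of trees can be
  substituted.\<close>

definition left_id :: "'k::field magma_comb \<Rightarrow> 'k magma_comb \<Rightarrow> 'k magma_comb \<Rightarrow> 'k magma_comb" where
  "left_id u v w = (u \<odot> v) \<odot> w - (v \<odot> u) \<odot> w - fscale 2 (u \<odot> (v \<odot> w)) + fscale 2 (v \<odot> (u \<odot> w))"

definition right_id :: "'k::field magma_comb \<Rightarrow> 'k magma_comb \<Rightarrow> 'k magma_comb \<Rightarrow> 'k magma_comb" where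
  "right_id u v w = u \<odot> (v \<odot> w) - u \<odot> (w \<odot> v) - fscale 2 ((u \<odot> v) \<odot> w) + fscale 2 ((u \<odot> w) \<odot> v)"

context weak_leibniz_congruence
begin

lemma ids_leaves:
  assumes "a \<noteq> b" "a \<noteq> c" "b \<noteq> c"
  shows "left_id (basis (Leaf a)) (basis (Leaf b)) (basis (Leaf c)) \<in> N {a, b, c}"
    and "right_id (basis (Leaf a)) (basis (Leaf b)) (basis (Leaf c)) \<in> N {a, b, c}"
proof -
  define f :: "nat \<Rightarrow> nat" where "f i = (if i = 1 then a else if i = 2 then b else c)" for i
  have f: "f 1 = a" "f 2 = b" "f 3 = c" "f (Suc 0) = a" by (simp_all add: f_def)
  have inj: "inj_on f {1, 2, 3}" "f ` {1, 2, 3} = {a, b, c}"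
    using assms f by (simp_all add: inj_on_def)
  have rel: "lin_ext (\<lambda>t. basis (map_btree id f t)) v \<in> N {a, b, c}" if "v \<in> N {1, 2, 3}" for v
    using operad_idealD(3)[OF ideal _ inj(1) that] inj(2) by simp
  show "left_id (basis (Leaf a)) (basis (Leaf b)) (basis (Leaf c)) \<in> N {a, b, c}"
    using rel[OF left_identity] f
    by (simp add: left_identity_def left_id_def Let_def lin_ext_add lin_ext_diff
        lin_ext_fscale times_tree_def node_prod_basis)
  show "right_id (basis (Leaf a)) (basis (Leaf b)) (basis (Leaf c)) \<in> N {a, b, c}"
    using rel[OF right_identity] f
    by (simp add: right_identity_def right_id_def Let_def lin_ext_add lin_ext_diff
        lin_ext_fscale times_tree_def node_prod_basis)
qed

lemma insert_three_leaves:
  assumes r: "r \<in> N {a, b, c}" and abc: "a \<noteq> b" "a \<noteq> c" "b \<noteq> c" "{a, b, c} \<inter> (I \<union> J \<union> K) = {}"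
    and u: "u \<in> tree_space UNIV I" and v: "v \<in> tree_space UNIV J" and w: "w \<in> tree_space UNIV K"
    and fin: "finite I" "finite J" "finite K" and disj: "I \<inter> J = {}" "I \<inter> K = {}" "J \<inter> K = {}"
  shows "insert_trees c (insert_trees b (insert_trees a r u) v) w \<in> N (I \<union> J \<union> K)"
proof -
  have "insert_trees a r u \<in> N ({a, b, c} - {a} \<union> I)"
    using abc fin u by (intro insert_left r) (auto simp: composable_def)
  moreover have "{a, b, c} - {a} \<union> I = {b, c} \<union> I" using abc by auto
  ultimately have "insert_trees b (insert_trees a r u) v \<in> N ({b, c} \<union> I - {b} \<union> J)"
    using abc fin v disj by (intro insert_left) (auto simp: composable_def)
  moreover have "{b, c} \<union> I - {b} \<union> J = insert c (I \<union> J)" using abc by auto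
  ultimately have "insert_trees c (insert_trees b (insert_trees a r u) v) w \<in> N (insert c (I \<union> J) - {c} \<union> K)"
    using abc fin w disj by (intro insert_left) (auto simp: composable_def)
  moreover have "insert c (I \<union> J) - {c} \<union> K = I \<union> J \<union> K" using abc by auto
  ultimately show ?thesis by simp
qed

text \<open>The identities on three fresh leaves come from relabelling; inserting \<open>u\<close>,
  \<open>v\<close>, \<open>w\<close> into these leaves gives the general case.\<close>

lemma left_id: "left_id u v w \<in> N L"
  and right_id: "right_id u v w \<in> N L"
  if u: "u \<in> tree_space UNIV I" and v: "v \<in> tree_space UNIV J" and w: "w \<in> tree_space UNIV K"
    and fin: "finite I" "finite J" "finite K" and disj: "I \<inter> J = {}" "I \<inter> K = {}" "J \<inter> K = {}"
    and L: "L = I \<union> J \<union> K"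
proof -
  obtain a b c where abc: "a \<notin> I \<union> J \<union> K" "b \<notin> I \<union> J \<union> K" "c \<notin> I \<union> J \<union> K" "a \<noteq> b" "a \<noteq> c" "b \<noteq> c"
    by (rule fresh_nats[of "I \<union> J \<union> K"]) (use fin in auto)
  have [simp]: "avoids b u" "avoids c u" "avoids c v"
    using abc avoids_tree_space[OF u] avoids_tree_space[OF v] by auto
  have [simp]: "a \<noteq> b" "a \<noteq> c" "b \<noteq> c" "b \<noteq> a" "c \<noteq> a" "c \<noteq> b" using abc by auto
  note ins = insert_three_leaves[OF _ abc(4-6) _ u v w fin disj]
  note [simp] = insert_trees_linear insert_trees_prod
  show "left_id u v w \<in> N L"
    using ins[OF ids_leaves(1)] abc unfolding L by (auto simp: left_id_def)
  show "right_id u v w \<in> N L"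
    using ins[OF ids_leaves(2)] abc unfolding L by (auto simp: right_id_def)
qed

end

section \<open>The relations of the weak Leibniz operad\<close>

abbreviation free_magma :: "('k::field, 'k magma_comb set) operad" where
  "free_magma \<equiv> free_operad regular_s2"

abbreviation cls :: "nat set \<Rightarrow> 'k::field magma_comb \<Rightarrow> 'k magma_comb set" where
  "cls \<equiv> free_class regular_s2"

lemma cls_eq_proj: "cls = (\<lambda>I. vcoset (space (tree_operad (vecs regular_s2)) I) (free_kernel regular_s2 I))"
  by (simp add: free_class_def fun_eq_iff)

lemma hom_cls: "operad_hom (tree_operad UNIV) free_magma cls"
  using operad_with_ideal.hom_proj[OF operad_with_ideal_free[of regular_s2]]
  by (simp add: free_operad_def cls_eq_proj)

lemma ops_free_magma: "ops free_magma I = cls I ` tree_space UNIV I"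
  using operad_with_ideal.ops_quot[OF operad_with_ideal_free[of regular_s2]]
  by (simp add: free_operad_def cls_eq_proj)

lemma cls_eq_zero:
  "finite I \<Longrightarrow> v \<in> tree_space UNIV I \<Longrightarrow> cls I v = vzero (space free_magma I) \<longleftrightarrow> v \<in> free_kernel regular_s2 I"
  using operad_with_ideal.proj_eq_zero_iff[OF operad_with_ideal_free[of regular_s2], of I v]
  by (simp add: free_operad_def cls_eq_proj)

lemma mem_cls: "w \<in> cls I v \<longleftrightarrow> (\<exists>k\<in>free_kernel regular_s2 I. w = v + k)"
  by (auto simp: cls_eq_proj vcoset_def)

lemma cls_eq_iff:
  assumes "finite I" "v \<in> tree_space UNIV I" "w \<in> tree_space UNIV I"
  shows "cls I v = cls I w \<longleftrightarrow> v - w \<in> free_kernel regular_s2 I"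
proof -
  have "cls I v = cls I w \<longleftrightarrow> (\<exists>k\<in>free_kernel regular_s2 I. v = w + k)"
    using operad_with_ideal.proj_eq_iff[OF operad_with_ideal_free[of regular_s2], of I v w] assms
    by (simp add: cls_eq_proj)
  then show ?thesis by (metis add_diff_cancel_left' diff_add_cancel add.commute)
qed

definition relation_classes :: "nat set \<Rightarrow> 'k::field magma_comb set set" where
  "relation_classes I = (if I = {1, 2, 3} then cls I ` {left_identity, right_identity} else {})"

lemma rels_weak_leibniz: "rels weak_leibniz = ideal_generated free_magma relation_classes {1, 2, 3}"
  unfolding weak_leibniz_def relation_classes_def by simp

lemma gens_weak_leibniz [simp]: "gens weak_leibniz = regular_s2"
  by (simp add: weak_leibniz_def)

lemma identities_closed: "relation_classes I \<subseteq> ops free_magma I"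
  using identities_evaluate by (auto simp: relation_classes_def ops_free_magma evaluation_kernel_def)

text \<open>Pulled back along \<open>cls\<close>, membership in an ideal of the free operad becomes
  membership of a representative, and the calculus of \<open>weak_leibniz_congruence\<close>
  applies.\<close>

lemma congruence_of_ideal:
  fixes N :: "nat set \<Rightarrow> 'k::field magma_comb set set"
  assumes N: "operad_ideal free_magma N" and rel: "relation_classes {1, 2, 3} \<subseteq> N {1, 2, 3}"
  shows "weak_leibniz_congruence (\<lambda>I. {v \<in> tree_space UNIV I. cls I v \<in> N I})"
proof
  show "operad_ideal (tree_operad UNIV) (\<lambda>I. {v \<in> tree_space UNIV I. cls I v \<in> N I})"
    using operad_ideal_vimage[OF symmetric_operad_tree symmetric_operad_free hom_cls N] by simp
  show "free_relations regular_s2 I \<subseteq> {v \<in> tree_space UNIV I. cls I v \<in> N I}" for I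
  proof
    fix v :: "'k magma_comb" assume v: "v \<in> free_relations regular_s2 I"
    then have fin: "finite I" by (auto simp: mem_free_relations)
    have "v \<in> free_kernel regular_s2 I"
      using v tree_congruence.free_relations[OF tree_congruence_free_kernel] by blast
    moreover have "v \<in> tree_space UNIV I"
      using v free_relations_closed[OF closed_regular_s2, of I] by auto
    ultimately show "v \<in> {v \<in> tree_space UNIV I. cls I v \<in> N I}"
      using cls_eq_zero[OF fin, of v] operad_idealD(1)[OF N fin] by (simp add: is_subspace_def)
  qed
  show "left_identity \<in> {v \<in> tree_space UNIV {1, 2, 3}. cls {1, 2, 3} v \<in> N {1, 2, 3}}"
    "right_identity \<in> {v \<in> tree_space UNIV {1, 2, 3}. cls {1, 2, 3} v \<in> N {1, 2, 3}}"
    using rel identities_evaluate by (auto simp: relation_classes_def evaluation_kernel_def)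
qed

lemma evaluation_ideal: "operad_ideal free_magma (\<lambda>I. cls I ` (evaluation_kernel I :: 'k::field magma_comb set))"
  by (rule operad_ideal_image[OF symmetric_operad_tree symmetric_operad_free hom_cls _ evaluation_kernel_ideal])
    (simp add: ops_free_magma)

lemma free_kernel_evaluate: "free_kernel regular_s2 I \<subseteq> evaluation_kernel I"
  unfolding regular_s2_sel by (rule ideal_generated_least[OF evaluation_kernel_ideal free_relations_evaluate])

text \<open>The hypothesis gives only some element of the kernel in the class of \<open>v\<close>.
  Elements of the free kernel evaluate to zero as well, so the conclusion reaches \<open>v\<close>
  itself.\<close>

lemma evaluate_cls:
  assumes fin: "finite I" and v: "v \<in> tree_space UNIV I" and cls: "cls I v \<in> cls I ` evaluation_kernel I"
  shows "evaluate d v = 0"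
proof -
  obtain w where w: "w \<in> evaluation_kernel I" "cls I v = cls I w" using cls by blast
  then have "v - w \<in> free_kernel regular_s2 I"
    using v fin cls_eq_iff[of I v w] by (simp add: evaluation_kernel_def)
  then have "v - w \<in> evaluation_kernel I" using free_kernel_evaluate by blast
  then show ?thesis using w(1) by (simp add: evaluation_kernel_def evaluate_diff)
qed

lemma relation_classes_evaluate: "relation_classes I \<subseteq> cls I ` evaluation_kernel I"
  unfolding relation_classes_def using identities_evaluate by auto

text \<open>The upper bound for the relations; the lower bound is
  \<open>mem_if_orthogonal\<close>.\<close>

lemma rels_evaluate: "rels weak_leibniz \<subseteq> cls {1, 2, 3} ` evaluation_kernel {1, 2, 3}"
  unfolding rels_weak_leibniz by (rule ideal_generated_least[OF evaluation_ideal relation_classes_evaluate])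

section \<open>Self-duality\<close>

abbreviation left_tree :: "nat \<Rightarrow> nat \<Rightarrow> nat \<Rightarrow> ('k::field \<times> 'k, nat) btree" where
  "left_tree i j k \<equiv> (Leaf i \<star> Leaf j) \<star> Leaf k"

abbreviation right_tree :: "nat \<Rightarrow> nat \<Rightarrow> nat \<Rightarrow> ('k::field \<times> 'k, nat) btree" where
  "right_tree i j k \<equiv> Leaf i \<star> (Leaf j \<star> Leaf k)"

definition perms3 :: "(nat \<times> nat \<times> nat) set" where
  "perms3 = {(1, 2, 3), (2, 3, 1), (3, 1, 2), (2, 1, 3), (1, 3, 2), (3, 2, 1)}"

lemma perms3I:
  assumes "{i, j, k} = {1, 2, 3 :: nat}"
  shows "(i, j, k) \<in> perms3"
proof -
  have "card {i, j, k} = 3" using assms by simp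
  then have "i \<noteq> j" "i \<noteq> k" "j \<noteq> k"
    by (auto simp: card_insert_if split: if_splits)
  moreover have "i \<in> {1, 2, 3}" "j \<in> {1, 2, 3}" "k \<in> {1, 2, 3}" using assms by blast+
  ultimately show ?thesis unfolding perms3_def by (elim insertE emptyE) simp_all
qed

lemma card_leaves_pos: "card (leaves t) > 0"
  by (simp add: card_gt_0_iff leaves_nonempty)

lemma multilinear_card1:
  assumes "multilinear_tree t" "card (leaves t) = 1"
  obtains i where "t = Leaf i"
proof (cases t)
  case (Node e u v)
  then show ?thesis
    using assms card_leaves_pos[of u] card_leaves_pos[of v] by (simp add: card_Un_disjoint)
qed

lemma multilinear_card2:
  assumes "multilinear_tree t" "card (leaves t) = 2"
  obtains f i j where "t = Node f (Leaf i) (Leaf j)"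
proof (cases t)
  case (Node e u v)
  then have "card (leaves u) + card (leaves v) = 2"
    using assms by (simp add: card_Un_disjoint)
  then have "card (leaves u) = 1" "card (leaves v) = 1"
    using card_leaves_pos[of u] card_leaves_pos[of v] by simp_all
  then show ?thesis
    using Node assms(1) multilinear_card1[of u] multilinear_card1[of v] that by (metis multilinear_tree.simps(2))
qed (use assms in simp)

lemma trees_three:
  assumes "t \<in> trees X {1, 2, 3}"
  obtains e f i j k where "(i, j, k) \<in> perms3" "e \<in> X" "f \<in> X"
    "t = Node e (Node f (Leaf i) (Leaf j)) (Leaf k) \<or> t = Node e (Leaf k) (Node f (Leaf i) (Leaf j))"
proof (cases t)
  case (Node e u v)
  have t: "multilinear_tree t" "leaves t = {1, 2, 3}" "labels t \<subseteq> X"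
    using assms by (simp_all add: trees_def)
  then have "card (leaves u) + card (leaves v) = card {1, 2, 3 :: nat}"
    using Node card_Un_disjoint[of "leaves u" "leaves v"] by simp
  then have "card (leaves u) = 2 \<and> card (leaves v) = 1 \<or> card (leaves u) = 1 \<and> card (leaves v) = 2"
    using card_leaves_pos[of u] card_leaves_pos[of v] by simp linarith
  moreover have "multilinear_tree u" "multilinear_tree v" using t Node by simp_all
  ultimately have "\<exists>f i j k.
    u = Node f (Leaf i) (Leaf j) \<and> v = Leaf k \<or> u = Leaf k \<and> v = Node f (Leaf i) (Leaf j)"
  proof (elim disjE conjE)
    assume *: "multilinear_tree u" "multilinear_tree v"
    show ?thesis if "card (leaves u) = 2" "card (leaves v) = 1"
    proof -
      obtain f i j where "u = Node f (Leaf i) (Leaf j)" using *(1) \<open>card (leaves u) = 2\<close> by (rule multilinear_card2)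
      moreover obtain k where "v = Leaf k" using *(2) \<open>card (leaves v) = 1\<close> by (rule multilinear_card1)
      ultimately show ?thesis by simp
    qed
    show ?thesis if "card (leaves u) = 1" "card (leaves v) = 2"
    proof -
      obtain f i j where "v = Node f (Leaf i) (Leaf j)" using *(2) \<open>card (leaves v) = 2\<close> by (rule multilinear_card2)
      moreover obtain k where "u = Leaf k" using *(1) \<open>card (leaves u) = 1\<close> by (rule multilinear_card1)
      ultimately show ?thesis by simp
    qed
  qed
  then obtain f i j k where
    "u = Node f (Leaf i) (Leaf j) \<and> v = Leaf k \<or> u = Leaf k \<and> v = Node f (Leaf i) (Leaf j)"
    by blast
  note uv = this
  then have "leaves t = {i, j, k}" "labels t = {e, f}" using Node by auto
  then have "(i, j, k) \<in> perms3" "e \<in> X" "f \<in> X" using t perms3I[of i j k] by simp_all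
  moreover have "t = Node e (Node f (Leaf i) (Leaf j)) (Leaf k) \<or> t = Node e (Leaf k) (Node f (Leaf i) (Leaf j))"
    using uv Node by blast
  ultimately show ?thesis by (rule that)
qed (use assms in simp)

lemma magma_trees_three:
  "magma_trees {1, 2, 3} = (\<lambda>(i, j, k). left_tree i j k) ` perms3 \<union> (\<lambda>(i, j, k). right_tree i j k) ` perms3"
proof
  have "(k, i, j) \<in> perms3" if "(i, j, k) \<in> perms3" for i j k
    using that by (auto simp: perms3_def)
  then show "magma_trees {1, 2, 3} \<subseteq>
      (\<lambda>(i, j, k). left_tree i j k) ` perms3 \<union> (\<lambda>(i, j, k). right_tree i j k) ` perms3"
    by (intro subsetI, elim trees_three) (force simp: times_tree_def)
  show "(\<lambda>(i, j, k). left_tree i j k) ` perms3 \<union> (\<lambda>(i, j, k). right_tree i j k) ` perms3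
      \<subseteq> magma_trees {1, 2, 3}"
    by (auto simp: perms3_def trees_def times_tree_def)
qed

lemma magma_tree_mem:
  assumes "(i, j, k) \<in> perms3"
  shows "left_tree i j k \<in> magma_trees {1, 2, 3}" "right_tree i j k \<in> magma_trees {1, 2, 3}"
  unfolding magma_trees_three
  by (rule UnI1, rule image_eqI[OF _ assms], simp, rule UnI2, rule image_eqI[OF _ assms], simp)

section \<open>The relations in coordinates\<close>

text \<open>
  The coordinates of an element of \<open>\<F>(E)(3)\<close>; the condition below is both the orthogonality to the
  identities and the membership in the space of relations.
\<close>

definition orthogonal :: "'k::field magma_comb \<Rightarrow> bool" where
  "orthogonal v \<longleftrightarrow> (\<forall>(i, j, k)\<in>perms3.
     Poly_Mapping.lookup v (left_tree i j k) + Poly_Mapping.lookup v (left_tree j i k) +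
       2 * Poly_Mapping.lookup v (right_tree i j k) + 2 * Poly_Mapping.lookup v (right_tree j i k) = 0 \<and>
     Poly_Mapping.lookup v (right_tree i j k) + Poly_Mapping.lookup v (right_tree i k j) +
       2 * Poly_Mapping.lookup v (left_tree i j k) + 2 * Poly_Mapping.lookup v (left_tree i k j) = 0)"

lemma orthogonalD:
  assumes "orthogonal v" "(i, j, k) \<in> perms3"
  shows "Poly_Mapping.lookup v (left_tree i j k) + Poly_Mapping.lookup v (left_tree j i k) +
       2 * Poly_Mapping.lookup v (right_tree i j k) + 2 * Poly_Mapping.lookup v (right_tree j i k) = 0"
    and "Poly_Mapping.lookup v (right_tree i j k) + Poly_Mapping.lookup v (right_tree i k j) +
       2 * Poly_Mapping.lookup v (left_tree i j k) + 2 * Poly_Mapping.lookup v (left_tree i k j) = 0"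
  using assms unfolding orthogonal_def by auto

lemma evaluate_magma_three:
  assumes "v \<in> tree_space {(1, 0)} {1, 2, 3}"
  shows "evaluate d v = (\<Sum>(i, j, k)\<in>perms3.
    smult (Poly_Mapping.lookup v (left_tree i j k)) ([:1, d k - d i - d j:] * [:1, d j - d i:]) +
    smult (Poly_Mapping.lookup v (right_tree i j k)) ([:1, d j + d k - d i:] * [:1, d k - d j:]))"
proof -
  have inj: "inj_on (\<lambda>(i, j, k). left_tree i j k) perms3" "inj_on (\<lambda>(i, j, k). right_tree i j k) perms3"
    by (auto simp: inj_on_def times_tree_def)
  have "evaluate d v = (\<Sum>t\<in>magma_trees {1, 2, 3}. smult (Poly_Mapping.lookup v t) (ev d t))"
    using assms unfolding magma_trees_three by (intro evaluate_superset) (auto simp: perms3_def)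
  also have "\<dots> = (\<Sum>t\<in>(\<lambda>(i, j, k). left_tree i j k) ` perms3. smult (Poly_Mapping.lookup v t) (ev d t)) +
      (\<Sum>t\<in>(\<lambda>(i, j, k). right_tree i j k) ` perms3. smult (Poly_Mapping.lookup v t) (ev d t))"
    unfolding magma_trees_three
    by (intro sum.union_disjoint) (auto simp: perms3_def times_tree_def)
  also have "\<dots> = (\<Sum>(i, j, k)\<in>perms3. smult (Poly_Mapping.lookup v (left_tree i j k)) (ev d (left_tree i j k)) +
      smult (Poly_Mapping.lookup v (right_tree i j k)) (ev d (right_tree i j k)))"
    unfolding sum.reindex[OF inj(1)] sum.reindex[OF inj(2)] sum.distrib[symmetric]
    by (simp add: split_def)
  also have "\<dots> = (\<Sum>(i, j, k)\<in>perms3.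
    smult (Poly_Mapping.lookup v (left_tree i j k)) ([:1, d k - d i - d j:] * [:1, d j - d i:]) +
    smult (Poly_Mapping.lookup v (right_tree i j k)) ([:1, d j + d k - d i:] * [:1, d k - d j:]))"
    by (intro sum.cong refl) (auto simp: perms3_def times_tree_def algebra_simps)
  finally show ?thesis .
qed

text \<open>The value is quadratic in \<epsilon>, so each choice of \<open>d\<close> gives three
  equations. The indicator of one leaf is a sufficient choice for the two conditions that single out
  this leaf.\<close>

lemma orthogonal_if_evaluate_zero:
  assumes v: "v \<in> tree_space {(1, 0)} {1, 2, 3}" and zero: "\<And>d. evaluate d v = 0"
    and char: "(2 :: 'k::field) \<noteq> 0"
  shows "orthogonal (v :: 'k magma_comb)"
proof -
  define p where "p i j k = Poly_Mapping.lookup v (left_tree i j k)" for i j k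
  define r where "r i j k = Poly_Mapping.lookup v (right_tree i j k)" for i j k
  have coeffs: "(\<Sum>(i, j, k)\<in>perms3. p i j k + r i j k) = 0"
    "(\<Sum>(i, j, k)\<in>perms3. p i j k * (d k - 2 * d i) + r i j k * (2 * d k - d i)) = 0"
    "(\<Sum>(i, j, k)\<in>perms3. p i j k * ((d k - d i - d j) * (d j - d i)) +
        r i j k * ((d j + d k - d i) * (d k - d j))) = 0" for d
  proof -
    have 0: "(\<Sum>(i, j, k)\<in>perms3. smult (p i j k) ([:1, d k - d i - d j:] * [:1, d j - d i:]) +
        smult (r i j k) ([:1, d j + d k - d i:] * [:1, d k - d j:])) = 0"
      using evaluate_magma_three[OF v, of d] zero unfolding p_def r_def by simp
    from arg_cong[OF this, of "\<lambda>q. coeff q 0"]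
    show "(\<Sum>(i, j, k)\<in>perms3. p i j k + r i j k) = 0"
      by (simp add: coeff_sum case_prod_beta)
    from arg_cong[OF 0, of "\<lambda>q. coeff q 1"]
    show "(\<Sum>(i, j, k)\<in>perms3. p i j k * (d k - 2 * d i) + r i j k * (2 * d k - d i)) = 0"
      by (simp add: coeff_sum case_prod_beta algebra_simps)
    from arg_cong[OF 0, of "\<lambda>q. coeff q 2"]
    show "(\<Sum>(i, j, k)\<in>perms3. p i j k * ((d k - d i - d j) * (d j - d i)) +
        r i j k * ((d j + d k - d i) * (d k - d j))) = 0"
      by (simp add: coeff_sum case_prod_beta eval_nat_numeral mult_ac)
  qed
  have half: "x = 0" if "2 * x = 0" for x :: 'k using that char by simp
  have sums: "p i j k + p j i k + 2 * r i j k + 2 * r j i k = 0 \<and>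
      r k i j + r k j i + 2 * p k i j + 2 * p k j i = 0" if "(i, j, k) \<in> perms3" for i j k
  proof -
    have ne: "i \<noteq> j" "i \<noteq> k" "j \<noteq> k" using that by (auto simp: perms3_def)
    have all: "(\<Sum>(a, b, c)\<in>perms3. f a b c) = f i j k + f j k i + f k i j + f j i k + f i k j + f k j i"
      for f :: "nat \<Rightarrow> nat \<Rightarrow> nat \<Rightarrow> 'k"
      using that unfolding perms3_def by (elim insertE emptyE) (simp_all add: ac_simps)
    \<comment> \<open>Let S and T be the two sums claimed to vanish. For the indicator of
      \<open>k\<close> the coefficient of \<epsilon> says S = T, while the constant and the
      quadratic coefficient add up to S + T. So 2 S = 2 T = 0.\<close>
    define d :: "nat \<Rightarrow> 'k" where "d x = (if x = k then 1 else 0)" for x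
    have d: "d k = 1" "d i = 0" "d j = 0" using ne by (simp_all add: d_def)
    note eqs = coeffs(1) coeffs(2)[of d] coeffs(3)[of d]
    note eqs' = eqs[unfolded all d]
    have "2 * (p i j k + p j i k + 2 * r i j k + 2 * r j i k) = 0"
      using eqs' by algebra
    moreover have "2 * (r k i j + r k j i + 2 * p k i j + 2 * p k j i) = 0"
      using eqs' by algebra
    ultimately show ?thesis using half by blast
  qed
  have "(j, k, i) \<in> perms3" if "(i, j, k) \<in> perms3" for i j k
    using that by (auto simp: perms3_def)
  then show ?thesis
    unfolding orthogonal_def p_def[symmetric] r_def[symmetric] using sums by fast
qed

text \<open>With l = p + 2r and m = 2p + r one has 3p = 2m - l and 3r = 2l - m, which are the
  coefficients at the two combs of - l L - m R. Antisymmetry of l and m accounts for the odd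
  permutations, so the sum runs over the three cyclic ones only.\<close>

lemma (in weak_leibniz_congruence) mem_if_orthogonal:
  assumes v: "v \<in> tree_space {(1, 0)} {1, 2, 3}" and orth: "orthogonal v" and char: "(3 :: 'k) \<noteq> 0"
  shows "v \<in> N {1, 2, 3}"
proof -
  define p where "p i j k = Poly_Mapping.lookup v (left_tree i j k)" for i j k
  define r where "r i j k = Poly_Mapping.lookup v (right_tree i j k)" for i j k
  define L where "L i j k = left_id (basis (Leaf i)) (basis (Leaf j)) (basis (Leaf k) :: 'k magma_comb)" for i j k
  define R where "R i j k = right_id (basis (Leaf i)) (basis (Leaf j)) (basis (Leaf k) :: 'k magma_comb)" for i j k
  let ?s = "\<lambda>i j k. fscale (- (p i j k + 2 * r i j k)) (L i j k) + fscale (- (2 * p i j k + r i j k)) (R i j k)"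
  have mem: "(1, 2, 3) \<in> perms3" "(2, 3, 1) \<in> perms3" "(3, 1, 2) \<in> perms3"
    by (simp_all add: perms3_def)
  \<comment> \<open>The inversion formulas at the odd permutation (j, i, k), with l and m moved by
    antisymmetry to the even permutations (i, j, k) and (j, k, i).\<close>
  have solved: "3 * p j i k = (p i j k + 2 * r i j k) - 2 * (2 * p j k i + r j k i)"
    "3 * r j i k = (2 * p j k i + r j k i) - 2 * (p i j k + 2 * r i j k)"
    if "(i, j, k) \<in> perms3" "(j, k, i) \<in> perms3" for i j k
  proof -
    note e = orthogonalD(1)[OF orth that(1), folded p_def r_def] orthogonalD(2)[OF orth that(2), folded p_def r_def]
    show "3 * p j i k = (p i j k + 2 * r i j k) - 2 * (2 * p j k i + r j k i)"
      using e by algebra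
    show "3 * r j i k = (2 * p j k i + r j k i) - 2 * (p i j k + 2 * r i j k)"
      using e by algebra
  qed
  note eqs = solved[OF mem(1,2)] solved[OF mem(2,3)] solved[OF mem(3,1)]
  note lookups = L_def R_def left_id_def right_id_def node_prod_basis times_tree_def lookup_add
    lookup_minus lookup_single when_def
  have eq: "fscale 3 v = ?s 1 2 3 + ?s 2 3 1 + ?s 3 1 2"
  proof (rule poly_mapping_eqI)
    fix t :: "('k \<times> 'k, nat) btree"
    consider i j k where "(i, j, k) \<in> perms3" "t = left_tree i j k"
      | i j k where "(i, j, k) \<in> perms3" "t = right_tree i j k" | "t \<notin> magma_trees {1, 2, 3}"
      unfolding magma_trees_three by fast
    then show "Poly_Mapping.lookup (fscale 3 v) t = Poly_Mapping.lookup (?s 1 2 3 + ?s 2 3 1 + ?s 3 1 2) t"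
    proof cases
      case 1
      have "Poly_Mapping.lookup (fscale 3 v) t = 3 * p i j k"
        by (simp add: 1(2) p_def)
      also have "\<dots> = Poly_Mapping.lookup (?s 1 2 3 + ?s 2 3 1 + ?s 3 1 2) t"
        using 1(1)[unfolded perms3_def] unfolding 1(2)
        by (elim insertE emptyE Pair_inject; hypsubst; simp add: lookups eqs algebra_simps del: One_nat_def)
      finally show ?thesis .
    next
      case 2
      have "Poly_Mapping.lookup (fscale 3 v) t = 3 * r i j k"
        by (simp add: 2(2) r_def)
      also have "\<dots> = Poly_Mapping.lookup (?s 1 2 3 + ?s 2 3 1 + ?s 3 1 2) t"
        using 2(1)[unfolded perms3_def] unfolding 2(2)
        by (elim insertE emptyE Pair_inject; hypsubst; simp add: lookups eqs algebra_simps del: One_nat_def)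
      finally show ?thesis .
    next
      case 3
      then have "t \<noteq> left_tree i j k \<and> t \<noteq> right_tree i j k" if "(i, j, k) \<in> perms3" for i j k
        using magma_tree_mem[OF that] by auto
      then have "\<forall>(i, j, k)\<in>perms3. left_tree i j k \<noteq> t \<and> right_tree i j k \<noteq> t" by auto
      note ne = this[unfolded perms3_def]
      have "Poly_Mapping.lookup v t = 0" using 3 v by (auto simp: in_keys_iff)
      moreover have "Poly_Mapping.lookup (?s 1 2 3 + ?s 2 3 1 + ?s 3 1 2) t = 0"
        using ne by (simp add: lookups del: One_nat_def split del: if_split)
      ultimately show ?thesis by simp
    qed
  qed
  have s: "?s i j k \<in> N {1, 2, 3}" if "(i, j, k) \<in> perms3" for i j k
  proof -
    have "{i, j, k} = {1, 2, 3}" "i \<noteq> j" "i \<noteq> k" "j \<noteq> k" using that by (auto simp: perms3_def)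
    then show ?thesis
      using ids_leaves[of i j k] unfolding L_def R_def by (intro add fscale) simp_all
  qed
  have "?s 1 2 3 + ?s 2 3 1 + ?s 3 1 2 \<in> N {1, 2, 3}"
    by (intro add s mem) simp_all
  then have "fscale 3 v \<in> N {1, 2, 3}" unfolding eq .
  then show ?thesis by (rule fscale_cancel[OF _ _ char, rotated]) simp
qed

section \<open>The dual generators and the pairing\<close>

text \<open>The isomorphism \<open>E\<^sup>* \<otimes> sgn \<cong> E\<close> and its inverse exchange the roles of the two symmetric
  generators \<open>ab + ba\<close> and \<open>ab - ba\<close>.\<close>

definition dual_to_regular :: "('k::field \<times> 'k \<Rightarrow> 'k) \<Rightarrow> 'k \<times> 'k" where
  "dual_to_regular \<phi> = (\<phi> (1, 0), - \<phi> (0, 1))"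

definition regular_to_dual :: "'k::field \<times> 'k \<Rightarrow> ('k \<times> 'k \<Rightarrow> 'k)" where
  "regular_to_dual u = (\<lambda>e. fst u * fst e - snd u * snd e)"

lemma sgn_dual_sel [simp]:
  "vecs (sgn_dual regular_s2) = {\<phi>. is_linear regular_s2 scalars \<phi>}"
  "vadd (sgn_dual regular_s2) = (\<lambda>\<phi> \<psi> e. \<phi> e + \<psi> e)"
  "vscale (sgn_dual regular_s2) = (\<lambda>c \<phi> e. c * \<phi> e)"
  "swap (sgn_dual regular_s2) = (\<lambda>\<phi> e. - \<phi> (snd e, fst e))"
  by (simp_all add: sgn_dual_def)

lemma linear_regular:
  assumes "is_linear regular_s2 scalars \<phi>"
  shows "\<phi> e = fst e * \<phi> (1, 0) + snd e * \<phi> (0, 1)"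
proof -
  obtain x y where e: "e = (x, y)" by (cases e)
  have "\<phi> (a + c, b + d) = \<phi> (a, b) + \<phi> (c, d)" "\<phi> (c * a, c * b) = c * \<phi> (a, b)" for a b c d
    using assms by (simp_all add: is_linear_def scalars_def)
  note lin = this
  have "\<phi> (x, y) = \<phi> (x, 0) + \<phi> (0, y)"
    using lin(1)[of x 0 0 y] by simp
  moreover have "\<phi> (x, 0) = x * \<phi> (1, 0)" "\<phi> (0, y) = y * \<phi> (0, 1)"
    using lin(2)[of x 1 0] lin(2)[of y 0 1] by simp_all
  ultimately show ?thesis using e by simp
qed

lemma dual_iso: "s2_iso (sgn_dual regular_s2) regular_s2 dual_to_regular regular_to_dual"
proof
  show "s2_hom (sgn_dual regular_s2) regular_s2 dual_to_regular"
    by (simp add: s2_hom_def is_linear_def[of "sgn_dual regular_s2"] dual_to_regular_def)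
  show "s2_hom regular_s2 (sgn_dual regular_s2) regular_to_dual"
    by (auto simp: s2_hom_def is_linear_def regular_to_dual_def scalars_def fun_eq_iff algebra_simps)
  show "regular_to_dual (dual_to_regular \<phi>) = \<phi>" if "\<phi> \<in> vecs (sgn_dual regular_s2)" for \<phi> :: "'a \<times> 'a \<Rightarrow> 'a"
  proof
    fix e
    have "\<phi> e = fst e * \<phi> (1, 0) + snd e * \<phi> (0, 1)"
      using that by (intro linear_regular) simp
    then show "regular_to_dual (dual_to_regular \<phi>) e = \<phi> e"
      by (simp add: regular_to_dual_def dual_to_regular_def mult.commute)
  qed
  show "dual_to_regular (regular_to_dual u) = u" for u :: "'a \<times> 'a"
    by (simp add: regular_to_dual_def dual_to_regular_def)
  show "closed_s2_module (sgn_dual (regular_s2 :: ('a, 'a \<times> 'a) s2_module))"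
    by (auto simp: closed_s2_module_def is_linear_def scalars_def algebra_simps)
qed (rule closed_regular_s2)

definition sign3 :: "nat \<times> nat \<times> nat \<Rightarrow> 'k::field" where
  "sign3 x = (if x \<in> {(1, 2, 3), (2, 3, 1), (3, 1, 2)} then 1 else - 1)"

text \<open>The natural pairing in the bases of combs. Turning a right comb into a left comb swaps
  the root label on both sides, and the swap in the twisted dual contributes the minus sign; the
  cyclic change of leaves is even.\<close>

definition form :: "'k::field magma_comb \<Rightarrow> 'k magma_comb \<Rightarrow> 'k" where
  "form v w = (\<Sum>(i, j, k)\<in>perms3. sign3 (i, j, k) *
     (Poly_Mapping.lookup v (left_tree i j k) * Poly_Mapping.lookup w (left_tree i j k) -
      Poly_Mapping.lookup v (right_tree i j k) * Poly_Mapping.lookup w (right_tree i j k)))"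

lemma sum_perms3: "sum f perms3 = f (1, 2, 3) + f (2, 3, 1) + f (3, 1, 2) + f (2, 1, 3) + f (1, 3, 2) + f (3, 2, 1)"
  by (simp add: perms3_def ac_simps)

lemma form_linear:
  "form (v + v') w = form v w + form v' w" "form v (w + w') = form v w + form v w'"
  "form (fscale c v) w = c * form v w" "form v (fscale c w) = c * form v w"
  "form 0 w = 0" "form v 0 = 0"
  by (simp_all add: form_def sum_perms3 lookup_add algebra_simps)

lemma sum_sign_symmetric:
  assumes "\<And>i j k. (i, j, k) \<in> perms3 \<Longrightarrow> f (i, j, k) = f (j, i, k)"
  shows "(\<Sum>x\<in>perms3. sign3 x * f x) = 0"
  using assms[of 1 2 3] assms[of 2 3 1] assms[of 3 1 2]
  by (simp add: sum_perms3 sign3_def perms3_def del: One_nat_def)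

lemma sum_sign_symmetric':
  assumes "\<And>i j k. (i, j, k) \<in> perms3 \<Longrightarrow> f (i, j, k) = f (i, k, j)"
  shows "(\<Sum>x\<in>perms3. sign3 x * f x) = 0"
  using assms[of 1 2 3] assms[of 2 3 1] assms[of 3 1 2]
  by (simp add: sum_perms3 sign3_def perms3_def del: One_nat_def)

text \<open>If l, m belong to \<open>v\<close> and l', m' to \<open>w\<close>, then m m' - l l' = 3
  (p p' - r r'). A product of two functions antisymmetric under a transposition is symmetric under
  it, so the signs cancel each of the two sums.\<close>

lemma form_orthogonal:
  assumes v: "orthogonal v" and w: "orthogonal w" and char: "(3 :: 'k::field) \<noteq> 0"
  shows "form v (w :: 'k magma_comb) = 0"
proof -
  define l where "l u = (\<lambda>(i, j, k). Poly_Mapping.lookup u (left_tree i j k) + 2 * Poly_Mapping.lookup u (right_tree i j k))"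
    for u :: "'k magma_comb"
  define m where "m u = (\<lambda>(i, j, k). 2 * Poly_Mapping.lookup u (left_tree i j k) + Poly_Mapping.lookup u (right_tree i j k))"
    for u :: "'k magma_comb"
  have "l u (i, j, k) = - l u (j, i, k)" "m u (i, j, k) = - m u (i, k, j)"
    if "orthogonal u" "(i, j, k) \<in> perms3" for u i j k
    unfolding eq_neg_iff_add_eq_0 using orthogonalD[OF that] by (simp_all add: l_def m_def ac_simps)
  then have "(\<Sum>x\<in>perms3. sign3 x * (m v x * m w x)) - (\<Sum>x\<in>perms3. sign3 x * (l v x * l w x)) = 0"
    using v w sum_sign_symmetric[of "\<lambda>x. l v x * l w x"] sum_sign_symmetric'[of "\<lambda>x. m v x * m w x"]
    by simp
  moreover have "3 * form v w =
      (\<Sum>x\<in>perms3. sign3 x * (m v x * m w x)) - (\<Sum>x\<in>perms3. sign3 x * (l v x * l w x))"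
    unfolding form_def sum_distrib_left sum_subtractf[symmetric]
    by (intro sum.cong refl) (auto simp: l_def m_def algebra_simps)
  ultimately show ?thesis using char by simp
qed

text \<open>Pairing with the identities reads off, up to sign, the defining equations of
  \<open>orthogonal\<close>. Together with \<open>form_orthogonal\<close> this makes the space its
  own annihilator.\<close>

lemma orthogonal_if_form_zero:
  assumes "\<And>i j k. (i, j, k) \<in> perms3 \<Longrightarrow>
    form v (left_id (basis (Leaf i)) (basis (Leaf j)) (basis (Leaf k))) = 0 \<and>
    form v (right_id (basis (Leaf i)) (basis (Leaf j)) (basis (Leaf k))) = 0"
  shows "orthogonal v"
proof -
  note eqs = assms[unfolded perms3_def, simplified]
  show ?thesis
    unfolding orthogonal_def perms3_def
    using eqs[of 1 2 3] eqs[of 2 3 1] eqs[of 3 1 2] eqs[of 2 1 3] eqs[of 1 3 2] eqs[of 3 2 1]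
    by (simp add: form_def sum_perms3 sign3_def left_id_def right_id_def node_prod_basis times_tree_def
        lookup_add lookup_minus lookup_single when_def) (simp add: algebra_simps)
qed

lemma identity_leaves:
  fixes w :: "'k::field magma_comb"
  assumes "(i, j, k) \<in> perms3" and "w = left_id (basis (Leaf i)) (basis (Leaf j)) (basis (Leaf k)) \<or>
    w = right_id (basis (Leaf i)) (basis (Leaf j)) (basis (Leaf k))"
  shows "w \<in> tree_space UNIV {1, 2, 3}" "lin_ext expand w = w"
proof -
  note defs = left_id_def right_id_def node_prod_basis times_tree_def
  show "lin_ext expand w = w"
    using assms(2) by (auto simp: defs lin_ext_add lin_ext_diff lin_ext_fscale)
  have "trees {(1, 0)} {1, 2, 3} \<subseteq> (trees UNIV {1, 2, 3} :: ('k \<times> 'k, nat) btree set)"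
    by (auto simp: trees_def)
  then have "left_tree a b c \<in> (trees UNIV {1, 2, 3} :: ('k \<times> 'k, nat) btree set)"
    "right_tree a b c \<in> (trees UNIV {1, 2, 3} :: ('k \<times> 'k, nat) btree set)"
    if "(a, b, c) \<in> perms3" for a b c
    using magma_tree_mem[OF that] by blast+
  moreover have "(j, i, k) \<in> perms3" "(i, k, j) \<in> perms3"
    using assms(1) by (auto simp: perms3_def)
  ultimately show "w \<in> tree_space UNIV {1, 2, 3}"
    using assms unfolding left_id_def right_id_def node_prod_basis mem_Collect_eq
    by (elim disjE) (simp_all add: keys_subset_add keys_subset_diff keys_subset_fscale del: One_nat_def)
qed

text \<open>Both functionals are expanded by their values on (1, 0) and (0, 1); what remains is a
  check for each of the 36 pairs of leaf orders.\<close>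

lemma pairing_eq_form_comb:
  assumes "(i, j, k) \<in> perms3" "(i', j', k') \<in> perms3"
    and lin: "is_linear regular_s2 scalars \<alpha>" "is_linear regular_s2 scalars \<beta>"
  shows "(if k \<noteq> k' then 0
        else (if (i, j, k) \<in> {(1, 2, 3), (2, 3, 1), (3, 1, 2)} then 1 else - 1) *
          \<alpha> e * \<beta> (if i = i' then f else swap regular_s2 f)) =
    form (expand (Node (dual_to_regular \<alpha>) (Node (dual_to_regular \<beta>) (Leaf i) (Leaf j)) (Leaf k)))
      (expand (Node e (Node f (Leaf i') (Leaf j')) (Leaf k')))"
proof -
  note lookups = node_prod_basis node_prod_linear times_tree_def lookup_add lookup_single when_def
  show ?thesis
    using assms(1,2) unfolding perms3_def linear_regular[OF lin(1), of e]
      linear_regular[OF lin(2), of "if i = i' then f else swap regular_s2 f"]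
    by (elim insertE emptyE; simp add: form_def sum_perms3 sign3_def dual_to_regular_def lookups;
        simp add: algebra_simps)
qed


lemma tree_pairing_eq_form:
  assumes s: "s \<in> trees (vecs (sgn_dual regular_s2)) {1, 2, 3}" and t: "t \<in> trees UNIV {1, 2, 3}"
  shows "tree_pairing regular_s2 s t = form (expand (map_btree dual_to_regular id s)) (expand t)"
proof -
  obtain \<alpha> \<beta> i j k where s': "(i, j, k) \<in> perms3" "is_linear regular_s2 scalars \<alpha>" "is_linear regular_s2 scalars \<beta>"
    "s = Node \<alpha> (Node \<beta> (Leaf i) (Leaf j)) (Leaf k) \<or> s = Node \<alpha> (Leaf k) (Node \<beta> (Leaf i) (Leaf j))"
    using s by (rule trees_three) auto
  obtain e f i' j' k' where t': "(i', j', k') \<in> perms3"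
    "t = Node e (Node f (Leaf i') (Leaf j')) (Leaf k') \<or> t = Node e (Leaf k') (Node f (Leaf i') (Leaf j'))"
    using t by (rule trees_three)
  \<comment> \<open>The root labels after normalisation to left combs; \<open>expand\<close> is
    unaffected by it, as \<open>dual_to_regular\<close> respects the swap.\<close>
  define \<alpha>' where "\<alpha>' = (if s = Node \<alpha> (Node \<beta> (Leaf i) (Leaf j)) (Leaf k) then \<alpha> else (\<lambda>e. - \<alpha> (snd e, fst e)))"
  define e' where "e' = (if t = Node e (Node f (Leaf i') (Leaf j')) (Leaf k') then e else (snd e, fst e))"
  have lin: "is_linear regular_s2 scalars \<alpha>'"
    using s'(2) by (auto simp: \<alpha>'_def is_linear_def scalars_def algebra_simps)
  have comb: "left_comb (sgn_dual regular_s2) s = (\<alpha>', \<beta>, i, j, k)" "left_comb regular_s2 t = (e', f, i', j', k')"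
    using s'(4) t'(2) by (auto simp: \<alpha>'_def e'_def)
  have ex: "expand (map_btree dual_to_regular id s) =
      expand (Node (dual_to_regular \<alpha>') (Node (dual_to_regular \<beta>) (Leaf i) (Leaf j)) (Leaf k))"
    "expand t = expand (Node e' (Node f (Leaf i') (Leaf j')) (Leaf k'))"
    using s'(4) t'(2) by (auto simp: \<alpha>'_def e'_def dual_to_regular_def add.commute)
  show ?thesis
    unfolding tree_pairing_def comb ex prod.case
    by (rule pairing_eq_form_comb[OF s'(1) t'(1) lin s'(3)])
qed

lemma form_lin_ext:
  "form (lin_ext f v) (lin_ext g w) = (\<Sum>s\<in>Poly_Mapping.keys v. \<Sum>t\<in>Poly_Mapping.keys w.
     Poly_Mapping.lookup v s * Poly_Mapping.lookup w t * form (f s) (g t))"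
proof -
  have "form (\<Sum>s\<in>S. fscale (c s) (f s)) u = (\<Sum>s\<in>S. c s * form (f s) u)" for S c u
    by (induction S rule: infinite_finite_induct) (simp_all add: form_linear)
  moreover have "form u (\<Sum>t\<in>S. fscale (c t) (g t)) = (\<Sum>t\<in>S. c t * form u (g t))" for S c u
    by (induction S rule: infinite_finite_induct) (simp_all add: form_linear)
  ultimately show ?thesis
    by (simp add: lin_ext_def sum_distrib_left mult.assoc mult.left_commute
        sum.swap[of _ "Poly_Mapping.keys w"])
qed

abbreviation dual_class :: "nat set \<Rightarrow> (('k::field \<times> 'k \<Rightarrow> 'k, nat) btree \<Rightarrow>\<^sub>0 'k) \<Rightarrow>
    (('k \<times> 'k \<Rightarrow> 'k, nat) btree \<Rightarrow>\<^sub>0 'k) set" where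
  "dual_class \<equiv> free_class (sgn_dual regular_s2)"

text \<open>The pairing is a definite description over all representatives. The double sum is
  constant on them because it factors through \<open>expand\<close>, which vanishes on both free
  kernels.\<close>

lemma natural_pairing_eq_form:
  assumes v: "v \<in> tree_space (vecs (sgn_dual regular_s2)) {1, 2, 3}" and w: "w \<in> tree_space UNIV {1, 2, 3}"
  shows "natural_pairing regular_s2 (dual_class {1, 2, 3} v) (cls {1, 2, 3} w) =
    form (lin_ext expand (map_labels dual_to_regular v)) (lin_ext expand w)"
proof -
  let ?K = "free_kernel (sgn_dual regular_s2) {1, 2, 3}"
  have sum: "(\<Sum>s\<in>Poly_Mapping.keys v'. \<Sum>t\<in>Poly_Mapping.keys w'.
      Poly_Mapping.lookup v' s * Poly_Mapping.lookup w' t * tree_pairing regular_s2 s t) =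
    form (lin_ext expand (map_labels dual_to_regular v)) (lin_ext expand w)"
    if v': "v' \<in> dual_class {1, 2, 3} v" and w': "w' \<in> cls {1, 2, 3} w" for v' w'
  proof -
    obtain k where k: "k \<in> ?K" "v' = v + k"
      using v' by (auto simp: free_class_def vcoset_def)
    obtain l where l: "l \<in> free_kernel regular_s2 {1, 2, 3}" "w' = w + l"
      using w' by (auto simp: mem_cls)
    have "k \<in> tree_space (vecs (sgn_dual regular_s2)) {1, 2, 3}" "l \<in> tree_space UNIV {1, 2, 3}"
      using k(1) l(1) by (simp_all add: ideal_generated_def)
    then have sp: "v' \<in> tree_space (vecs (sgn_dual regular_s2)) {1, 2, 3}" "w' \<in> tree_space UNIV {1, 2, 3}"
      using v w k(2) l(2) by (simp_all add: keys_subset_add)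
    have "map_labels dual_to_regular k \<in> free_kernel regular_s2 {1, 2, 3}"
      using s2_iso.image_free_kernel[OF dual_iso, of "{1, 2, 3}"] k(1) by blast
    then have "lin_ext expand (map_labels dual_to_regular v') = lin_ext expand (map_labels dual_to_regular v)"
      "lin_ext expand w' = lin_ext expand w"
      using l k(2) by (simp_all add: map_labels_linear lin_ext_add expand_free_kernel)
    then have "form (lin_ext expand (map_labels dual_to_regular v)) (lin_ext expand w) =
        form (lin_ext (\<lambda>t. expand (map_btree dual_to_regular id t)) v') (lin_ext expand w')"
      by (simp add: map_labels_def lin_ext_lin_ext)
    also have "\<dots> = (\<Sum>s\<in>Poly_Mapping.keys v'. \<Sum>t\<in>Poly_Mapping.keys w'.
      Poly_Mapping.lookup v' s * Poly_Mapping.lookup w' t * tree_pairing regular_s2 s t)"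
      unfolding form_lin_ext
      using sp by (intro sum.cong refl arg_cong2[of _ _ _ _ "(*)"] tree_pairing_eq_form[symmetric]) auto
    finally show ?thesis by simp
  qed
  have "v \<in> dual_class {1, 2, 3} v" "w \<in> cls {1, 2, 3} w"
    unfolding free_class_def using v w
    by (intro subspace_on.mem_coset[OF operad_with_ideal.subspace_on[OF operad_with_ideal_free]]; simp)+
  note mem = this
  show ?thesis
    unfolding natural_pairing_def
  proof (rule the_equality)
    fix c
    assume "\<forall>v'\<in>dual_class {1, 2, 3} v. \<forall>w'\<in>cls {1, 2, 3} w.
      c = (\<Sum>s\<in>Poly_Mapping.keys v'. \<Sum>t\<in>Poly_Mapping.keys w'.
        Poly_Mapping.lookup v' s * Poly_Mapping.lookup w' t * tree_pairing regular_s2 s t)"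
    from this[rule_format, OF mem] sum[OF mem]
    show "c = form (lin_ext expand (map_labels dual_to_regular v)) (lin_ext expand w)"
      by (rule trans)
  qed (intro ballI sum[symmetric])
qed

section \<open>The annihilator of the relations\<close>

lemma rels_closed: "rels weak_leibniz \<subseteq> cls {1, 2, 3} ` tree_space UNIV {1, 2, 3}"
  using rels_evaluate by (auto simp: evaluation_kernel_def)

lemma congruence_rels:
  "weak_leibniz_congruence (\<lambda>I. {v \<in> tree_space UNIV I. cls I v \<in>
     ideal_generated free_magma (relation_classes :: _ \<Rightarrow> 'k::field magma_comb set set) I})"
  using identities_closed
  by (intro congruence_of_ideal symmetric_operad.operad_ideal_generated symmetric_operad_free)
    (auto intro: ideal_generated_generator)

lemma identity_rels:
  assumes ijk: "(i, j, k) \<in> perms3" and "w = left_id (basis (Leaf i)) (basis (Leaf j)) (basis (Leaf k)) \<or>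
    w = right_id (basis (Leaf i)) (basis (Leaf j)) (basis (Leaf k))"
  shows "cls {1, 2, 3} w \<in> rels weak_leibniz"
proof -
  have ne: "i \<noteq> j" "i \<noteq> k" "j \<noteq> k" and set: "{i, j, k} = {1, 2, 3}"
    using ijk by (auto simp: perms3_def)
  note ids = weak_leibniz_congruence.ids_leaves[OF congruence_rels ne, unfolded set mem_Collect_eq]
  show ?thesis
    unfolding rels_weak_leibniz using assms(2) ids[THEN conjunct2] by metis
qed

text \<open>Evaluation gives one direction and needs 2 to be invertible; the explicit combination of
  identities gives the other and needs 3 to be invertible.\<close>

lemma mem_rels_iff:
  assumes char: "(2 :: 'k::field) \<noteq> 0" "(3 :: 'k) \<noteq> 0" and v: "v \<in> tree_space UNIV {1, 2, 3}"
  shows "cls {1, 2, 3} (v :: 'k magma_comb) \<in> rels weak_leibniz \<longleftrightarrow> orthogonal (lin_ext expand v)"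
proof
  have ex: "lin_ext expand v \<in> tree_space {(1, 0)} {1, 2, 3}"
    using v by (rule lin_ext_expand_closed)
  interpret K: tree_congruence "free_kernel (regular_s2 :: ('k, _) s2_module)"
    by (rule tree_congruence_free_kernel)
  {
    assume "cls {1, 2, 3} v \<in> rels weak_leibniz"
    then have "evaluate d v = 0" for d
      using rels_evaluate by (intro evaluate_cls[OF _ v]) auto
    moreover have "evaluate d (v - lin_ext expand v) = 0" for d
      using K.diff_expand[OF v] free_kernel_evaluate by (auto simp: evaluation_kernel_def)
    ultimately show "orthogonal (lin_ext expand v)"
      using ex char(1) by (intro orthogonal_if_evaluate_zero) (simp_all add: evaluate_diff)
  }
  assume orth: "orthogonal (lin_ext expand v)"
  let ?N = "ideal_generated free_magma (relation_classes :: _ \<Rightarrow> 'k magma_comb set set)"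
  interpret N: weak_leibniz_congruence "\<lambda>I. {v \<in> tree_space UNIV I. cls I v \<in> ?N I}"
    by (rule congruence_rels)
  have "lin_ext expand v \<in> {v \<in> tree_space UNIV {1, 2, 3}. cls {1, 2, 3} v \<in> ?N {1, 2, 3}}"
    using ex orth char(2) by (rule N.mem_if_orthogonal)
  then have "lin_ext expand v + (v - lin_ext expand v) \<in> {v \<in> tree_space UNIV {1, 2, 3}. cls {1, 2, 3} v \<in> ?N {1, 2, 3}}"
    using N.diff_expand[OF v] by (intro N.add) simp_all
  then show "cls {1, 2, 3} v \<in> rels weak_leibniz" by (simp add: rels_weak_leibniz)
qed

text \<open>Both spaces of relations are described by the same condition \<open>orthogonal\<close>
  on coordinates: the relations by \<open>mem_rels_iff\<close>, the annihilator by the two lemmas on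
  \<open>form\<close>.\<close>

lemma dual_rels:
  assumes char: "(2 :: 'k::field) \<noteq> 0" "(3 :: 'k) \<noteq> 0"
  shows "image (map_labels dual_to_regular) ` rels (koszul_dual (weak_leibniz :: ('k, _) quadratic_data)) = rels weak_leibniz"
proof -
  let ?T = "tree_space (vecs (sgn_dual regular_s2)) {1, 2, 3} :: (('k \<times> 'k \<Rightarrow> 'k, nat) btree \<Rightarrow>\<^sub>0 'k) set"
  let ?\<psi> = "map_labels dual_to_regular :: (('k \<times> 'k \<Rightarrow> 'k, nat) btree \<Rightarrow>\<^sub>0 'k) \<Rightarrow> 'k magma_comb"
  interpret iso: s2_iso "sgn_dual regular_s2" "regular_s2 :: ('k, _) s2_module" dual_to_regular regular_to_dual
    by (rule dual_iso)
  have bij: "bij_betw ?\<psi> ?T (tree_space UNIV {1, 2, 3})"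
    using iso.iso_trees by (simp add: operad_iso_iff)
  have \<psi>: "?\<psi> v \<in> tree_space UNIV {1, 2, 3}" if "v \<in> ?T" for v
    using bij that by (auto simp: bij_betw_def)
  have surj: "\<exists>v\<in>?T. u = ?\<psi> v" if "u \<in> tree_space UNIV {1, 2, 3}" for u
  proof -
    have "u \<in> ?\<psi> ` ?T" using that bij_betw_imp_surj_on[OF bij] by simp
    then show ?thesis by (rule imageE) (rule bexI)
  qed
  have cls: "?\<psi> ` dual_class {1, 2, 3} v = cls {1, 2, 3} (?\<psi> v)" for v
  proof -
    have "?\<psi> ` dual_class {1, 2, 3} v = (\<lambda>k. ?\<psi> v + k) ` ?\<psi> ` free_kernel (sgn_dual regular_s2) {1, 2, 3}"
      by (simp add: free_class_def vcoset_def image_image map_labels_linear)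
    also have "\<dots> = (\<lambda>k. ?\<psi> v + k) ` free_kernel regular_s2 {1, 2, 3}"
      by (subst iso.image_free_kernel) simp_all
    also have "\<dots> = cls {1, 2, 3} (?\<psi> v)"
      by (simp add: free_class_def vcoset_def)
    finally show ?thesis .
  qed
  have ops: "ops (free_operad (sgn_dual regular_s2)) {1, 2, 3} = dual_class {1, 2, 3} ` ?T"
    using operad_with_ideal.ops_quot[OF operad_with_ideal_free[of "sgn_dual (regular_s2 :: ('k, _) s2_module)"], of "{1, 2, 3}"]
    by (simp add: free_operad_def free_class_def)
  have perp: "dual_class {1, 2, 3} v \<in> rels (koszul_dual weak_leibniz) \<longleftrightarrow> cls {1, 2, 3} (?\<psi> v) \<in> rels weak_leibniz"
    if v: "v \<in> ?T" for v
  proof -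
    have "dual_class {1, 2, 3} v \<in> rels (koszul_dual weak_leibniz) \<longleftrightarrow>
        (\<forall>w\<in>tree_space UNIV {1, 2, 3}. orthogonal (lin_ext expand w) \<longrightarrow>
          form (lin_ext expand (?\<psi> v)) (lin_ext expand w) = 0)"
    proof -
      have "(rels weak_leibniz :: 'k magma_comb set set) =
          cls {1, 2, 3} ` {w \<in> tree_space UNIV {1, 2, 3}. orthogonal (lin_ext expand w)}"
        using rels_closed mem_rels_iff[OF char] by blast
      then have "dual_class {1, 2, 3} v \<in> rels (koszul_dual weak_leibniz) \<longleftrightarrow>
          (\<forall>w\<in>{w \<in> tree_space UNIV {1, 2, 3}. orthogonal (lin_ext expand w)}.
            natural_pairing regular_s2 (dual_class {1, 2, 3} v) (cls {1, 2, 3} w) = 0)"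
        using v ops by (simp add: koszul_dual_def)
      then show ?thesis using natural_pairing_eq_form[OF v] by (simp add: imp_conjL)
    qed
    \<comment> \<open>From left to right it suffices to test against the identities; from right to
      left all orthogonal vectors have to be considered.\<close>
    also have "\<dots> \<longleftrightarrow> orthogonal (lin_ext expand (?\<psi> v))"
    proof
      assume zero: "\<forall>w\<in>tree_space UNIV {1, 2, 3}. orthogonal (lin_ext expand w) \<longrightarrow>
          form (lin_ext expand (?\<psi> v)) (lin_ext expand w) = 0"
      show "orthogonal (lin_ext expand (?\<psi> v))"
      proof (rule orthogonal_if_form_zero)
        fix i j k assume ijk: "(i, j, k) \<in> perms3"
        have "form (lin_ext expand (?\<psi> v)) w = 0"
          if "w = left_id (basis (Leaf i)) (basis (Leaf j)) (basis (Leaf k)) \<or>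
            w = right_id (basis (Leaf i)) (basis (Leaf j)) (basis (Leaf k))" for w
        proof -
          have w: "w \<in> tree_space UNIV {1, 2, 3}" "lin_ext expand w = w" "cls {1, 2, 3} w \<in> rels weak_leibniz"
            using identity_leaves[OF ijk that] identity_rels[OF ijk that] by blast+
          have "orthogonal (lin_ext expand w)" using mem_rels_iff[OF char w(1)] w(3) by blast
          with zero w(1) have "form (lin_ext expand (?\<psi> v)) (lin_ext expand w) = 0" by blast
          then show ?thesis by (simp only: w(2))
        qed
        then show "form (lin_ext expand (?\<psi> v)) (left_id (basis (Leaf i)) (basis (Leaf j)) (basis (Leaf k))) = 0 \<and>
           form (lin_ext expand (?\<psi> v)) (right_id (basis (Leaf i)) (basis (Leaf j)) (basis (Leaf k))) = 0"
          by blast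
      qed
    qed (simp add: form_orthogonal[OF _ _ char(2)])
    also have "\<dots> \<longleftrightarrow> cls {1, 2, 3} (?\<psi> v) \<in> rels weak_leibniz"
      using mem_rels_iff[OF char \<psi>[OF v]] by simp
    finally show ?thesis .
  qed
  show ?thesis
  proof (intro equalityI subsetI)
    fix Y assume "Y \<in> image ?\<psi> ` rels (koszul_dual weak_leibniz)"
    then obtain X where X: "X \<in> rels (koszul_dual weak_leibniz)" "Y = ?\<psi> ` X" by blast
    then obtain v where v: "v \<in> ?T" "X = dual_class {1, 2, 3} v"
      using ops by (auto simp: koszul_dual_def)
    then show "Y \<in> rels weak_leibniz" using X perp[OF v(1)] cls by simp
  next
    fix Y :: "'k magma_comb set" assume Y: "Y \<in> rels weak_leibniz"
    then obtain u where u: "u \<in> tree_space UNIV {1, 2, 3}" "Y = cls {1, 2, 3} u"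
      using rels_closed by blast
    obtain v where v: "v \<in> ?T" "u = ?\<psi> v" using surj[OF u(1)] by blast
    then have "dual_class {1, 2, 3} v \<in> rels (koszul_dual weak_leibniz)" "Y = ?\<psi> ` dual_class {1, 2, 3} v"
      using perp[OF v(1)] Y u cls by simp_all
    then show "Y \<in> image ?\<psi> ` rels (koszul_dual weak_leibniz)" by blast
  qed
qed

text \<open>Otherwise the characteristic would divide \<open>p\<close>, hence be 1 or
  \<open>p\<close>.\<close>

lemma of_nat_prime_neq_zero:
  assumes "prime p" "CHAR('k::field) \<noteq> p"
  shows "(of_nat p :: 'k) \<noteq> 0"
proof
  assume "(of_nat p :: 'k) = 0"
  then have "CHAR('k) dvd p" by (simp add: of_nat_eq_0_iff_char_dvd)
  then have "CHAR('k) = 1" using assms prime_nat_iff by blast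
  then show False using CHAR_not_1[where 'a = 'k] by simp
qed

theorem self_dual:
  assumes "(2 :: 'k::field) \<noteq> 0" "(3 :: 'k) \<noteq> 0"
  shows "isomorphic_operads (quadratic_operad (koszul_dual weak_leibniz))
    (weak_leibniz_operad :: ('k, 'k magma_comb set set) operad)"
  by (rule s2_iso.isomorphic_quadratic[OF dual_iso])
    (use dual_rels[OF assms] in \<open>auto simp: koszul_dual_def\<close>)

section \<open>Contraction of edges\<close>

definition children :: "nat set list \<Rightarrow> nat set \<Rightarrow> nat set set" where
  "children es A =
     (let above = {C. C \<subset> A \<and> (C \<in> set es \<or> (\<exists>i\<in>A. C = {i}))}
      in {C \<in> above. \<not> (\<exists>D\<in>above. C \<subset> D)})"

lemma inputs_eq: "inputs es A = Min ` children es A"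
  by (simp add: inputs_def children_def Let_def)

lemma children_iff:
  "C \<in> children es A \<longleftrightarrow> C \<subset> A \<and> (C \<in> set es \<or> (\<exists>i\<in>A. C = {i})) \<and>
     (\<forall>D. D \<subset> A \<and> (D \<in> set es \<or> (\<exists>i\<in>A. D = {i})) \<longrightarrow> \<not> C \<subset> D)"
  by (auto simp: children_def Let_def)

lemma children_cong: "set es = set fs \<Longrightarrow> children es A = children fs A"
  by (simp add: children_def)

lemma inputs_cong: "set es = set fs \<Longrightarrow> inputs es A = inputs fs A"
  by (simp add: inputs_eq children_cong[of es fs])

text \<open>The partition of a vertex into its children determines them.\<close>

lemma children_eqI:
  assumes cover: "\<Union>P = A" "A \<notin> P" "{} \<notin> P"
    and disj: "\<And>C D. C \<in> P \<Longrightarrow> D \<in> P \<Longrightarrow> C \<noteq> D \<Longrightarrow> C \<inter> D = {}"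
    and sub: "\<And>C. C \<in> P \<Longrightarrow> C \<in> set es \<or> (\<exists>i\<in>A. C = {i})"
    and max: "\<And>D. D \<in> set es \<Longrightarrow> D \<subset> A \<Longrightarrow> \<exists>C\<in>P. D \<subseteq> C"
  shows "children es A = P"
proof -
  have below: "\<exists>C\<in>P. D \<subseteq> C" if "D \<subset> A" "D \<in> set es \<or> (\<exists>i\<in>A. D = {i})" for D
    using that max[of D] cover(1) by blast
  have psub: "C \<subset> A" if "C \<in> P" for C
    using that cover(1,2) by (metis Union_upper psubsetI)
  have antichain: "C = D" if "C \<in> P" "D \<in> P" "C \<subseteq> D" for C D
    using that disj[of C D] cover(3) by (metis Int_absorb2)
  show ?thesis
  proof (intro equalityI subsetI)
    fix C assume "C \<in> children es A"
    then have C: "C \<subset> A" "C \<in> set es \<or> (\<exists>i\<in>A. C = {i})"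
      "\<And>D. D \<subset> A \<Longrightarrow> D \<in> set es \<or> (\<exists>i\<in>A. D = {i}) \<Longrightarrow> \<not> C \<subset> D"
      by (auto simp: children_iff)
    obtain D where D: "D \<in> P" "C \<subseteq> D" using below[OF C(1,2)] by blast
    then have "C = D" using C(3)[OF psub sub] by blast
    then show "C \<in> P" using D by simp
  next
    fix C assume C: "C \<in> P"
    have "\<not> C \<subset> D" if D: "D \<subset> A" "D \<in> set es \<or> (\<exists>i\<in>A. D = {i})" for D
    proof
      assume "C \<subset> D"
      moreover obtain C' where "C' \<in> P" "D \<subseteq> C'" using below[OF D] by blast
      ultimately show False using antichain[of C C'] C by blast
    qed
    then show "C \<in> children es A" using psub[OF C] sub[OF C] by (simp add: children_iff)
  qed
qed

lemma mem_vertices: "V \<in> vertices n es \<longleftrightarrow> V = {1..n} \<or> V \<in> set es"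
  by (simp add: vertices_def)

lemma vertex_finite: "edge_list n es \<Longrightarrow> V \<in> vertices n es \<Longrightarrow> finite V"
  unfolding edge_list_def mem_vertices by (auto intro: finite_subset[of V "{1..n}"])

lemma vertex_card: "edge_list n es \<Longrightarrow> 2 \<le> n \<Longrightarrow> V \<in> vertices n es \<Longrightarrow> 2 \<le> card V"
  unfolding edge_list_def mem_vertices by auto

lemma vertex_subset: "edge_list n es \<Longrightarrow> V \<in> vertices n es \<Longrightarrow> V \<subseteq> {1..n}"
  unfolding edge_list_def mem_vertices by auto

lemma edge_psubset: "edge_list n es \<Longrightarrow> A \<in> set es \<Longrightarrow> A \<subset> {1..n}"
  unfolding edge_list_def by blast

lemma edge_laminar:
  "edge_list n es \<Longrightarrow> A \<in> set es \<Longrightarrow> B \<in> set es \<Longrightarrow> A \<subseteq> B \<or> B \<subseteq> A \<or> A \<inter> B = {}"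
  unfolding edge_list_def by blast

lemma vertex_laminar:
  assumes "edge_list n es" "A \<in> vertices n es" "B \<in> vertices n es"
  shows "A \<subseteq> B \<or> B \<subseteq> A \<or> A \<inter> B = {}"
  using assms edge_laminar[OF assms(1)] edge_psubset[OF assms(1)] unfolding mem_vertices by blast

locale vertex =
  fixes n :: nat and es :: "nat set list" and V :: "nat set"
  assumes edges: "edge_list n es" and n: "2 \<le> n" and V: "V \<in> vertices n es"
begin

lemma finite_V: "finite V"
  using vertex_finite edges V by blast

lemma child_finite: "C \<in> children es V \<Longrightarrow> finite C"
  using finite_V by (auto simp: children_iff intro: finite_subset[of C V])

lemma child_psubset: "C \<in> children es V \<Longrightarrow> C \<subset> V"
  by (simp add: children_iff)

lemma finite_children: "finite (children es V)"
  using finite_V child_psubset by (intro finite_subset[of "children es V" "Pow V"]) auto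

lemma child_nonempty: "C \<in> children es V \<Longrightarrow> C \<noteq> {}"
proof
  assume "C \<in> children es V" "C = {}"
  then have "{} \<in> set es" by (auto simp: children_iff)
  then show False using edges by (auto simp: edge_list_def)
qed

lemma below_child:
  assumes "D \<subset> V" "D \<in> set es \<or> (\<exists>i\<in>V. D = {i})"
  shows "\<exists>C\<in>children es V. D \<subseteq> C"
proof -
  let ?above = "{C. C \<subset> V \<and> (C \<in> set es \<or> (\<exists>i\<in>V. C = {i}))}"
  have "finite ?above" using finite_V by (intro finite_subset[of ?above "Pow V"]) auto
  then obtain C where C: "C \<in> ?above" "D \<subseteq> C" "\<forall>E\<in>?above. C \<subseteq> E \<longrightarrow> C = E"
    using finite_has_maximal2[of ?above D] assms by (smt (verit) mem_Collect_eq)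
  then have "C \<in> children es V" by (auto simp: children_iff)
  with C(2) show ?thesis by blast
qed

lemma Union_children: "\<Union>(children es V) = V"
proof
  show "V \<subseteq> \<Union>(children es V)"
  proof
    fix i assume i: "i \<in> V"
    then have "{i} \<noteq> V" using vertex_card[OF edges n V] by auto
    then show "i \<in> \<Union>(children es V)" using below_child[of "{i}"] i by blast
  qed
qed (use child_psubset in blast)

lemma child_laminar:
  assumes "C \<in> children es V" "D \<in> children es V"
  shows "C \<subseteq> D \<or> D \<subseteq> C \<or> C \<inter> D = {}"
  using assms edge_laminar[OF edges, of C D] by (auto simp: children_iff)

lemma children_disjoint:
  assumes "C \<in> children es V" "D \<in> children es V" "C \<noteq> D"
  shows "C \<inter> D = {}"
proof -
  have "\<not> C \<subset> D" "\<not> D \<subset> C" using assms(1,2) by (simp_all add: children_iff)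
  then show ?thesis using child_laminar[OF assms(1,2)] assms(3) by blast
qed

lemma Min_child: "C \<in> children es V \<Longrightarrow> Min C \<in> C"
  using child_finite child_nonempty by (intro Min_in) auto

lemma inj_Min: "inj_on Min (children es V)"
proof (rule inj_onI)
  fix C D assume CD: "C \<in> children es V" "D \<in> children es V" "Min C = Min D"
  then have "Min C \<in> C \<inter> D" using Min_child[of C] Min_child[of D] by simp
  then show "C = D" using children_disjoint[OF CD(1,2)] by blast
qed

lemma finite_inputs: "finite (inputs es V)"
  unfolding inputs_eq using finite_children by simp

lemma inputs_subset: "inputs es V \<subseteq> V"
  unfolding inputs_eq using Min_child child_psubset by blast

end

definition parent :: "nat \<Rightarrow> nat set list \<Rightarrow> nat set \<Rightarrow> nat set \<Rightarrow> bool" where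
  "parent n es A B \<longleftrightarrow> B \<in> vertices n es \<and> A \<subset> B \<and> (\<forall>C\<in>vertices n es. A \<subset> C \<longrightarrow> B \<subseteq> C)"

lemma parent_Inter: "parent n es A B \<Longrightarrow> \<Inter>{C \<in> vertices n es. A \<subset> C} = B"
  unfolding parent_def by (intro equalityI Inter_lower Inter_greatest) auto

text \<open>Only the set of the remaining edges is prescribed. Their order enters the complex
  through signs alone, and these are dealt with separately.\<close>

locale contraction =
  fixes n :: nat and es es' :: "nat set list" and A B :: "nat set"
  assumes edges: "edge_list n es" and n: "2 \<le> n" and A: "A \<in> set es" and parent: "parent n es A B"
    and es': "set es' = set es - {A}" "distinct es'"
begin

lemma edges': "edge_list n es'"
  using edges es' unfolding edge_list_def by blast

lemma B: "B \<in> vertices n es" "A \<subset> B" and least: "C \<in> vertices n es \<Longrightarrow> A \<subset> C \<Longrightarrow> B \<subseteq> C"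
  using parent unfolding parent_def by blast+

lemma A_vertex: "A \<in> vertices n es"
  using A by (simp add: mem_vertices)

lemma A_not_singleton: "A \<noteq> {i}"
  using vertex_card[OF edges n A_vertex] by auto

lemma vertices_contract: "vertices n es' = vertices n es - {A}"
  using es' edge_psubset[OF edges A] by (auto simp: vertices_def)

sublocale VB: vertex n es B
  using edges n B by unfold_locales

sublocale VA: vertex n es A
  using edges n A_vertex by unfold_locales

lemma A_child: "A \<in> children es B"
proof -
  have "\<not> A \<subset> D" if "D \<subset> B" "D \<in> set es \<or> (\<exists>i\<in>B. D = {i})" for D
  proof
    assume D: "A \<subset> D"
    then have "D \<noteq> {i}" for i using A_not_singleton[of i] VB.finite_V vertex_card[OF edges n A_vertex]
      by (metis card.empty not_numeral_le_zero psubset_imp_subset subset_singletonD)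
    then have "D \<in> set es" using that by blast
    then show False using least[of D] D that(1) by (auto simp: mem_vertices)
  qed
  then show ?thesis using A B by (simp add: children_iff)
qed

lemma children_contract: "children es' B = children es B - {A} \<union> children es A"
proof (rule children_eqI)
  have "\<Union>(children es B - {A}) \<union> A = B"
    using VB.Union_children A_child by blast
  then show "\<Union>(children es B - {A} \<union> children es A) = B"
    using VA.Union_children by blast
  show "B \<notin> children es B - {A} \<union> children es A"
    using VB.child_psubset VA.child_psubset B by blast
  show "{} \<notin> children es B - {A} \<union> children es A"
    using VB.child_nonempty VA.child_nonempty by blast
  show "C \<inter> D = {}" if "C \<in> children es B - {A} \<union> children es A"
    "D \<in> children es B - {A} \<union> children es A" "C \<noteq> D" for C D
  proof -
    have mixed: "E \<inter> F = {}" if "E \<in> children es B - {A}" "F \<in> children es A" for E F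
    proof -
      have "A \<inter> E = {}" using that VB.children_disjoint[OF A_child, of E] by auto
      then show ?thesis using VA.child_psubset[OF that(2)] by blast
    qed
    show ?thesis
      using that(1,2) VB.children_disjoint[OF _ _ that(3)] VA.children_disjoint[OF _ _ that(3)]
        mixed[of C D] mixed[of D C] by (elim UnE) (simp_all add: Int_commute)
  qed
  show "C \<in> set es' \<or> (\<exists>i\<in>B. C = {i})" if "C \<in> children es B - {A} \<union> children es A" for C
    using that es'(1) B(2) VA.child_psubset[of C] by (auto simp: children_iff)
  show "\<exists>C\<in>children es B - {A} \<union> children es A. D \<subseteq> C" if D: "D \<in> set es'" "D \<subset> B" for D
  proof -
    have D': "D \<in> set es" "D \<noteq> A" using D es' by auto
    obtain C where C: "C \<in> children es B" "D \<subseteq> C" using VB.below_child[OF D(2)] D' by blast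
    show ?thesis
    proof (cases "C = A")
      case True
      then have "D \<subset> A" using C D' by blast
      then show ?thesis using VA.below_child D' by blast
    qed (use C in blast)
  qed
qed

text \<open>Another vertex above \<open>A\<close> contains the least one \<open>B\<close>, which
  then lies strictly between \<open>A\<close> and that vertex.\<close>

lemma not_child_other:
  assumes V: "V \<in> vertices n es" "V \<noteq> B"
  shows "A \<notin> children es V"
proof
  assume A_V: "A \<in> children es V"
  then have "A \<subset> V" and max: "D \<subset> V \<Longrightarrow> D \<in> set es \<Longrightarrow> \<not> A \<subset> D" for D
    by (simp_all add: children_iff)
  then have "B \<subset> V" using least[OF V(1)] V(2) by auto
  moreover from this have "B \<in> set es"
    using vertex_subset[OF edges V(1)] B(1) by (auto simp: mem_vertices)
  ultimately show False using max[of B] B(2) by simp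
qed

lemma children_other:
  assumes V: "V \<in> vertices n es" "V \<noteq> B"
  shows "children es' V = children es V"
proof -
  interpret V: vertex n es V using edges n V(1) by unfold_locales
  have A_V: "A \<notin> children es V" using V by (rule not_child_other)
  show ?thesis
  proof (rule children_eqI[OF V.Union_children])
    show "V \<notin> children es V" "{} \<notin> children es V"
      using V.child_psubset V.child_nonempty by auto
    show "C \<inter> D = {}" if "C \<in> children es V" "D \<in> children es V" "C \<noteq> D" for C D
      using that by (rule V.children_disjoint)
    show "C \<in> set es' \<or> (\<exists>i\<in>V. C = {i})" if "C \<in> children es V" for C
      using that A_V es'(1) by (auto simp: children_iff)
    show "\<exists>C\<in>children es V. D \<subseteq> C" if "D \<in> set es'" "D \<subset> V" for D
      using that es'(1) by (intro V.below_child) simp_all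
  qed
qed

lemma inputs_contract: "inputs es' B = inputs es B - {Min A} \<union> inputs es A"
proof -
  have "Min ` (children es B - {A}) = Min ` children es B - Min ` {A}"
    using VB.inj_Min A_child by (intro inj_on_image_set_diff[of _ "children es B"]) auto
  then show ?thesis by (simp add: inputs_eq children_contract image_Un)
qed

lemma inputs_other: "V \<in> vertices n es \<Longrightarrow> V \<noteq> B \<Longrightarrow> inputs es' V = inputs es V"
  by (simp add: inputs_eq children_other)

text \<open>Inputs are least leaves: those of \<open>A\<close> lie in \<open>A\<close>, and those of
  \<open>B\<close> other than \<open>Min A\<close> lie in children disjoint from
  \<open>A\<close>.\<close>

lemma composable_inputs: "composable (inputs es B) (Min A) (inputs es A)"
proof -
  have "Min C \<notin> A" if "C \<in> children es B" "Min C \<noteq> Min A" for C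
    using that VB.children_disjoint[OF that(1) A_child] VB.Min_child[OF that(1)] by blast
  then have "(inputs es B - {Min A}) \<inter> inputs es A = {}"
    using VA.inputs_subset unfolding inputs_eq[of es B] by blast
  moreover have "Min A \<in> inputs es B" using A_child by (simp add: inputs_eq)
  ultimately show ?thesis
    using VB.finite_inputs VA.finite_inputs by (simp add: composable_def)
qed

lemma contract_apply:
  "V \<in> vertices n es' \<Longrightarrow> contract P n es A x V =
     (if V = B then compose P (inputs es B) (Min A) (inputs es A) (x B) (x A) else x V)"
  by (simp add: contract_def parent_Inter[OF parent] vertices_contract)

lemma contract_decorations:
  assumes P: "symmetric_operad P" and x: "x \<in> decorations P n es"
  shows "contract P n es A x \<in> decorations P n es'"
proof -
  have xV: "x V \<in> ops P (inputs es V)" if "V \<in> vertices n es" for V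
    using x that by (auto simp: decorations_def)
  have "contract P n es A x V \<in> ops P (inputs es' V)" if V: "V \<in> vertices n es'" for V
    using V xV[of V] xV[OF B(1)] xV[OF A_vertex] symmetric_operad.compose_closed[OF P composable_inputs]
    by (auto simp: contract_apply inputs_contract inputs_other vertices_contract)
  moreover have "contract P n es A x \<in> extensional (vertices n es')"
    by (simp add: contract_def vertices_contract Let_def)
  ultimately show ?thesis by (simp add: decorations_def PiE_iff)
qed

end

section \<open>Functionals on the weak Leibniz operad\<close>

abbreviation WL :: "('k::field, 'k magma_comb set set) operad" where
  "WL \<equiv> weak_leibniz_operad"

abbreviation wl_ideal :: "nat set \<Rightarrow> 'k::field magma_comb set set" where
  "wl_ideal \<equiv> quadratic_ideal weak_leibniz"

definition wcls :: "nat set \<Rightarrow> 'k::field magma_comb \<Rightarrow> 'k magma_comb set set" where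
  "wcls I v = vcoset (space free_magma I) (wl_ideal I) (cls I v)"

lemma operad_hom_comp:
  assumes "operad_hom P Q \<phi>" "operad_hom Q R \<psi>"
  shows "operad_hom P R (\<lambda>I x. \<psi> I (\<phi> I x))"
  unfolding operad_hom_def
proof (intro conjI allI impI ballI)
  note h = operad_homD[OF assms(1)] operad_homD[OF assms(2)]
  show "is_linear (space P I) (space R I) (\<lambda>x. \<psi> I (\<phi> I x))" if "finite I" for I
    using h(1)[OF that] h(6)[OF that] by (rule linear_comp)
  show "\<psi> (f ` I) (\<phi> (f ` I) (relabel P I f x)) = relabel R I f (\<psi> I (\<phi> I x))"
    if "x \<in> ops P I" "finite I \<and> inj_on f I" for I f x
    using that by (simp add: h(2,3,8))
  show "\<psi> (I - {a} \<union> J) (\<phi> (I - {a} \<union> J) (compose P I a J x y)) =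
      compose R I a J (\<psi> I (\<phi> I x)) (\<psi> J (\<phi> J y))"
    if "x \<in> ops P I" "y \<in> ops P J" "composable I a J" for I a J x y
    using that composable_finite[OF that(3)] by (simp add: h(2,4,9))
  show "\<psi> {a} (\<phi> {a} (unit P a)) = unit R a" for a
    by (simp add: h(5,10))
qed

lemma wl_quotient: "operad_with_ideal free_magma (wl_ideal :: _ \<Rightarrow> 'k::field magma_comb set set)"
  using operad_with_ideal_quadratic[of weak_leibniz] by simp

lemma WL_eq: "WL = quotient_operad free_magma wl_ideal"
  by (simp add: quadratic_operad_def)

lemma symmetric_operad_WL: "symmetric_operad WL"
  by (rule symmetric_operad_quadratic)

lemma hom_wcls: "operad_hom (tree_operad UNIV) WL wcls"
proof -
  have "operad_hom (tree_operad UNIV) WL (\<lambda>I v. vcoset (space free_magma I) (wl_ideal I) (cls I v))"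
    unfolding WL_eq by (rule operad_hom_comp[OF hom_cls operad_with_ideal.hom_proj[OF wl_quotient]])
  then show ?thesis by (simp add: wcls_def[abs_def])
qed

lemma ops_WL: "ops WL I = wcls I ` tree_space UNIV I"
  unfolding WL_eq operad_with_ideal.ops_quot[OF wl_quotient] ops_free_magma
  by (simp add: wcls_def image_image)

lemma cls_add:
  fixes v w :: "'k::field magma_comb"
  shows "finite I \<Longrightarrow> v \<in> tree_space UNIV I \<Longrightarrow> w \<in> tree_space UNIV I \<Longrightarrow>
    cls I (v + w) = vadd (space free_magma I) (cls I v) (cls I w)"
  using operad_homD(1)[OF hom_cls[where 'a = 'k], of I] by (simp add: is_linear_def)

lemma wcls_add:
  fixes v w :: "'k::field magma_comb"
  shows "finite I \<Longrightarrow> v \<in> tree_space UNIV I \<Longrightarrow> w \<in> tree_space UNIV I \<Longrightarrow>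
    wcls I (v + w) = vadd (space WL I) (wcls I v) (wcls I w)"
  using operad_homD(1)[OF hom_wcls[where 'a = 'k], of I] by (simp add: is_linear_def)

lemma wcls_scale:
  fixes v :: "'k::field magma_comb"
  shows "finite I \<Longrightarrow> v \<in> tree_space UNIV I \<Longrightarrow>
    wcls I (fscale c v) = vscale (space WL I) c (wcls I v)"
  using operad_homD(1)[OF hom_wcls[where 'a = 'k], of I] by (simp add: is_linear_def)

lemma relation_classes_wl: "relation_classes {1, 2, 3} \<subseteq> (wl_ideal {1, 2, 3} :: 'k::field magma_comb set set)"
proof
  fix X :: "'k magma_comb set" assume X: "X \<in> relation_classes {1, 2, 3}"
  then have ops: "X \<in> ops free_magma {1, 2, 3}" using identities_closed by blast
  then have "X \<in> rels weak_leibniz"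
    using X unfolding rels_weak_leibniz by (intro ideal_generated_generator)
  then show "X \<in> wl_ideal {1, 2, 3}"
    using ops by (intro ideal_generated_generator) simp_all
qed

text \<open>The kernel of the projection of combinations of trees onto the weak Leibniz operad, see
  \<open>wcls_eqI\<close> and \<open>wcls_eqD\<close>.\<close>

definition wl_kernel :: "nat set \<Rightarrow> 'k::field magma_comb set" where
  "wl_kernel I = {v \<in> tree_space UNIV I. cls I v \<in> wl_ideal I}"

lemma congruence_wl: "weak_leibniz_congruence wl_kernel"
  unfolding wl_kernel_def[abs_def]
  by (rule congruence_of_ideal[OF operad_with_ideal.ideal[OF wl_quotient] relation_classes_wl])

lemma wcls_eqI:
  assumes fin: "finite I" and vw: "v \<in> tree_space UNIV I" "w \<in> tree_space UNIV I" and diff: "v - w \<in> wl_kernel I"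
  shows "wcls I v = wcls I w"
proof -
  have "cls I v = cls I (w + (v - w))" by simp
  also have "\<dots> = vadd (space free_magma I) (cls I w) (cls I (v - w))"
    using fin vw diff by (intro cls_add) (simp_all add: wl_kernel_def)
  finally show ?thesis
    using operad_with_ideal.proj_add[OF wl_quotient fin, of "cls I w" "cls I (v - w)"] vw diff
    by (simp add: wcls_def wl_kernel_def ops_free_magma)
qed

text \<open>The generators of the ideal evaluate to zero, hence so does the ideal. This makes
  evaluation a function on the weak Leibniz operad.\<close>

lemma wl_kernel_evaluate:
  assumes "finite I" "v \<in> wl_kernel I"
  shows "evaluate d v = 0"
proof -
  have "wl_ideal I \<subseteq> cls I ` evaluation_kernel I"
    unfolding gens_weak_leibniz
    using rels_evaluate by (intro ideal_generated_least[OF evaluation_ideal]) auto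
  then show ?thesis using assms by (intro evaluate_cls[of I]) (auto simp: wl_kernel_def)
qed

lemma wcls_eqD:
  assumes fin: "finite I" and vw: "v \<in> tree_space UNIV I" "w \<in> tree_space UNIV I" and eq: "wcls I v = wcls I w"
  shows "v - w \<in> wl_kernel I"
proof -
  obtain X where X: "X \<in> wl_ideal I" "cls I v = vadd (space free_magma I) (cls I w) X"
    using operad_with_ideal.proj_eq_iff[OF wl_quotient fin, of "cls I v" "cls I w"] vw eq
    by (auto simp: wcls_def ops_free_magma)
  have "X \<in> ops free_magma I"
    using operad_idealD(2)[OF operad_with_ideal.ideal[OF wl_quotient] fin X(1)] .
  then obtain u where u: "u \<in> tree_space UNIV I" "X = cls I u" by (auto simp: ops_free_magma)
  have "cls I v = cls I (w + u)"
    using X(2) cls_add[OF fin vw(2) u(1)] u(2) by simp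
  then have "v - (w + u) \<in> free_kernel regular_s2 I"
    using cls_eq_iff[OF fin vw(1), of "w + u"] vw(2) u(1) by (simp add: keys_subset_add)
  moreover have "free_kernel regular_s2 I \<subseteq> wl_kernel I"
    unfolding regular_s2_sel
    using weak_leibniz_congruence.axioms(1)[OF congruence_wl] unfolding tree_congruence_def
    by (intro ideal_generated_least) auto
  moreover have "u \<in> wl_kernel I" using u X(1) by (simp add: wl_kernel_def)
  ultimately have "(v - (w + u)) + u \<in> wl_kernel I"
    by (intro tree_congruence.add[OF weak_leibniz_congruence.axioms(1)[OF congruence_wl] fin]) auto
  then show ?thesis by (simp add: algebra_simps)
qed

text \<open>A representative is chosen; by \<open>wl_kernel_evaluate\<close> the value does not
  depend on the choice, which is \<open>val_wcls\<close>.\<close>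

definition val :: "nat set \<Rightarrow> (nat \<Rightarrow> 'k) \<Rightarrow> 'k::field magma_comb set set \<Rightarrow> 'k poly" where
  "val I d X = evaluate d (SOME v. v \<in> tree_space UNIV I \<and> X = wcls I v)"

lemma val_wcls:
  assumes "finite I" "v \<in> tree_space UNIV I"
  shows "val I d (wcls I v) = evaluate d v"
proof -
  define w where "w = (SOME w. w \<in> tree_space UNIV I \<and> wcls I v = wcls I w)"
  have w: "w \<in> tree_space UNIV I" "wcls I v = wcls I w"
    using someI[of "\<lambda>w. w \<in> tree_space UNIV I \<and> wcls I v = wcls I w" v] assms(2) unfolding w_def by auto
  then have "evaluate d (v - w) = 0"
    using wcls_eqD[OF assms(1,2) w] wl_kernel_evaluate[OF assms(1)] by blast
  then show ?thesis unfolding val_def w_def[symmetric] by (simp add: evaluate_diff)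
qed

lemma val_add:
  assumes "finite I" "X \<in> ops WL I" "Y \<in> ops WL I"
  shows "val I d (vadd (space WL I) X Y) = val I d X + val I d Y"
proof -
  obtain v w where vw: "v \<in> tree_space UNIV I" "w \<in> tree_space UNIV I" "X = wcls I v" "Y = wcls I w"
    using assms unfolding ops_WL by blast
  then have "vadd (space WL I) X Y = wcls I (v + w)"
    using assms(1) by (simp add: wcls_add)
  then show ?thesis
    using vw assms(1) val_wcls[of I v] val_wcls[of I w] val_wcls[of I "v + w"]
    by (simp add: keys_subset_add evaluate_add)
qed

lemma val_scale:
  assumes "finite I" "X \<in> ops WL I"
  shows "val I d (vscale (space WL I) c X) = smult c (val I d X)"
proof -
  obtain v where v: "v \<in> tree_space UNIV I" "X = wcls I v"
    using assms unfolding ops_WL by blast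
  then have "vscale (space WL I) c X = wcls I (fscale c v)"
    using assms(1) by (simp add: wcls_scale)
  then show ?thesis
    using v assms(1) val_wcls[of I v] val_wcls[of I "fscale c v"]
    by (simp add: keys_subset_fscale evaluate_fscale)
qed

lemma val_compose:
  assumes c: "composable I a J" and X: "X \<in> ops WL I" and Y: "Y \<in> ops WL J"
  shows "val (I - {a} \<union> J) d (compose WL I a J X Y) = val I (d(a := sum d J)) X * val J d Y"
proof -
  obtain v where v: "v \<in> tree_space UNIV I" "X = wcls I v"
    using X unfolding ops_WL by blast
  obtain w where w: "w \<in> tree_space UNIV J" "Y = wcls J w"
    using Y unfolding ops_WL by blast
  have "compose WL I a J X Y = wcls (I - {a} \<union> J) (insert_trees a v w)"
    using operad_homD(4)[OF hom_wcls c, of v w] v w by simp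
  then show ?thesis
    using v w val_wcls[of I v] val_wcls[of J w] val_wcls[OF _ insert_trees_closed[OF c v(1) w(1)]]
      composable_finite[OF c] evaluate_insert[OF c v(1) w(1)]
    by simp
qed

text \<open>Every \<open>d\<close> gives the same constant coefficient, see
  \<open>coeff_0_val\<close>; zero frequencies are an arbitrary choice.\<close>

definition const_part :: "nat set \<Rightarrow> 'k::field magma_comb set set \<Rightarrow> 'k" where
  "const_part I X = coeff (val I (\<lambda>_. 0) X) 0"

definition lin_part :: "nat set \<Rightarrow> (nat \<Rightarrow> 'k) \<Rightarrow> 'k::field magma_comb set set \<Rightarrow> 'k" where
  "lin_part I d X = coeff (val I d X) 1"

lemma coeff_0_evaluate: "coeff (evaluate d v) 0 = coeff (evaluate d' v) 0"
proof -
  have "coeff (ev d t) 0 = coeff (ev d' t) 0" for t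
    by (induction t) (simp_all add: coeff_mult)
  then show ?thesis by (simp add: evaluate_def coeff_sum)
qed

lemma coeff_0_val: "coeff (val I d X) 0 = const_part I X"
  unfolding val_def const_part_def by (rule coeff_0_evaluate)

lemma const_part_compose:
  assumes "composable I a J" "X \<in> ops WL I" "Y \<in> ops WL J"
  shows "const_part (I - {a} \<union> J) (compose WL I a J X Y) = const_part I X * const_part J Y"
  using val_compose[OF assms, of "\<lambda>_. 0"]
  by (simp add: const_part_def[of "I - {a} \<union> J"] coeff_mult coeff_0_val)

text \<open>The coefficient of \<epsilon> in a product of two polynomials. Constant and linear parts
  of a composite thus depend only on those of its factors, which is all that a cocycle with one
  linear factor requires.\<close>

lemma lin_part_compose:
  assumes "composable I a J" "X \<in> ops WL I" "Y \<in> ops WL J"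
  shows "lin_part (I - {a} \<union> J) d (compose WL I a J X Y) =
    const_part I X * lin_part J d Y + lin_part I (d(a := sum d J)) X * const_part J Y"
  using val_compose[OF assms, of d] by (simp add: lin_part_def coeff_mult coeff_0_val)

lemma trees_two:
  assumes t: "t \<in> trees X {a, b}" and ab: "a \<noteq> b"
  obtains e where "t = Node e (Leaf a) (Leaf b) \<or> t = Node e (Leaf b) (Leaf a)"
proof -
  have m: "multilinear_tree t" "leaves t = {a, b}" using t by (simp_all add: trees_def)
  then have "card (leaves t) = 2" using ab by simp
  then obtain f i j where "t = Node f (Leaf i) (Leaf j)"
    by (rule multilinear_card2[OF m(1)])
  then show thesis using m(2) by (intro that[of f]) (auto simp: doubleton_eq_iff)
qed

text \<open>A binary operation is a combination of ab and ba, whose linear parts are opposite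
  multiples of \<open>d b - d a\<close>. The scalar \<open>l\<close> is the linear part at the
  indicator of \<open>b\<close>.\<close>

lemma lin_part_binary:
  assumes X: "X \<in> ops WL {a, b}" and ab: "a \<noteq> b"
  obtains l where "\<And>d. lin_part {a, b} d X = (d b - d a) * l"
proof -
  obtain v where v: "v \<in> tree_space UNIV {a, b}" "X = wcls {a, b} v"
    using X unfolding ops_WL by blast
  define \<delta> :: "nat \<Rightarrow> 'a" where "\<delta> i = (if i = b then 1 else 0)" for i
  have ev_two: "coeff (ev d t) 1 = (d b - d a) * coeff (ev \<delta> t) 1" if "t \<in> trees UNIV {a, b}" for t and d :: "nat \<Rightarrow> 'a"
    by (rule trees_two[OF that ab]) (use ab in \<open>auto simp: \<delta>_def algebra_simps\<close>)
  have lin: "coeff (evaluate d v) 1 = (d b - d a) * coeff (evaluate \<delta> v) 1" for d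
  proof -
    have eq: "(\<Sum>t\<in>Poly_Mapping.keys v. Poly_Mapping.lookup v t * coeff (ev d t) 1) =
        (\<Sum>t\<in>Poly_Mapping.keys v. Poly_Mapping.lookup v t * ((d b - d a) * coeff (ev \<delta> t) 1))"
    proof (rule sum.cong[OF refl])
      fix t assume "t \<in> Poly_Mapping.keys v"
      then have "t \<in> trees UNIV {a, b}" using v(1) by auto
      then show "Poly_Mapping.lookup v t * coeff (ev d t) 1 =
          Poly_Mapping.lookup v t * ((d b - d a) * coeff (ev \<delta> t) 1)"
        by (rule arg_cong[OF ev_two])
    qed
    show ?thesis
      unfolding evaluate_def coeff_sum coeff_smult eq
      by (simp add: sum_distrib_left mult.left_commute)
  qed
  show thesis
  proof (rule that)
    show "lin_part {a, b} d X = (d b - d a) * coeff (evaluate \<delta> v) 1" for d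
      unfolding lin_part_def v(2) val_wcls[OF _ v(1), simplified] by (rule lin)
  qed
qed

section \<open>A cocycle in arity five\<close>

text \<open>
  Here \<open>c\<close> and \<open>m\<close> stand for the constant and the linear coefficient of the decorations. The six
  cases were found by solving the linear equations for cocycles that have one factor \<open>m\<close> and are
  invariant under the permutations that fix the leaf \<open>1\<close>.
\<close>

definition cocycle_term ::
    "nat set \<Rightarrow> nat set \<Rightarrow> (nat set \<Rightarrow> 'k) \<Rightarrow> (nat set \<Rightarrow> (nat \<Rightarrow> 'k) \<Rightarrow> 'k) \<Rightarrow> 'k::field" where
  "cocycle_term A B c m =
     (if A \<subset> B then
        if 1 \<in> A then
          if card A = 2 \<and> card B = 3 then c A * c B * m {1..5} (\<lambda>i. if i = 1 then 0 else 1)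
          else if card A = 3 then c {1..5} * c A * m B (\<lambda>i. if i = 1 then 1 else 0) else 0
        else if 1 \<in> B \<and> card B = 4 then
          if card A = 2 then c {1..5} * c A * m B (\<lambda>_. 1)
          else - (c {1..5} * c A * m B (\<lambda>i. if i = 1 then 1 else 0))
        else 0
      else if A \<inter> B = {} \<and> 1 \<in> A \<and> card A = 2 then
        if card B = 2 then - (c A * c B * m {1..5} (\<lambda>i. if i = Min B then 0 else 1))
        else c {1..5} * c A * m B (\<lambda>_. 1)
      else 0)"

text \<open>Each branch is a product with exactly one factor, \<open>c\<close> or \<open>m\<close>,
  from each of the three vertices. So the term is additive in the decoration of every
  vertex.\<close>

lemma cocycle_term_add:
  assumes "V = {1..5} \<or> V = A \<or> V = B" "A \<noteq> {1..5}" "B \<noteq> {1..5}" "A \<noteq> B"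
  shows "cocycle_term A B (c(V := p + q)) (m(V := \<lambda>d. f d + g d)) =
    cocycle_term A B (c(V := p)) (m(V := f)) + cocycle_term A B (c(V := q)) (m(V := g))"
  using assms by (elim disjE) (simp_all add: cocycle_term_def algebra_simps)

lemma cocycle_term_scale:
  assumes "V = {1..5} \<or> V = A \<or> V = B" "A \<noteq> {1..5}" "B \<noteq> {1..5}" "A \<noteq> B"
  shows "cocycle_term A B (c(V := k * p)) (m(V := \<lambda>d. k * f d)) = k * cocycle_term A B (c(V := p)) (m(V := f))"
  using assms by (elim disjE) (simp_all add: cocycle_term_def algebra_simps)

text \<open>The cocycle on the tree in which the edge \<open>A\<close> has been contracted into
  \<open>B\<close>, with \<open>X\<close> and \<open>Y\<close> the remaining edges. The updates at
  \<open>B\<close> are the rules \<open>const_part_compose\<close> and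
  \<open>lin_part_compose\<close>.\<close>

definition contracted_term ::
    "(nat set \<Rightarrow> nat set) \<Rightarrow> (nat set \<Rightarrow> 'k) \<Rightarrow> (nat set \<Rightarrow> (nat \<Rightarrow> 'k) \<Rightarrow> 'k) \<Rightarrow>
     nat set \<Rightarrow> nat set \<Rightarrow> nat set \<Rightarrow> nat set \<Rightarrow> 'k::field" where
  "contracted_term inp c m A B X Y =
     (let c' = c(B := c B * c A);
          m' = m(B := \<lambda>d. c B * m A d + m B (d(Min A := sum d (inp A))) * c A)
      in cocycle_term X Y c' m' - cocycle_term Y X c' m')"

lemma contracted_term_swap: "contracted_term inp c m A B Y X = - contracted_term inp c m A B X Y"
  by (simp add: contracted_term_def Let_def)

text \<open>The leaf that the cocycle distinguishes is the least one, so it represents every vertex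
  in which it lies.\<close>

lemma Min_eq_1: "A \<subseteq> {1..5 :: nat} \<Longrightarrow> 1 \<in> A \<Longrightarrow> Min A = 1"
  using finite_subset[of A "{1..5}"] by (intro Min_eqI) auto

text \<open>All four vertices are binary, so each linear part is known up to one scalar. The
  contractions go from \<open>X\<close> into \<open>Y\<close>, from \<open>Y\<close> into
  \<open>Z\<close> and from \<open>Z\<close> into the root; the place where the leaf 1 is attached
  decides which branches of \<open>cocycle_term\<close> are active.\<close>

lemma cocycle_chain:
  fixes m :: "nat set \<Rightarrow> (nat \<Rightarrow> 'k) \<Rightarrow> 'k::field"
  assumes X: "X = {a, b}" "a \<noteq> b" and Y: "Y = insert y X" "y \<notin> X" and Z: "Z = insert z Y" "z \<notin> Y"
    and R: "{1..5} = insert w Z" "w \<notin> Z"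
    and inp: "inp X = {a, b}" "inp Y = {Min X, y}" "inp Z = {Min Y, z}"
    and m: "\<And>d. m X d = (d b - d a) * lX" "\<And>d. m Y d = (d y - d (Min X)) * lY"
      "\<And>d. m Z d = (d z - d (Min Y)) * lZ" "\<And>d. m {1..5} d = (d w - d (Min Z)) * lR"
  shows "contracted_term inp c m X Y Y Z - contracted_term inp c m Y Z X Z +
    contracted_term inp c m Z {1..5} X Y = 0"
proof -
  have sub: "X \<subset> Y" "Y \<subset> Z" "X \<subset> Z" "\<not> Y \<subset> X" "\<not> Z \<subset> Y" "\<not> Z \<subset> X"
    "X \<inter> Y \<noteq> {}" "Y \<inter> X \<noteq> {}" "X \<inter> Z \<noteq> {}" "Z \<inter> X \<noteq> {}" "Y \<inter> Z \<noteq> {}" "Z \<inter> Y \<noteq> {}"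
    using X(1) Y Z by auto
  have ne: "X \<noteq> Y" "Y \<noteq> X" "X \<noteq> Z" "Z \<noteq> X" "Y \<noteq> Z" "Z \<noteq> Y" using sub by auto
  have card: "card X = 2" "card Y = 3" "card Z = 4" using X Y Z by simp_all
  then have neR: "X \<noteq> {1..5}" "Y \<noteq> {1..5}" "Z \<noteq> {1..5}" "{1..5} \<noteq> X" "{1..5} \<noteq> Y" "{1..5} \<noteq> Z"
    by auto
  have subR: "X \<subseteq> {1..5}" "Y \<subseteq> {1..5}" "Z \<subseteq> {1..5}" using Y Z R by auto
  have Min: "Min X \<in> X" "Min Y \<in> Y" "Min Z \<in> Z"
    using subR card by (auto intro!: Min_in intro: finite_subset)
  then have Min_ne: "Min X \<noteq> y" "Min Y \<noteq> z" "Min Z \<noteq> w" "y \<noteq> Min X" "z \<noteq> Min Y" "w \<noteq> Min Z" using Y Z R by auto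
  note simps = contracted_term_def cocycle_term_def Let_def sub ne neR card inp m Min_ne X(2)
  have "1 \<in> insert w Z" unfolding R(1)[symmetric] by simp
  then have "1 \<in> X \<or> y = 1 \<or> z = 1 \<or> w = 1" using Y(1) Z(1) by auto
  then consider "1 \<in> X" | "y = 1" | "z = 1" | "w = 1" by blast
  then show ?thesis
  proof cases
    case 1
    then have in1: "1 \<in> X" "1 \<in> Y" "1 \<in> Z" "z \<noteq> 1" "w \<noteq> 1" "y \<noteq> 1" using Y Z R by auto
    note Min1 = Min_eq_1[OF subR(1) in1(1)] Min_eq_1[OF subR(2) in1(2)] Min_eq_1[OF subR(3) in1(3)]
    show ?thesis by (simp add: simps in1 Min1 del: One_nat_def)
  next
    case 2
    then have in1: "1 \<notin> X" "1 \<in> Y" "1 \<in> Z" "z \<noteq> 1" "w \<noteq> 1" "y = 1" using Y Z R by auto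
    note Min1 = Min_eq_1[OF subR(2) in1(2)] Min_eq_1[OF subR(3) in1(3)]
    have "Min X \<noteq> 1" using Min in1 by metis
    then show ?thesis by (simp add: simps in1 Min1 del: One_nat_def)
  next
    case 3
    then have in1: "1 \<notin> X" "1 \<notin> Y" "1 \<in> Z" "z = 1" "w \<noteq> 1" "y \<noteq> 1" using Y Z R by auto
    note Min1 = Min_eq_1[OF subR(3) in1(3)]
    have "Min X \<noteq> 1" "Min Y \<noteq> 1" using Min in1 by metis+
    then show ?thesis by (simp add: simps in1 Min1 del: One_nat_def)
  next
    case 4
    then have in1: "1 \<notin> X" "1 \<notin> Y" "1 \<notin> Z" using Y Z R by auto
    show ?thesis by (simp add: simps in1 del: One_nat_def)
  qed
qed

text \<open>The cherries \<open>X\<close> and \<open>Y\<close> play symmetric roles, so the leaf 1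
  can be kept out of \<open>Y\<close>; it then lies in \<open>X\<close> or is the last leaf
  \<open>w\<close>.\<close>

lemma cocycle_two_cherries:
  fixes m :: "nat set \<Rightarrow> (nat \<Rightarrow> 'k) \<Rightarrow> 'k::field"
  assumes X: "X = {a, b}" "a \<noteq> b" and Y: "Y = {a', b'}" "a' \<noteq> b'" "X \<inter> Y = {}" and Z: "Z = X \<union> Y"
    and R: "{1..5} = insert w Z" "w \<notin> Z" and in1: "1 \<notin> Y"
    and inp: "inp X = {a, b}" "inp Y = {a', b'}" "inp Z = {Min X, Min Y}"
    and m: "\<And>d. m X d = (d b - d a) * lX" "\<And>d. m Y d = (d b' - d a') * lY"
      "\<And>d. m Z d = (d (Min Y) - d (Min X)) * lZ" "\<And>d. m {1..5} d = (d w - d (Min Z)) * lR"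
  shows "contracted_term inp c m X Z Y Z - contracted_term inp c m Y Z X Z +
    contracted_term inp c m Z {1..5} X Y = 0"
proof -
  have sub: "\<not> X \<subset> Y" "Y \<subset> Z" "X \<subset> Z" "\<not> Y \<subset> X" "\<not> Z \<subset> Y" "\<not> Z \<subset> X"
    "X \<inter> Y = {}" "Y \<inter> X = {}" "X \<inter> Z \<noteq> {}" "Z \<inter> X \<noteq> {}" "Y \<inter> Z \<noteq> {}" "Z \<inter> Y \<noteq> {}"
    using X(1) Y Z by auto
  have ne: "X \<noteq> Y" "Y \<noteq> X" "X \<noteq> Z" "Z \<noteq> X" "Y \<noteq> Z" "Z \<noteq> Y" using sub X by auto
  have card: "card X = 2" "card Y = 2" "card Z = 4" using X Y(1,2) Z Y(3) by (simp_all add: card_Un_disjoint)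
  then have neR: "X \<noteq> {1..5}" "Y \<noteq> {1..5}" "Z \<noteq> {1..5}" "{1..5} \<noteq> X" "{1..5} \<noteq> Y" "{1..5} \<noteq> Z"
    by auto
  have subR: "X \<subseteq> {1..5}" "Y \<subseteq> {1..5}" "Z \<subseteq> {1..5}" using Y Z R by auto
  have Min: "Min X \<in> X" "Min Y \<in> Y" "Min Z \<in> Z"
    using subR card by (auto intro!: Min_in intro: finite_subset)
  then have Min_ne: "Min X \<noteq> Min Y" "Min Y \<noteq> Min X" "Min Y \<noteq> 1" "1 \<noteq> Min Y" "Min Z \<noteq> w" "w \<noteq> Min Z" "w \<noteq> Min Y"
    "w \<noteq> Min X"
    using Y Z R in1 by auto
  note simps = contracted_term_def cocycle_term_def Let_def sub ne neR card inp m Min_ne X(2) Y(2)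
  have "1 \<in> insert w Z" unfolding R(1)[symmetric] by simp
  then have "1 \<in> X \<or> w = 1" using in1 Z(1) by auto
  then consider "1 \<in> X" | "w = 1" by blast
  then show ?thesis
  proof cases
    case 1
    then have in1: "1 \<in> X" "1 \<notin> Y" "1 \<in> Z" "w \<noteq> 1" using in1 Z R by auto
    note Min1 = Min_eq_1[OF subR(1) in1(1)] Min_eq_1[OF subR(3) in1(3)]
    show ?thesis by (simp add: simps[unfolded Min1] in1 Min1 del: One_nat_def)
  next
    case 2
    then have "1 \<notin> X" "1 \<notin> Y" "1 \<notin> Z" using Y Z R in1 by auto
    then show ?thesis by (simp add: simps del: One_nat_def)
  qed
qed

text \<open>Both \<open>Y\<close> and \<open>Z\<close> are contracted into the root, while
  \<open>X\<close> is contracted into \<open>Z\<close>. The cases are the leaf 1 in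
  \<open>X\<close>, at \<open>z\<close>, or in \<open>Y\<close>.\<close>

lemma cocycle_two_branches:
  fixes m :: "nat set \<Rightarrow> (nat \<Rightarrow> 'k) \<Rightarrow> 'k::field"
  assumes X: "X = {a, b}" "a \<noteq> b" and Z: "Z = insert z X" "z \<notin> X" and Y: "Y = {a', b'}" "a' \<noteq> b'" "Z \<inter> Y = {}"
    and R: "{1..5} = Z \<union> Y"
    and inp: "inp X = {a, b}" "inp Y = {a', b'}" "inp Z = {Min X, z}"
    and m: "\<And>d. m X d = (d b - d a) * lX" "\<And>d. m Y d = (d b' - d a') * lY"
      "\<And>d. m Z d = (d z - d (Min X)) * lZ" "\<And>d. m {1..5} d = (d (Min Y) - d (Min Z)) * lR"
  shows "contracted_term inp c m X Z Y Z - contracted_term inp c m Y {1..5} X Z +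
    contracted_term inp c m Z {1..5} X Y = 0"
proof -
  have sub: "\<not> X \<subset> Y" "\<not> Y \<subset> Z" "X \<subset> Z" "\<not> Y \<subset> X" "\<not> Z \<subset> Y" "\<not> Z \<subset> X"
    "X \<inter> Y = {}" "Y \<inter> X = {}" "X \<inter> Z \<noteq> {}" "Z \<inter> X \<noteq> {}" "Y \<inter> Z = {}" "Z \<inter> Y = {}"
    using X(1) Y Z by auto
  have ne: "X \<noteq> Y" "Y \<noteq> X" "X \<noteq> Z" "Z \<noteq> X" "Y \<noteq> Z" "Z \<noteq> Y" using sub X Y by auto
  have card: "card X = 2" "card Y = 2" "card Z = 3" using X Y(1,2) Z by simp_all
  then have neR: "X \<noteq> {1..5}" "Y \<noteq> {1..5}" "Z \<noteq> {1..5}" "{1..5} \<noteq> X" "{1..5} \<noteq> Y" "{1..5} \<noteq> Z"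
    by auto
  have subR: "X \<subseteq> {1..5}" "Y \<subseteq> {1..5}" "Z \<subseteq> {1..5}" using Z R by auto
  have Min: "Min X \<in> X" "Min Y \<in> Y" "Min Z \<in> Z"
    using subR card by (auto intro!: Min_in intro: finite_subset)
  then have Min_ne: "Min X \<noteq> Min Y" "Min Y \<noteq> Min X" "Min Y \<noteq> Min Z" "Min Z \<noteq> Min Y"
    "z \<noteq> Min X" "Min X \<noteq> z" "z \<noteq> Min Y" "Min Y \<noteq> z"
    "a' \<noteq> Min X" "b' \<noteq> Min X" "a \<noteq> Min Y" "b \<noteq> Min Y"
  proof -
    have "a \<in> X" "b \<in> X" "a' \<in> Y" "b' \<in> Y" "z \<in> Z" using X Y Z by simp_all
    moreover have "i \<noteq> j" if "i \<in> Z" "j \<in> Y" for i j using that Y(3) by blast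
    moreover have "i \<in> Z" if "i \<in> X" for i using that sub(3) by blast
    ultimately show "Min X \<noteq> Min Y" "Min Y \<noteq> Min X" "Min Y \<noteq> Min Z" "Min Z \<noteq> Min Y"
      "z \<noteq> Min X" "Min X \<noteq> z" "z \<noteq> Min Y" "Min Y \<noteq> z"
      "a' \<noteq> Min X" "b' \<noteq> Min X" "a \<noteq> Min Y" "b \<noteq> Min Y"
      using Min Z(2) by metis+
  qed
  note simps = contracted_term_def cocycle_term_def Let_def sub ne neR card inp m Min_ne X(2) Y(2)
  have "1 \<in> Z \<union> Y" unfolding R(1)[symmetric] by simp
  then have "1 \<in> X \<or> z = 1 \<or> 1 \<in> Y" using Z(1) by auto
  then consider "1 \<in> X" | "z = 1" | "1 \<in> Y" by blast
  then show ?thesis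
  proof cases
    case 1
    then have in1: "1 \<in> X" "1 \<notin> Y" "1 \<in> Z" "z \<noteq> 1" using Y Z by auto
    note Min1 = Min_eq_1[OF subR(1) in1(1)] Min_eq_1[OF subR(3) in1(3)]
    have "a' \<noteq> 1" "b' \<noteq> 1" using in1 Y by auto
    then show ?thesis by (simp add: simps[unfolded Min1] in1 Min1 del: One_nat_def)
  next
    case 2
    then have "1 \<notin> X" "1 \<notin> Y" "1 \<in> Z" using Y Z by auto
    then show ?thesis by (simp add: simps 2 del: One_nat_def)
  next
    case 3
    then have in1: "1 \<notin> X" "1 \<in> Y" "1 \<notin> Z" using Y Z by auto
    note Min1 = Min_eq_1[OF subR(2) in1(2)]
    show ?thesis by (simp add: simps[unfolded Min1] in1 Min1 del: One_nat_def)
  qed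
qed

text \<open>Three is the largest number of internal edges for five leaves, so these trees are
  binary. There are three shapes of binary trees with five leaves.\<close>

lemma edge_list_three:
  assumes es: "edge_list 5 es" and len: "length es = 3"
  obtains (chain) X Y Z where "set es = {X, Y, Z}" "card X = 2" "card Y = 3" "card Z = 4" "X \<subset> Y" "Y \<subset> Z"
  | (cherries) X Y Z where "set es = {X, Y, Z}" "card X = 2" "card Y = 2" "card Z = 4"
      "X \<inter> Y = {}" "X \<subset> Z" "Y \<subset> Z"
  | (branches) X Y Z where "set es = {X, Y, Z}" "card X = 2" "card Y = 2" "card Z = 3" "X \<subset> Z" "Y \<inter> Z = {}"
proof -
  have dist: "distinct es" using es by (simp add: edge_list_def)
  have fin: "finite A" if "A \<in> set es" for A
    using vertex_finite[OF es] that by (simp add: mem_vertices)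
  have cardA: "card A \<in> {2, 3, 4}" if A: "A \<in> set es" for A
  proof -
    have "card A < card {1..5 :: nat}" using edge_psubset[OF es A] by (intro psubset_card_mono) auto
    then show ?thesis using es A by (auto simp: edge_list_def)
  qed
  have disj: "card A + card B \<le> 5" if "A \<in> set es" "B \<in> set es" "A \<inter> B = {}" for A B
  proof -
    have "card (A \<union> B) \<le> card {1..5 :: nat}"
      using that edge_psubset[OF es] by (intro card_mono) auto
    then show ?thesis using that fin by (simp add: card_Un_disjoint)
  qed
  have lam: "A \<subset> B \<or> A \<inter> B = {}" if "A \<in> set es" "B \<in> set es" "A \<noteq> B" "card A \<le> card B" for A B
  proof -
    have "\<not> B \<subset> A" using psubset_card_mono[OF fin[OF that(1)], of B] that(4) by auto
    then show ?thesis using edge_laminar[OF es that(1,2)] that(3) by auto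
  qed
  \<comment> \<open>Edges of equal size are disjoint by laminarity, and two disjoint edges have at
    most five leaves together.\<close>
  have eq2: "A \<inter> B = {} \<and> card A = 2" if "A \<in> set es" "B \<in> set es" "A \<noteq> B" "card A = card B" for A B
  proof -
    have "\<not> A \<subset> B" using psubset_card_mono[OF fin[OF that(2)], of A] that(4) by auto
    then have "A \<inter> B = {}" using lam[OF that(1-3)] that(4) by simp
    then show ?thesis using disj[OF that(1,2)] cardA[OF that(1)] that(4) by auto
  qed
  \<comment> \<open>Three pairwise disjoint edges would need six leaves, so the largest edge is
    unique once the edges are sorted by size.\<close>
  have sorted: thesis if set: "set es = {X, Y, Z}" and ne: "X \<noteq> Y" "X \<noteq> Z" "Y \<noteq> Z"
    and le: "card X \<le> card Y" "card Y \<le> card Z" for X Y Z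
  proof -
    have mem: "X \<in> set es" "Y \<in> set es" "Z \<in> set es" using set by simp_all
    note c = cardA[OF mem(1)] cardA[OF mem(2)] cardA[OF mem(3)]
    have "card Y \<noteq> card Z"
    proof
      assume YZ: "card Y = card Z"
      then have 2: "card Y = 2" "card Z = 2" "Y \<inter> Z = {}" using eq2[OF mem(2,3) ne(3)] by simp_all
      then have 3: "card X = card Y" "card X = card Z" using le c by auto
      then have "X \<inter> Y = {}" "X \<inter> Z = {}" using eq2[OF mem(1,2) ne(1)] eq2[OF mem(1,3) ne(2)] by simp_all
      then have "card (X \<union> Y \<union> Z) = 6"
        using 2 3 fin[OF mem(1)] fin[OF mem(2)] fin[OF mem(3)] by (simp add: card_Un_disjoint Int_Un_distrib2)
      moreover have "card (X \<union> Y \<union> Z) \<le> card {1..5 :: nat}"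
        using edge_psubset[OF es] mem by (intro card_mono) auto
      ultimately show False by simp
    qed
    then have YZ: "card Y < card Z" using le by simp
    show thesis
    proof (cases "card X = card Y")
      case True
      then have X: "X \<inter> Y = {}" "card X = 2" "card Y = 2" using eq2[OF mem(1,2) ne(1)] by simp_all
      show thesis
      proof (cases "card Z = 4")
        case True
        then have "X \<inter> Z \<noteq> {}" "Y \<inter> Z \<noteq> {}" using disj[OF mem(1,3)] disj[OF mem(2,3)] X by auto
        then show thesis
          using cherries[OF set X(2,3) True X(1)] lam[OF mem(1,3) ne(2)] lam[OF mem(2,3) ne(3)] le by simp
      next
        case False
        then have Z: "card Z = 3" using c YZ X by auto
        have not_both: "X \<inter> Z = {} \<or> Y \<inter> Z = {}"
        proof (rule ccontr)
          assume "\<not> ?thesis"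
          then have "X \<union> Y \<subseteq> Z" using lam[OF mem(1,3) ne(2)] lam[OF mem(2,3) ne(3)] le by auto
          then have "card (X \<union> Y) \<le> card Z" using fin[OF mem(3)] by (intro card_mono)
          then show False using X Z fin mem by (simp add: card_Un_disjoint)
        qed
        have not_none: "X \<subset> Z \<or> Y \<subset> Z"
        proof (rule ccontr)
          assume "\<not> ?thesis"
          then have "X \<inter> Z = {}" "Y \<inter> Z = {}" using lam[OF mem(1,3) ne(2)] lam[OF mem(2,3) ne(3)] le by auto
          then have "card (X \<union> Y \<union> Z) = 7"
            using X Z fin[OF mem(1)] fin[OF mem(2)] fin[OF mem(3)] by (simp add: card_Un_disjoint Int_Un_distrib2)
          moreover have "card (X \<union> Y \<union> Z) \<le> card {1..5 :: nat}"
            using edge_psubset[OF es] mem by (intro card_mono) auto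
          ultimately show False by simp
        qed
        have "X \<noteq> {}" "Y \<noteq> {}" using X by auto
        then have "X \<subset> Z \<and> Y \<inter> Z = {} \<or> Y \<subset> Z \<and> X \<inter> Z = {}"
          using not_both not_none by auto
        moreover have "set es = {Y, X, Z}" using set by auto
        ultimately show thesis using branches[OF set X(2,3) Z] branches[of Y X Z] X Z by blast
      qed
    next
      case False
      then have c: "card X = 2" "card Y = 3" "card Z = 4" using c YZ le by auto
      have "Y \<inter> Z \<noteq> {}" "X \<inter> Z \<noteq> {}" using disj[OF mem(2,3)] disj[OF mem(1,3)] c by auto
      then have sub: "Y \<subset> Z" "X \<subset> Z" using lam[OF mem(2,3) ne(3)] lam[OF mem(1,3) ne(2)] c by auto
      have "X \<inter> Y \<noteq> {}"
      proof
        assume "X \<inter> Y = {}"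
        then have "card (X \<union> Y) = 5" using c fin mem by (simp add: card_Un_disjoint)
        moreover have "card (X \<union> Y) \<le> card Z" using sub fin[OF mem(3)] by (intro card_mono) auto
        ultimately show False using c by simp
      qed
      then show thesis using chain[OF set c] sub lam[OF mem(1,2) ne(1)] c by simp
    qed
  qed
  obtain A B C where ABC: "es = [A, B, C]"
    using len by (auto simp: numeral_3_eq_3 length_Suc_conv)
  then have ne: "A \<noteq> B" "A \<noteq> C" "B \<noteq> C" "B \<noteq> A" "C \<noteq> A" "C \<noteq> B" using dist by auto
  have sets: "set es = {A, B, C}" "set es = {A, C, B}" "set es = {B, A, C}" "set es = {B, C, A}"
    "set es = {C, A, B}" "set es = {C, B, A}"
    using ABC by auto
  consider "card A \<le> card B" "card B \<le> card C" | "card A \<le> card C" "card C \<le> card B"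
    | "card B \<le> card A" "card A \<le> card C" | "card B \<le> card C" "card C \<le> card A"
    | "card C \<le> card A" "card A \<le> card B" | "card C \<le> card B" "card B \<le> card A"
    by linarith
  then show thesis
  proof cases
    case 1 show thesis by (rule sorted[OF sets(1)]) (use 1 ne in simp_all)
  next
    case 2 show thesis by (rule sorted[OF sets(2)]) (use 2 ne in simp_all)
  next
    case 3 show thesis by (rule sorted[OF sets(3)]) (use 3 ne in simp_all)
  next
    case 4 show thesis by (rule sorted[OF sets(4)]) (use 4 ne in simp_all)
  next
    case 5 show thesis by (rule sorted[OF sets(5)]) (use 5 ne in simp_all)
  next
    case 6 show thesis by (rule sorted[OF sets(6)]) (use 6 ne in simp_all)
  qed
qed

lemma inputs_two:
  assumes V: "V = C \<union> D" "C \<inter> D = {}" "C \<noteq> {}" "D \<noteq> {}"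
    and C: "C \<in> set es \<or> (\<exists>i. C = {i})" and D: "D \<in> set es \<or> (\<exists>i. D = {i})"
    and sub: "\<And>E. E \<in> set es \<Longrightarrow> E \<subset> V \<Longrightarrow> E \<subseteq> C \<or> E \<subseteq> D"
  shows "inputs es V = {Min C, Min D}"
proof -
  have "children es V = {C, D}"
  proof (rule children_eqI)
    show "\<Union>{C, D} = V" "V \<notin> {C, D}" "{} \<notin> {C, D}" using V by auto
    show "E \<inter> F = {}" if "E \<in> {C, D}" "F \<in> {C, D}" "E \<noteq> F" for E F
      using that V(2) by (auto simp: Int_commute)
    show "E \<in> set es \<or> (\<exists>i\<in>V. E = {i})" if "E \<in> {C, D}" for E
      using that C D V(1) by auto
    show "\<exists>F\<in>{C, D}. E \<subseteq> F" if "E \<in> set es" "E \<subset> V" for E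
      using sub[OF that] by auto
  qed
  then show ?thesis by (simp add: inputs_eq)
qed

text \<open>Vertices above \<open>A\<close> meet, hence are nested by laminarity; a minimal one
  among them is the least.\<close>

lemma parent_exists:
  assumes es: "edge_list n es" and A: "A \<in> set es"
  shows "parent n es A (\<Inter>{C \<in> vertices n es. A \<subset> C})"
proof -
  let ?S = "{C \<in> vertices n es. A \<subset> C}"
  have "finite ?S" "{1..n} \<in> ?S"
    using edge_psubset[OF es A] by (auto simp: vertices_def)
  then obtain B where B: "B \<in> ?S" "\<And>C. C \<in> ?S \<Longrightarrow> C \<subseteq> B \<Longrightarrow> B = C"
    using finite_has_minimal[of ?S] by auto
  have "A \<noteq> {}" using es A by (auto simp: edge_list_def)
  then have "B \<subseteq> C" if "C \<in> ?S" for C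
    using vertex_laminar[OF es, of B C] B that by auto
  then have "parent n es A B" using B(1) by (simp add: parent_def)
  then show ?thesis using parent_Inter by metis
qed

lemma parentI:
  assumes "edge_list n es" "A \<in> set es" "B \<in> vertices n es" "A \<subset> B"
    and "\<And>C. C \<in> set es \<Longrightarrow> A \<subset> C \<Longrightarrow> B \<subseteq> C"
  shows "parent n es A B"
proof -
  have "B \<subseteq> {1..n}" using assms(3) edge_psubset[OF assms(1)] unfolding mem_vertices by blast
  then have "B \<subseteq> C" if "C \<in> vertices n es" "A \<subset> C" for C
    using that(1) assms(5)[OF _ that(2)] unfolding mem_vertices by metis
  then show ?thesis using assms(3,4) unfolding parent_def by blast
qed

section \<open>The cocycle on decorated trees\<close>

definition wl_const :: "nat set list \<Rightarrow> (nat set \<Rightarrow> 'k::field magma_comb set set) \<Rightarrow> nat set \<Rightarrow> 'k" where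
  "wl_const es x V = const_part (inputs es V) (x V)"

definition wl_lin ::
    "nat set list \<Rightarrow> (nat set \<Rightarrow> 'k::field magma_comb set set) \<Rightarrow> nat set \<Rightarrow> (nat \<Rightarrow> 'k) \<Rightarrow> 'k" where
  "wl_lin es x V d = lin_part (inputs es V) d (x V)"

text \<open>Antisymmetrised in the two edges, since cochains alternate under reordering of the
  edges.\<close>

definition wl_cocycle :: "nat set list \<Rightarrow> (nat set \<Rightarrow> 'k::field magma_comb set set) \<Rightarrow> 'k" where
  "wl_cocycle es x =
     (if edge_list 5 es \<and> length es = 2 \<and> x \<in> decorations WL 5 es
      then cocycle_term (es ! 0) (es ! 1) (wl_const es x) (wl_lin es x) -
        cocycle_term (es ! 1) (es ! 0) (wl_const es x) (wl_lin es x)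
      else 0)"

lemma decoration_mem: "x \<in> decorations P n es \<Longrightarrow> V \<in> vertices n es \<Longrightarrow> x V \<in> ops P (inputs es V)"
  by (auto simp: decorations_def)

lemma decorations_cong: "set es = set fs \<Longrightarrow> decorations P n es = decorations P n fs"
  by (simp add: decorations_def vertices_def inputs_cong[of es fs])

lemma wl_cocycle_cochain: "wl_cocycle \<in> cochains WL 5 2"
proof -
  have "is_linear (space WL (inputs es A)) scalars (\<lambda>u. wl_cocycle es (x(A := u :: 'k::field magma_comb set set)))"
    if es: "edge_list 5 es" "length es = 2" and x: "x \<in> decorations WL 5 es" and A: "A \<in> vertices 5 es" for es x A
  proof -
    obtain P Q where PQ: "es = [P, Q]"
      using es(2) by (auto simp: numeral_2_eq_2 length_Suc_conv)
    have APQ: "A = {1..5} \<or> A = P \<or> A = Q" using A PQ by (auto simp: vertices_def)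
    have ne: "P \<noteq> {1..5}" "Q \<noteq> {1..5}" "P \<noteq> Q" "Q \<noteq> P" using es(1) PQ by (auto simp: edge_list_def)
    interpret vertex 5 es A using es(1) A by unfold_locales auto
    have dec: "x(A := u) \<in> decorations WL 5 es" if "u \<in> ops WL (inputs es A)" for u
      using x that A by (auto simp: decorations_def PiE_iff extensional_def)
    have upd: "wl_const es (x(A := u)) = (wl_const es x)(A := const_part (inputs es A) u)"
      "wl_lin es (x(A := u)) = (wl_lin es x)(A := \<lambda>d. lin_part (inputs es A) d u)" for u
      by (auto simp: wl_const_def wl_lin_def fun_eq_iff)
    have eq: "wl_cocycle es (x(A := u)) =
        cocycle_term P Q ((wl_const es x)(A := const_part (inputs es A) u)) ((wl_lin es x)(A := \<lambda>d. lin_part (inputs es A) d u)) -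
        cocycle_term Q P ((wl_const es x)(A := const_part (inputs es A) u)) ((wl_lin es x)(A := \<lambda>d. lin_part (inputs es A) d u))"
      if "u \<in> ops WL (inputs es A)" for u
    proof -
      have "es ! 0 = P" "es ! 1 = Q" using PQ by simp_all
      then show ?thesis using dec[OF that] es by (simp add: wl_cocycle_def upd del: One_nat_def)
    qed
    interpret V: vector_space_on "space WL (inputs es A)"
      by standard (rule symmetric_operad.vspace[OF symmetric_operad_WL finite_inputs])
    have add: "const_part (inputs es A) (vadd (space WL (inputs es A)) u v) = const_part (inputs es A) u + const_part (inputs es A) v"
      "lin_part (inputs es A) d (vadd (space WL (inputs es A)) u v) = lin_part (inputs es A) d u + lin_part (inputs es A) d v"
      if "u \<in> ops WL (inputs es A)" "v \<in> ops WL (inputs es A)" for u v d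
      using that by (simp_all add: const_part_def lin_part_def val_add[OF finite_inputs])
    have scale: "const_part (inputs es A) (vscale (space WL (inputs es A)) k u) = k * const_part (inputs es A) u"
      "lin_part (inputs es A) d (vscale (space WL (inputs es A)) k u) = k * lin_part (inputs es A) d u"
      if "u \<in> ops WL (inputs es A)" for u k d
      using that by (simp_all add: const_part_def lin_part_def val_scale[OF finite_inputs])
    have AQP: "A = {1..5} \<or> A = Q \<or> A = P" using APQ by blast
    show ?thesis
      by (simp add: is_linear_def scalars_def eq add scale right_diff_distrib
          cocycle_term_add[OF APQ ne(1-3)] cocycle_term_add[OF AQP ne(2,1,4)]
          cocycle_term_scale[OF APQ ne(1-3)] cocycle_term_scale[OF AQP ne(2,1,4)])
  qed
  moreover have "wl_cocycle (es[i := es ! j, j := es ! i]) x = - wl_cocycle es x"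
    if es: "edge_list 5 es" "length es = 2" and x: "x \<in> decorations WL 5 es" and ij: "i < j" "j < 2"
    for es i j and x :: "nat set \<Rightarrow> 'k::field magma_comb set set"
  proof -
    obtain P Q where PQ: "es = [P, Q]"
      using es(2) by (auto simp: numeral_2_eq_2 length_Suc_conv)
    have swap: "es[i := es ! j, j := es ! i] = [Q, P]"
      using ij PQ by (cases i; cases j) auto
    have "edge_list 5 [Q, P]" using es(1) PQ by (auto simp: edge_list_def)
    moreover have "x \<in> decorations WL 5 [Q, P]" using x PQ decorations_cong[of es "[Q, P]" WL 5] by auto
    moreover have "wl_const [Q, P] x = wl_const es x" "wl_lin [Q, P] x = wl_lin es x"
      using PQ inputs_cong[of "[Q, P]" es] by (auto simp: wl_const_def wl_lin_def fun_eq_iff insert_commute)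
    ultimately show ?thesis using es x PQ unfolding swap by (simp add: wl_cocycle_def)
  qed
  moreover have "wl_cocycle es x = 0" if "\<not> (edge_list 5 es \<and> length es = 2 \<and> x \<in> decorations WL 5 es)" for es x
    using that by (auto simp: wl_cocycle_def)
  ultimately show ?thesis unfolding cochains_def mem_Collect_eq by blast
qed

context contraction
begin

lemma contracted_values:
  assumes x: "x \<in> decorations WL n es" and V: "V \<in> vertices n es'"
  shows "wl_const es' (contract WL n es A x) V = ((wl_const es x)(B := wl_const es x B * wl_const es x A)) V"
    and "wl_lin es' (contract WL n es A x) V = ((wl_lin es x)(B := \<lambda>d. wl_const es x B * wl_lin es x A d +
      wl_lin es x B (d(Min A := sum d (inputs es A))) * wl_const es x A)) V"
proof -
  note ops = decoration_mem[OF x B(1)] decoration_mem[OF x A_vertex]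
  have inputs: "inputs es' V = inputs es V" if "V \<noteq> B"
    using V that by (simp add: vertices_contract inputs_other)
  show "wl_const es' (contract WL n es A x) V = ((wl_const es x)(B := wl_const es x B * wl_const es x A)) V"
    using const_part_compose[OF composable_inputs ops] V
    by (simp add: wl_const_def contract_apply inputs inputs_contract)
  show "wl_lin es' (contract WL n es A x) V = ((wl_lin es x)(B := \<lambda>d. wl_const es x B * wl_lin es x A d +
      wl_lin es x B (d(Min A := sum d (inputs es A))) * wl_const es x A)) V"
    using lin_part_compose[OF composable_inputs ops] V
    by (auto simp: wl_lin_def wl_const_def contract_apply inputs inputs_contract fun_eq_iff)
qed

end

lemma cocycle_term_cong:
  assumes "\<And>V. V = {1..5} \<or> V = A \<or> V = B \<Longrightarrow> c V = c' V \<and> m V = m' V"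
  shows "cocycle_term A B c m = cocycle_term A B c' m'"
  using assms[of "{1..5}"] assms[of A] assms[of B] by (simp add: cocycle_term_def)

lemma wl_cocycle_contract:
  assumes es: "edge_list 5 es" and len: "length es = 3" and A: "A \<in> set es" and x: "x \<in> decorations WL 5 es"
    and fs: "set [X, Y] = set es - {A}" "X \<noteq> Y"
  shows "wl_cocycle [X, Y] (contract WL 5 es A x) =
    contracted_term (inputs es) (wl_const es x) (wl_lin es x) A (\<Inter>{C \<in> vertices 5 es. A \<subset> C}) X Y"
proof -
  let ?B = "\<Inter>{C \<in> vertices 5 es. A \<subset> C}"
  interpret contraction 5 es "[X, Y]" A ?B
    using es A fs parent_exists[OF es A] by unfold_locales simp_all
  have V: "V \<in> vertices 5 [X, Y]" if "V = {1..5} \<or> V = X \<or> V = Y" for V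
    using that by (auto simp: vertices_def)
  note vals = contracted_values[OF x V]
  have "cocycle_term X Y (wl_const [X, Y] (contract WL 5 es A x)) (wl_lin [X, Y] (contract WL 5 es A x)) =
      cocycle_term X Y ((wl_const es x)(?B := wl_const es x ?B * wl_const es x A))
        ((wl_lin es x)(?B := \<lambda>d. wl_const es x ?B * wl_lin es x A d +
          wl_lin es x ?B (d(Min A := sum d (inputs es A))) * wl_const es x A))"
    by (intro cocycle_term_cong conjI vals)
  moreover have "cocycle_term Y X (wl_const [X, Y] (contract WL 5 es A x)) (wl_lin [X, Y] (contract WL 5 es A x)) =
      cocycle_term Y X ((wl_const es x)(?B := wl_const es x ?B * wl_const es x A))
        ((wl_lin es x)(?B := \<lambda>d. wl_const es x ?B * wl_lin es x A d +
          wl_lin es x ?B (d(Min A := sum d (inputs es A))) * wl_const es x A))"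
    by (intro cocycle_term_cong conjI vals) auto
  ultimately show ?thesis
    using contract_decorations[OF symmetric_operad_WL x] edges'
    by (simp add: wl_cocycle_def contracted_term_def Let_def)
qed

text \<open>The edges are returned in the order suited to the shape of the tree. The order in
  \<open>es\<close> is restored in \<open>wl_cocycle_closed\<close>, where it costs at most a
  sign.\<close>

lemma sum_contracted_terms:
  fixes x :: "nat set \<Rightarrow> 'k::field magma_comb set set"
  assumes es: "edge_list 5 es" and len: "length es = 3" and x: "x \<in> decorations WL 5 es"
  obtains X Y Z where "set es = {X, Y, Z}" "X \<noteq> Y" "X \<noteq> Z" "Y \<noteq> Z"
    "contracted_term (inputs es) (wl_const es x) (wl_lin es x) X (\<Inter>{C \<in> vertices 5 es. X \<subset> C}) Y Z -
     contracted_term (inputs es) (wl_const es x) (wl_lin es x) Y (\<Inter>{C \<in> vertices 5 es. Y \<subset> C}) X Z +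
     contracted_term (inputs es) (wl_const es x) (wl_lin es x) Z (\<Inter>{C \<in> vertices 5 es. Z \<subset> C}) X Y = 0"
proof -
  note result = that
  have fin: "finite A" and sub: "A \<subset> {1..5}" and card2: "2 \<le> card A" if "A \<in> set es" for A
    using vertex_finite[OF es] edge_psubset[OF es that] vertex_card[OF es] that by (simp_all add: mem_vertices)
  \<comment> \<open>Supplies the scalars in the assumptions on \<open>m\<close> of the three shape
    lemmas.\<close>
  have binary: "\<exists>l. \<forall>d. wl_lin es x V d = (d q - d p) * l"
    if V: "V \<in> vertices 5 es" "inputs es V = {p, q}" and pq: "p \<noteq> q" for V p q
  proof -
    have "x V \<in> ops WL {p, q}" using decoration_mem[OF x V(1)] V(2) by simp
    from lin_part_binary[OF this pq] obtain l where "\<And>d. lin_part {p, q} d (x V) = (d q - d p) * l"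
      by blast
    then show ?thesis using V(2) by (auto simp: wl_lin_def)
  qed
  have Min_mem: "Min A \<in> A" if "A \<in> set es" for A
    using fin[OF that] card2[OF that] by (intro Min_in) auto
  have pair: "\<exists>a b. A = {a, b} \<and> a \<noteq> b \<and> inputs es A = {a, b}" if A: "A \<in> set es" "card A = 2" for A
  proof -
    obtain a b where ab: "A = {a, b}" "a \<noteq> b" using A(2) by (auto simp: card_2_iff)
    have "inputs es A = {Min {a}, Min {b}}"
    proof (rule inputs_two)
      show "E \<subseteq> {a} \<or> E \<subseteq> {b}" if "E \<in> set es" "E \<subset> A" for E
        using psubset_card_mono[OF fin[OF A(1)] that(2)] card2[OF that(1)] A(2) by simp
    qed (use ab in auto)
    then show ?thesis using ab by auto
  qed
  have extend: "\<exists>y. B = insert y A \<and> y \<notin> A" if "A \<subset> B" "finite B" "card B = Suc (card A)" for A B :: "nat set"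
  proof -
    have "card (B - A) = 1" using that finite_subset[of A B] by (simp add: card_Diff_subset)
    then obtain y where "B - A = {y}" by (rule card_1_singletonE)
    then show ?thesis using that(1) by (intro exI[of _ y]) auto
  qed
  have R: "{1..5} \<in> vertices 5 es" by (simp add: vertices_def)
  show thesis
  proof (cases rule: edge_list_three[OF es len])
    case (1 X Y Z)
    have mem: "X \<in> set es" "Y \<in> set es" "Z \<in> set es" using 1(1) by simp_all
    have sets: "\<And>E. E \<in> set es \<Longrightarrow> E = X \<or> E = Y \<or> E = Z" using 1(1) by auto
    obtain a b where X: "X = {a, b}" "a \<noteq> b" "inputs es X = {a, b}" using pair[OF mem(1) 1(2)] by blast
    obtain y where Y: "Y = insert y X" "y \<notin> X" using extend[OF 1(5) fin[OF mem(2)]] 1 by auto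
    obtain z where Z: "Z = insert z Y" "z \<notin> Y" using extend[OF 1(6) fin[OF mem(3)]] 1 by auto
    obtain w where W: "{1..5} = insert w Z" "w \<notin> Z" using extend[OF sub[OF mem(3)]] 1 by auto
    have "inputs es Y = {Min X, Min {y}}"
      by (rule inputs_two) (use Y X mem 1 sets in auto)
    then have inpY: "inputs es Y = {Min X, y}" by simp
    have "inputs es Z = {Min Y, Min {z}}"
      by (rule inputs_two) (use Y Z mem 1 sets in auto)
    then have inpZ: "inputs es Z = {Min Y, z}" by simp
    have "inputs es {1..5} = {Min Z, Min {w}}"
      by (rule inputs_two) (use Z Y W mem 1 sets in auto)
    then have inpR: "inputs es {1..5} = {Min Z, w}" by simp
    have ne: "Min X \<noteq> y" "Min Y \<noteq> z" "Min Z \<noteq> w"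
      using Min_mem[OF mem(1)] Min_mem[OF mem(2)] Min_mem[OF mem(3)] Y(2) Z(2) W(2) by auto
    have vs: "X \<in> vertices 5 es" "Y \<in> vertices 5 es" "Z \<in> vertices 5 es" using mem by (simp_all add: mem_vertices)
    have "Y \<subseteq> E" if "E \<in> set es" "X \<subset> E" for E using sets[OF that(1)] that(2) 1(5,6) by auto
    then have parX: "parent 5 es X Y" by (intro parentI[OF es mem(1) vs(2) 1(5)])
    have "Z \<subseteq> E" if "E \<in> set es" "Y \<subset> E" for E using sets[OF that(1)] that(2) 1(5,6) by auto
    then have parY: "parent 5 es Y Z" by (intro parentI[OF es mem(2) vs(3) 1(6)])
    have "{1..5} \<subseteq> E" if "E \<in> set es" "Z \<subset> E" for E using sets[OF that(1)] that(2) 1(5,6) by auto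
    then have parZ: "parent 5 es Z {1..5}" by (intro parentI[OF es mem(3) R sub[OF mem(3)]])
    note par = parX parY parZ
    obtain lX lY lZ lR where "\<And>d. wl_lin es x X d = (d b - d a) * lX"
      "\<And>d. wl_lin es x Y d = (d y - d (Min X)) * lY" "\<And>d. wl_lin es x Z d = (d z - d (Min Y)) * lZ"
      "\<And>d. wl_lin es x {1..5} d = (d w - d (Min Z)) * lR"
      using binary[OF vs(1) X(3,2)] binary[OF vs(2) inpY ne(1)] binary[OF vs(3) inpZ ne(2)] binary[OF R inpR ne(3)]
      by blast
    note id = cocycle_chain[OF X(1,2) Y Z W, of "inputs es" "wl_lin es x", OF X(3) inpY inpZ this]
    show thesis
      by (rule that[OF 1(1)]) (use 1 id in \<open>auto simp: parent_Inter[OF par(1)] parent_Inter[OF par(2)] parent_Inter[OF par(3)]\<close>)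
  next
    case (2 X Y Z)
    have mem: "X \<in> set es" "Y \<in> set es" "Z \<in> set es" using 2(1) by simp_all
    have Z: "Z = X \<union> Y"
    proof -
      have "card (X \<union> Y) = card Z" using 2 fin[OF mem(1)] fin[OF mem(2)] by (simp add: card_Un_disjoint)
      moreover have "X \<union> Y \<subseteq> Z" using 2 by auto
      ultimately show ?thesis using card_subset_eq[OF fin[OF mem(3)]] by metis
    qed
    have "1 \<notin> X \<or> 1 \<notin> Y" using 2(5) by auto
    \<comment> \<open>The shape is symmetric in the two cherries; the one without the leaf 1 is
      called \<open>Y\<close>.\<close>
    have main: thesis if set: "set es = {X, Y, Z}" and cards: "card X = 2" "card Y = 2"
      and disj: "X \<inter> Y = {}" and Z: "Z = X \<union> Y" and in1: "1 \<notin> Y" and card: "card Z = 4" for X Y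
    proof -
      have mem: "X \<in> set es" "Y \<in> set es" "Z \<in> set es" using set by simp_all
      have sets: "\<And>E. E \<in> set es \<Longrightarrow> E = X \<or> E = Y \<or> E = Z" using set by auto
      obtain a b where X: "X = {a, b}" "a \<noteq> b" "inputs es X = {a, b}" using pair[OF mem(1) cards(1)] by blast
      obtain a' b' where Y: "Y = {a', b'}" "a' \<noteq> b'" "inputs es Y = {a', b'}" using pair[OF mem(2) cards(2)] by blast
      obtain w where W: "{1..5} = insert w Z" "w \<notin> Z" using extend[OF sub[OF mem(3)]] card by auto
      have ne: "X \<noteq> {}" "Y \<noteq> {}" "Z \<noteq> {}" using X Y Z by auto
      have psub: "X \<subset> Z" "Y \<subset> Z" using Z disj ne by auto
      have inpZ: "inputs es Z = {Min X, Min Y}"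
        by (rule inputs_two[OF Z disj ne(1,2)]) (use mem sets psub in auto)
      have "inputs es {1..5} = {Min Z, Min {w}}"
      proof (rule inputs_two)
        show "E \<subseteq> Z \<or> E \<subseteq> {w}" if "E \<in> set es" for E using sets[OF that] psub by auto
      qed (use W mem ne in auto)
      then have inpR: "inputs es {1..5} = {Min Z, w}" by simp
      have Min_ne: "Min X \<noteq> Min Y" "Min Z \<noteq> w"
        using Min_mem[OF mem(1)] Min_mem[OF mem(2)] Min_mem[OF mem(3)] disj W(2) by auto
      have vs: "X \<in> vertices 5 es" "Y \<in> vertices 5 es" "Z \<in> vertices 5 es" using mem by (simp_all add: mem_vertices)
      have not: "\<not> X \<subset> Y" "\<not> Y \<subset> X" "X \<noteq> Y" using disj ne by auto
      have "Z \<subseteq> E" if "E \<in> set es" "X \<subset> E" for E using sets[OF that(1)] that(2) not by auto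
      then have parX: "parent 5 es X Z" by (intro parentI[OF es mem(1) vs(3) psub(1)])
      have "Z \<subseteq> E" if "E \<in> set es" "Y \<subset> E" for E using sets[OF that(1)] that(2) not by auto
      then have parY: "parent 5 es Y Z" by (intro parentI[OF es mem(2) vs(3) psub(2)])
      have "{1..5} \<subseteq> E" if "E \<in> set es" "Z \<subset> E" for E using sets[OF that(1)] that(2) psub by auto
      then have parZ: "parent 5 es Z {1..5}" by (intro parentI[OF es mem(3) R sub[OF mem(3)]])
      note par = parX parY parZ
      obtain lX lY lZ lR where "\<And>d. wl_lin es x X d = (d b - d a) * lX"
        "\<And>d. wl_lin es x Y d = (d b' - d a') * lY" "\<And>d. wl_lin es x Z d = (d (Min Y) - d (Min X)) * lZ"
        "\<And>d. wl_lin es x {1..5} d = (d w - d (Min Z)) * lR"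
        using binary[OF vs(1) X(3,2)] binary[OF vs(2) Y(3,2)] binary[OF vs(3) inpZ Min_ne(1)] binary[OF R inpR Min_ne(2)]
        by blast
      note id = cocycle_two_cherries[OF X(1,2) Y(1,2) disj Z W in1, of "inputs es" "wl_lin es x", OF X(3) Y(3) inpZ this]
      show thesis
        by (rule result[OF set])
          (use psub not id in \<open>auto simp: parent_Inter[OF par(1)] parent_Inter[OF par(2)] parent_Inter[OF par(3)]\<close>)
    qed
    show thesis
      using \<open>1 \<notin> X \<or> 1 \<notin> Y\<close>
    proof
      assume "1 \<notin> Y"
      then show thesis using 2 Z by (intro main[of X Y])
    next
      assume "1 \<notin> X"
      then show thesis using 2 Z by (intro main[of Y X]) auto
    qed
  next
    case (3 X Y Z)
    have mem: "X \<in> set es" "Y \<in> set es" "Z \<in> set es" using 3(1) by simp_all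
    have sets: "\<And>E. E \<in> set es \<Longrightarrow> E = X \<or> E = Y \<or> E = Z" using 3(1) by auto
    obtain a b where X: "X = {a, b}" "a \<noteq> b" "inputs es X = {a, b}" using pair[OF mem(1) 3(2)] by blast
    obtain a' b' where Y: "Y = {a', b'}" "a' \<noteq> b'" "inputs es Y = {a', b'}" using pair[OF mem(2) 3(3)] by blast
    obtain z where Z: "Z = insert z X" "z \<notin> X" using extend[OF 3(5) fin[OF mem(3)]] 3 by auto
    have disj: "Z \<inter> Y = {}" using 3(6) by auto
    have W: "{1..5} = Z \<union> Y"
    proof -
      have "card (Z \<union> Y) = card {1..5 :: nat}"
        using 3 disj fin[OF mem(2)] fin[OF mem(3)] by (simp add: card_Un_disjoint)
      moreover have "Z \<union> Y \<subseteq> {1..5}" using sub[OF mem(2)] sub[OF mem(3)] by auto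
      ultimately show ?thesis using card_subset_eq[of "{1..5}" "Z \<union> Y"] by simp
    qed
    have ne: "X \<noteq> {}" "Y \<noteq> {}" "Z \<noteq> {}" using X Y Z by auto
    have not: "\<not> X \<subset> Y" "\<not> Y \<subset> X" "X \<noteq> Y" "\<not> Z \<subset> Y" "\<not> Y \<subset> Z" "Y \<noteq> Z"
      using disj ne 3(5) by auto
    have "inputs es Z = {Min X, Min {z}}"
    proof (rule inputs_two)
      show "E \<subseteq> X \<or> E \<subseteq> {z}" if "E \<in> set es" "E \<subset> Z" for E
        using sets[OF that(1)] that(2) not(5) by auto
    qed (use Z(1,2) mem(1) ne(1) in auto)
    then have inpZ: "inputs es Z = {Min X, z}" by simp
    have inpR: "inputs es {1..5} = {Min Z, Min Y}"
    proof (rule inputs_two[OF W disj ne(3,2)])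
      show "E \<subseteq> Z \<or> E \<subseteq> Y" if "E \<in> set es" for E
        using sets[OF that] 3(5) by auto
    qed (use mem in simp_all)
    have Min_ne: "Min X \<noteq> z" "Min Z \<noteq> Min Y"
      using Min_mem[OF mem(1)] Min_mem[OF mem(2)] Min_mem[OF mem(3)] disj Z(2) by auto
    have vs: "X \<in> vertices 5 es" "Y \<in> vertices 5 es" "Z \<in> vertices 5 es" using mem by (simp_all add: mem_vertices)
    have "Z \<subseteq> E" if "E \<in> set es" "X \<subset> E" for E using sets[OF that(1)] that(2) not by auto
    then have parX: "parent 5 es X Z" by (intro parentI[OF es mem(1) vs(3) 3(5)])
    have "{1..5} \<subseteq> E" if "E \<in> set es" "Y \<subset> E" for E using sets[OF that(1)] that(2) not by auto
    then have parY: "parent 5 es Y {1..5}" by (intro parentI[OF es mem(2) R sub[OF mem(2)]])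
    have "{1..5} \<subseteq> E" if "E \<in> set es" "Z \<subset> E" for E using sets[OF that(1)] that(2) 3(5) not by auto
    then have parZ: "parent 5 es Z {1..5}" by (intro parentI[OF es mem(3) R sub[OF mem(3)]])
    note par = parX parY parZ
    obtain lX lY lZ lR where "\<And>d. wl_lin es x X d = (d b - d a) * lX"
      "\<And>d. wl_lin es x Y d = (d b' - d a') * lY" "\<And>d. wl_lin es x Z d = (d z - d (Min X)) * lZ"
      "\<And>d. wl_lin es x {1..5} d = (d (Min Y) - d (Min Z)) * lR"
      using binary[OF vs(1) X(3,2)] binary[OF vs(2) Y(3,2)] binary[OF vs(3) inpZ Min_ne(1)] binary[OF R inpR Min_ne(2)]
      by blast
    note id = cocycle_two_branches[OF X(1,2) Z Y(1,2) disj W, of "inputs es" "wl_lin es x", OF X(3) Y(3) inpZ this]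
    show thesis
      by (rule that[OF 3(1)])
        (use 3(5) not id in \<open>auto simp: parent_Inter[OF par(1)] parent_Inter[OF par(2)] parent_Inter[OF par(3)]\<close>)
  qed
qed

lemma wl_cocycle_closed: "coboundary WL 5 2 wl_cocycle = (\<lambda>es x. 0 :: 'k::field)"
proof (intro ext)
  fix es and x :: "nat set \<Rightarrow> 'k magma_comb set set"
  show "coboundary WL 5 2 wl_cocycle es x = 0"
  proof (cases "edge_list 5 es \<and> length es = 3 \<and> x \<in> decorations WL 5 es")
    case True
    then have es: "edge_list 5 es" "length es = 3" and x: "x \<in> decorations WL 5 es" by simp_all
    obtain A B C where ABC: "es = [A, B, C]"
      using es(2) by (auto simp: numeral_3_eq_3 length_Suc_conv)
    then have ne: "A \<noteq> B" "A \<noteq> C" "B \<noteq> C" "B \<noteq> A" "C \<noteq> A" "C \<noteq> B"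
      using es(1) by (auto simp: edge_list_def)
    define T where "T D = contracted_term (inputs es) (wl_const es x) (wl_lin es x) D (\<Inter>{E \<in> vertices 5 es. D \<subset> E})" for D
    have swap: "T D P Q = - T D Q P" for D P Q
      unfolding T_def by (rule contracted_term_swap)
    have "coboundary WL 5 2 wl_cocycle es x = wl_cocycle [B, C] (contract WL 5 es A x) -
        wl_cocycle [A, C] (contract WL 5 es B x) + wl_cocycle [A, B] (contract WL 5 es C x)"
      using True ABC by (simp add: coboundary_def numeral_2_eq_2)
    also have "\<dots> = T A B C - T B A C + T C A B"
      using wl_cocycle_contract[OF es _ x, of A B C] wl_cocycle_contract[OF es _ x, of B A C]
        wl_cocycle_contract[OF es _ x, of C A B] ABC ne
      by (simp add: T_def insert_Diff_if)
    also have "\<dots> = 0"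
    proof -
      obtain X Y Z where XYZ: "set es = {X, Y, Z}" "X \<noteq> Y" "X \<noteq> Z" "Y \<noteq> Z" "T X Y Z - T Y X Z + T Z X Y = 0"
        by (rule sum_contracted_terms[OF es x]) (simp add: T_def)
      have "{A, B, C} = {X, Y, Z}" using XYZ(1) ABC by simp
      then have "A \<in> {X, Y, Z}" "B \<in> {X, Y, Z}" "C \<in> {X, Y, Z}" by auto
      \<comment> \<open>\<open>T\<close> is antisymmetric in its last two arguments, so a
        permutation of the three edges multiplies the alternating sum by its sign.\<close>
      then consider "A = X" "B = Y" "C = Z" | "A = X" "B = Z" "C = Y" | "A = Y" "B = X" "C = Z"
        | "A = Y" "B = Z" "C = X" | "A = Z" "B = X" "C = Y" | "A = Z" "B = Y" "C = X"
        using ne by (elim insertE emptyE) simp_all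
      then show ?thesis
      proof cases
        case 1 then show ?thesis using XYZ(5) by simp
      next
        case 2 then show ?thesis using XYZ(5) swap[of X Z Y] by (simp add: algebra_simps)
      next
        case 3 then show ?thesis using XYZ(5) swap[of Z Y X] by (simp add: algebra_simps)
      next
        case 4 then show ?thesis using XYZ(5) swap[of Y Z X] swap[of Z Y X] swap[of X Y Z] by (simp add: algebra_simps)
      next
        case 5 then show ?thesis using XYZ(5) swap[of X Z Y] swap[of Y Z X] by (simp add: algebra_simps)
      next
        case 6 then show ?thesis using XYZ(5) swap[of X Z Y] swap[of Y Z X] swap[of Z Y X] by (simp add: algebra_simps)
      qed
    qed
    finally show ?thesis .
  qed (auto simp: coboundary_def)
qed

section \<open>Transposed Poisson relations\<close>

text \<open>
  The symmetrised product of a weak Leibniz algebra is associative, and together with the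
  commutator it satisfies the transposed Leibniz rule.
\<close>

definition jordan :: "'k::field magma_comb \<Rightarrow> 'k magma_comb \<Rightarrow> 'k magma_comb" where
  "jordan v w = v \<odot> w + w \<odot> v"

definition lie :: "'k::field magma_comb \<Rightarrow> 'k magma_comb \<Rightarrow> 'k magma_comb" where
  "lie v w = v \<odot> w - w \<odot> v"

text \<open>In functions the derivatives of y and z cancel between the two summands and 8 \<epsilon>
  x' y z remains. The absence of these derivatives is what suggests
  \<open>jordan_mixed\<close>.\<close>

definition mixed :: "'k::field magma_comb \<Rightarrow> 'k magma_comb \<Rightarrow> 'k magma_comb \<Rightarrow> 'k magma_comb" where
  "mixed x y z = lie y (jordan x z) + lie z (jordan x y)"

lemma jordan_commute: "jordan v w = jordan w v"
  by (simp add: jordan_def add.commute)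

lemma jordan_closed:
  assumes "v \<in> tree_space UNIV I" "w \<in> tree_space UNIV J" "I \<inter> J = {}" "L = I \<union> J"
  shows "jordan v w \<in> tree_space UNIV L"
  using assms node_prod_closed[of v UNIV I w J] node_prod_closed[of w UNIV J v I]
  by (simp add: jordan_def keys_subset_add Un_commute Int_commute)

lemma lie_closed:
  assumes "v \<in> tree_space UNIV I" "w \<in> tree_space UNIV J" "I \<inter> J = {}" "L = I \<union> J"
  shows "lie v w \<in> tree_space UNIV L"
  using assms node_prod_closed[of v UNIV I w J] node_prod_closed[of w UNIV J v I]
  by (simp add: lie_def keys_subset_diff Un_commute Int_commute)

lemma mixed_closed:
  assumes "x \<in> tree_space UNIV I" "y \<in> tree_space UNIV J" "z \<in> tree_space UNIV K"
    and "I \<inter> J = {}" "I \<inter> K = {}" "J \<inter> K = {}" "L = I \<union> J \<union> K"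
  shows "mixed x y z \<in> tree_space UNIV L"
proof -
  have "lie y (jordan x z) \<in> tree_space UNIV L"
    using assms by (intro lie_closed[OF assms(2) jordan_closed[OF assms(1,3,5) refl]]) auto
  moreover have "lie z (jordan x y) \<in> tree_space UNIV L"
    using assms by (intro lie_closed[OF assms(3) jordan_closed[OF assms(1,2,4) refl]]) auto
  ultimately show ?thesis by (simp add: mixed_def keys_subset_add)
qed

context weak_leibniz_congruence
begin

lemma jordan_congruence:
  assumes "v \<in> N I" "w \<in> tree_space UNIV J" "finite I" "finite J" "I \<inter> J = {}" "L = I \<union> J"
  shows "jordan v w \<in> N L"
  using add[of "I \<union> J", OF _ node_prod_left[OF assms(1-5)] node_prod_right[OF assms(2,1,4,3), unfolded Un_commute[of J I]]] assms
  by (simp add: jordan_def Int_commute)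

lemma lie_congruence:
  assumes "v \<in> tree_space UNIV I" "w \<in> N J" "finite I" "finite J" "I \<inter> J = {}" "L = I \<union> J"
  shows "lie v w \<in> N L"
  using diff[of "I \<union> J", OF _ node_prod_right[OF assms(1-5)] node_prod_left[OF assms(2,1,4,3), unfolded Un_commute[of J I]]] assms
  by (simp add: lie_def Int_commute)

text \<open>Adding the left and the right identity with the same commutator produces the symmetrised
  product of this commutator with the third element. This is done for [v, w] and for [w, u].\<close>

lemma transposed_leibniz:
  assumes u: "u \<in> tree_space UNIV I" and v: "v \<in> tree_space UNIV J" and w: "w \<in> tree_space UNIV K"
    and fin: "finite I" "finite J" "finite K" and disj: "I \<inter> J = {}" "I \<inter> K = {}" "J \<inter> K = {}"
    and L: "L = I \<union> J \<union> K"
  shows "fscale 2 (jordan (lie u v) w) - (lie u (jordan v w) - lie v (jordan u w)) \<in> N L"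
proof -
  have finL: "finite L" using fin L by simp
  have "left_id v w u \<in> N L" "left_id w u v \<in> N L" "right_id u v w \<in> N L" "right_id v w u \<in> N L"
    by (rule left_id[OF v w u] left_id[OF w u v] right_id[OF u v w] right_id[OF v w u];
      use fin disj L in auto)+
  then have "- ((left_id v w u + right_id u v w) + (left_id w u v + right_id v w u)) \<in> N L"
    by (intro uminus add finL)
  also have "- ((left_id v w u + right_id u v w) + (left_id w u v + right_id v w u)) =
      fscale 2 (jordan (lie u v) w) - (lie u (jordan v w) - lie v (jordan u w))"
    by (rule poly_mapping_eqI)
      (simp add: jordan_def lie_def left_id_def right_id_def node_prod_linear lookup_add lookup_minus algebra_simps)
  finally show ?thesis .
qed

text \<open>\<open>?E a b c\<close> expresses the double commutator [[a, b], c] by products without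
  commutators. The cyclic sum minus three copies of one term is three times the associator, whence
  the division by 3.\<close>

lemma jordan_assoc:
  assumes char: "(3::'k) \<noteq> 0"
    and u: "u \<in> tree_space UNIV I" and v: "v \<in> tree_space UNIV J" and w: "w \<in> tree_space UNIV K"
    and fin: "finite I" "finite J" "finite K" and disj: "I \<inter> J = {}" "I \<inter> K = {}" "J \<inter> K = {}"
    and L: "L = I \<union> J \<union> K"
  shows "jordan (jordan u v) w - jordan u (jordan v w) \<in> N L"
proof -
  have finL: "finite L" using fin L by simp
  let ?E = "\<lambda>a b c. left_id a b c - right_id c a b"
  have "left_id u v w \<in> N L" "left_id v w u \<in> N L" "left_id w u v \<in> N L"
    "right_id w u v \<in> N L" "right_id u v w \<in> N L" "right_id v w u \<in> N L"
    by (rule left_id[OF u v w] left_id[OF v w u] left_id[OF w u v]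
        right_id[OF w u v] right_id[OF u v w] right_id[OF v w u]; use fin disj L in auto)+
  then have "?E u v w + ?E v w u + ?E w u v - fscale 3 (?E w u v) \<in> N L"
    by (intro diff add fscale finL)
  also have "?E u v w + ?E v w u + ?E w u v - fscale 3 (?E w u v) =
      fscale 3 (jordan (jordan u v) w - jordan u (jordan v w))"
    by (rule poly_mapping_eqI)
      (simp add: jordan_def left_id_def right_id_def node_prod_linear lookup_add lookup_minus algebra_simps)
  finally show ?thesis using fscale_cancel[OF finL _ char] by blast
qed

text \<open>Write ab for \<open>jordan a b\<close>. The transposed rule for [y, z] and x, multiplied
  by t, gives t [z, xy] = t [y, xz] - 2 t x [y, z], so the left side is 2 t [y, xz] - 2 t x [y, z].
  Applying the transposed rule to both terms, with t and with xt as the third element, [y, xzt]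
  cancels and [yt, xz] + [z, xyt] remains, which is the right side.\<close>

lemma jordan_mixed:
  assumes char: "(3::'k) \<noteq> 0" and ne: "distinct [t, x, y, z]"
  defines "l \<equiv> \<lambda>i. basis (Leaf i) :: 'k magma_comb"
  shows "jordan (l t) (mixed (l x) (l y) (l z)) - mixed (l x) (jordan (l y) (l t)) (l z) \<in> N {t, x, y, z}"
    (is "?T \<in> N ?L")
proof -
  have ne: "t \<noteq> x" "t \<noteq> y" "t \<noteq> z" "x \<noteq> y" "x \<noteq> z" "y \<noteq> z" "x \<noteq> t" "y \<noteq> t" "z \<noteq> t" "y \<noteq> x" "z \<noteq> x" "z \<noteq> y"
    using ne by auto
  have l: "l i \<in> tree_space UNIV {i}" for i by (auto simp: l_def trees_def)
  have j: "jordan (l i) (l k) \<in> tree_space UNIV {i, k}" if "i \<noteq> k" for i k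
    using that by (intro jordan_closed[OF l l]) auto
  define TL where "TL u v w = fscale 2 (jordan (lie u v) w) - (lie u (jordan v w) - lie v (jordan u w))"
    for u v w :: "'k magma_comb"
  define JA where "JA u v w = jordan (jordan u v) w - jordan u (jordan v w)" for u v w :: "'k magma_comb"
  note tl = transposed_leibniz[folded TL_def] and ja = jordan_assoc[OF char, folded JA_def]
  have a: "JA (l i) (l k) (l m) \<in> N {i, k, m}" if "i \<noteq> k" "i \<noteq> m" "k \<noteq> m" for i k m
    using that by (intro ja[OF l l l]) auto
  have f1: "TL (l y) (jordan (l x) (l z)) (l t) \<in> N ?L"
    using ne by (intro tl[OF l j l]) auto
  have f3: "TL (l y) (l z) (jordan (l x) (l t)) \<in> N ?L"
    using ne by (intro tl[OF l l j]) auto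
  have yz: "lie (l y) (l z) \<in> tree_space UNIV {y, z}"
    using ne by (intro lie_closed[OF l l]) auto
  have f4: "JA (l t) (l x) (lie (l y) (l z)) \<in> N ?L"
    using ne by (intro ja[OF l l yz]) auto
  have "TL (l y) (l z) (l x) \<in> N {y, z, x}"
    using ne by (intro tl[OF l l l]) auto
  then have f5: "jordan (TL (l y) (l z) (l x)) (l t) \<in> N ?L"
    by (rule jordan_congruence[OF _ l]) (use ne in auto)
  have g1: "lie (l y) (JA (l z) (l x) (l t)) \<in> N ?L"
    using ne by (intro lie_congruence[OF l a]) auto
  have g2: "lie (l z) (JA (l y) (l x) (l t)) \<in> N ?L"
    using ne by (intro lie_congruence[OF l a]) auto
  have g3: "lie (l z) (JA (l x) (l y) (l t)) \<in> N ?L"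
    using ne by (intro lie_congruence[OF l a]) auto
  have "TL (l y) (jordan (l x) (l z)) (l t) + lie (l z) (JA (l x) (l y) (l t))
      + fscale 2 (JA (l t) (l x) (lie (l y) (l z))) + jordan (TL (l y) (l z) (l x)) (l t)
      - TL (l y) (l z) (jordan (l x) (l t)) + lie (l y) (JA (l z) (l x) (l t))
      - lie (l z) (JA (l y) (l x) (l t)) \<in> N ?L" (is "?S \<in> _")
    by (intro add diff fscale f1 f3 f4 f5 g1 g2 g3) simp_all
  also have "?S = ?T"
    by (rule poly_mapping_eqI)
      (simp add: TL_def JA_def mixed_def jordan_def lie_def node_prod_linear lookup_add lookup_minus algebra_simps)
  finally show ?thesis .
qed

end

section \<open>Failure of Koszulness\<close>

text \<open>Decorations given by representatives, so that contraction of an edge becomes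
  \<open>insert_trees\<close> on combinations of trees.\<close>

definition decorate :: "nat set list \<Rightarrow> (nat set \<Rightarrow> 'k::field magma_comb) \<Rightarrow> nat set \<Rightarrow> 'k magma_comb set set" where
  "decorate es f = restrict (\<lambda>V. wcls (inputs es V) (f V)) (vertices 5 es)"

definition decorable :: "nat set list \<Rightarrow> (nat set \<Rightarrow> 'k::field magma_comb) \<Rightarrow> bool" where
  "decorable es f \<longleftrightarrow> (\<forall>V\<in>vertices 5 es. f V \<in> tree_space UNIV (inputs es V))"

lemma decorate_decorations: "decorable es f \<Longrightarrow> decorate es f \<in> decorations WL 5 es"
  by (simp add: decorate_def decorations_def decorable_def ops_WL)

lemma decorate_eqI:
  assumes "edge_list 5 es" "decorable es f" "decorable es g"
    and "\<And>V. V \<in> vertices 5 es \<Longrightarrow> f V = g V \<or> f V - g V \<in> wl_kernel (inputs es V)"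
  shows "decorate es f = decorate es g"
  unfolding decorate_def
proof (rule restrict_ext)
  fix V assume V: "V \<in> vertices 5 es"
  interpret vertex 5 es V using assms(1) V by unfold_locales auto
  show "wcls (inputs es V) (f V) = wcls (inputs es V) (g V)"
    using assms(2,3) assms(4)[OF V] V wcls_eqI[OF finite_inputs, of "f V" "g V"]
    by (auto simp: decorable_def)
qed

lemma contract_decorate:
  assumes c: "contraction 5 es es' A B" and f: "decorable es f"
  shows "contract WL 5 es A (decorate es f) = decorate es' (f(B := insert_trees (Min A) (f B) (f A)))"
    and "decorable es' (f(B := insert_trees (Min A) (f B) (f A)))"
proof -
  interpret contraction 5 es es' A B by fact
  have fV: "f V \<in> tree_space UNIV (inputs es V)" if "V \<in> vertices 5 es" for V
    using f that by (simp add: decorable_def)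
  have compose: "compose WL (inputs es B) (Min A) (inputs es A) (wcls (inputs es B) (f B)) (wcls (inputs es A) (f A)) =
      wcls (inputs es' B) (insert_trees (Min A) (f B) (f A))"
    using operad_homD(4)[OF hom_wcls composable_inputs, of "f B" "f A"] fV[OF B(1)] fV[OF A_vertex]
    by (simp add: inputs_contract)
  show "decorable es' (f(B := insert_trees (Min A) (f B) (f A)))"
    using insert_trees_closed[OF composable_inputs fV[OF B(1)] fV[OF A_vertex]] fV
    by (auto simp: decorable_def vertices_contract inputs_contract inputs_other)
  show "contract WL 5 es A (decorate es f) = decorate es' (f(B := insert_trees (Min A) (f B) (f A)))"
  proof (rule extensionalityI[of _ "vertices 5 es'"])
    show "contract WL 5 es A (decorate es f) \<in> extensional (vertices 5 es')"
      by (simp add: contract_def vertices_contract Let_def)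
    show "decorate es' (f(B := insert_trees (Min A) (f B) (f A))) \<in> extensional (vertices 5 es')"
      by (simp add: decorate_def)
    show "contract WL 5 es A (decorate es f) V = decorate es' (f(B := insert_trees (Min A) (f B) (f A))) V"
      if V: "V \<in> vertices 5 es'" for V
      using V B(1) A_vertex
      by (auto simp: contract_apply decorate_def compose inputs_other vertices_contract)
  qed
qed

lemma inputs_corolla:
  assumes V: "finite V" "2 \<le> card V" and sub: "\<And>E. E \<in> set es \<Longrightarrow> \<not> E \<subset> V"
  shows "inputs es V = V"
proof -
  have "children es V = (\<lambda>i. {i}) ` V"
    by (rule children_eqI) (use V sub in auto)
  then show ?thesis by (simp add: inputs_eq image_image)
qed

lemma inputs_one_edge:
  assumes E: "E \<in> set es" "E \<subset> V" "E \<noteq> {}" and sub: "\<And>F. F \<in> set es \<Longrightarrow> F \<subset> V \<Longrightarrow> F \<subseteq> E"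
  shows "inputs es V = insert (Min E) (V - E)"
proof -
  have "children es V = insert E ((\<lambda>i. {i}) ` (V - E))"
  proof (rule children_eqI)
    show "\<Union>(insert E ((\<lambda>i. {i}) ` (V - E))) = V" using E by auto
    show "V \<notin> insert E ((\<lambda>i. {i}) ` (V - E))" "{} \<notin> insert E ((\<lambda>i. {i}) ` (V - E))" using E by auto
    show "C \<inter> D = {}" if "C \<in> insert E ((\<lambda>i. {i}) ` (V - E))" "D \<in> insert E ((\<lambda>i. {i}) ` (V - E))" "C \<noteq> D" for C D
      using that by auto
    show "C \<in> set es \<or> (\<exists>i\<in>V. C = {i})" if "C \<in> insert E ((\<lambda>i. {i}) ` (V - E))" for C
      using that E by auto
    show "\<exists>C\<in>insert E ((\<lambda>i. {i}) ` (V - E)). F \<subseteq> C" if "F \<in> set es" "F \<subset> V" for F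
      using sub[OF that] by auto
  qed
  then show ?thesis by (simp add: inputs_eq image_image)
qed


lemma root_eq: "{1..5} = {1, 2, 3, 4, 5 :: nat}"
  by auto

lemma decorate_parts:
  assumes es: "edge_list 5 es" and f: "decorable es f" and V: "V \<in> vertices 5 es"
  shows "wl_const es (decorate es f) V = coeff (evaluate (\<lambda>_. 0) (f V)) 0"
    and "wl_lin es (decorate es f) V d = coeff (evaluate d (f V)) 1"
proof -
  interpret vertex 5 es V using es V by unfold_locales auto
  have "f V \<in> tree_space UNIV (inputs es V)" using f V by (simp add: decorable_def)
  then show "wl_const es (decorate es f) V = coeff (evaluate (\<lambda>_. 0) (f V)) 0"
    "wl_lin es (decorate es f) V d = coeff (evaluate d (f V)) 1"
    using V by (simp_all add: decorate_def wl_const_def wl_lin_def const_part_def lin_part_def val_wcls[OF finite_inputs])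
qed

section \<open>Decorated trees with one and two edges\<close>

definition decorate_one ::
    "nat set \<Rightarrow> 'k::field magma_comb \<Rightarrow> 'k magma_comb \<Rightarrow> nat set \<Rightarrow> 'k magma_comb set set" where
  "decorate_one Q v w = decorate [Q] ((\<lambda>_. w)(Q := v))"

text \<open>The default value \<open>w\<close> of the function is read only at the root and
  decorates it.\<close>

definition decorate_two ::
    "nat set \<Rightarrow> nat set \<Rightarrow> 'k::field magma_comb \<Rightarrow> 'k magma_comb \<Rightarrow> 'k magma_comb \<Rightarrow>
     nat set \<Rightarrow> 'k magma_comb set set" where
  "decorate_two P Q u v w = decorate [P, Q] ((\<lambda>_. w)(P := u, Q := v))"

lemma edge_list_one: "Q \<subset> {1..5} \<Longrightarrow> 2 \<le> card Q \<Longrightarrow> edge_list 5 [Q]"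
  by (simp add: edge_list_def)

lemma inputs_edge_one:
  assumes "Q \<subset> {1..5}" "2 \<le> card Q"
  shows "inputs [Q] Q = Q" "inputs [Q] {1..5} = insert (Min Q) ({1..5} - Q)"
proof -
  have "finite Q" using assms(1) finite_subset[of Q "{1..5}"] by auto
  then show "inputs [Q] Q = Q" using assms by (intro inputs_corolla) auto
  show "inputs [Q] {1..5} = insert (Min Q) ({1..5} - Q)"
    using assms by (intro inputs_one_edge) auto
qed

lemma decorate_one_eqI:
  assumes Q: "Q \<subset> {1..5}" "2 \<le> card Q"
    and v: "v \<in> tree_space UNIV Q" "v' \<in> tree_space UNIV Q" "v - v' \<in> wl_kernel Q"
    and R: "R = insert (Min Q) ({1..5} - Q)"
    and w: "w \<in> tree_space UNIV R" "w' \<in> tree_space UNIV R" "w - w' \<in> wl_kernel R"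
  shows "decorate_one Q v w = decorate_one Q v' w'"
  unfolding decorate_one_def
proof (rule decorate_eqI[OF edge_list_one[OF Q]])
  note inp = inputs_edge_one[OF Q, folded R]
  have ne: "{1..5} \<noteq> Q" using Q by auto
  show "decorable [Q] ((\<lambda>_. w)(Q := v))" "decorable [Q] ((\<lambda>_. w')(Q := v'))"
    using v w inp ne by (auto simp: decorable_def mem_vertices)
  show "((\<lambda>_. w)(Q := v)) V = ((\<lambda>_. w')(Q := v')) V \<or>
      ((\<lambda>_. w)(Q := v)) V - ((\<lambda>_. w')(Q := v')) V \<in> wl_kernel (inputs [Q] V)" if "V \<in> vertices 5 [Q]" for V
    using that v w inp ne by (auto simp: mem_vertices simp del: One_nat_def)
qed

text \<open>A tree with two edges links its two contractions, which have one edge each. Sums with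
  suitable signs along a closed walk of such links therefore vanish on coboundaries.\<close>

lemma coboundary_decorate:
  assumes es: "edge_list 5 [P, Q]" and par: "parent 5 [P, Q] P B" "parent 5 [P, Q] Q C" and f: "decorable [P, Q] f"
  shows "coboundary WL 5 1 \<psi> [P, Q] (decorate [P, Q] f) =
    \<psi> [Q] (decorate [Q] (f(B := insert_trees (Min P) (f B) (f P)))) -
    \<psi> [P] (decorate [P] (f(C := insert_trees (Min Q) (f C) (f Q))))"
proof -
  have "P \<noteq> Q" using es by (auto simp: edge_list_def)
  then have c: "contraction 5 [P, Q] [Q] P B" "contraction 5 [P, Q] [P] Q C"
    using es par by (unfold_locales; auto)+
  show ?thesis
    using es decorate_decorations[OF f] contract_decorate(1)[OF c(1) f] contract_decorate(1)[OF c(2) f]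
    by (simp add: coboundary_def)
qed

lemma decorate_cong: "(\<And>V. V \<in> vertices 5 es \<Longrightarrow> f V = g V) \<Longrightarrow> decorate es f = decorate es g"
  unfolding decorate_def by (rule restrict_ext) simp

lemma nested_decoration:
  assumes PQ: "P \<subset> Q" "Q \<subset> {1..5}" "2 \<le> card P"
    and u: "u \<in> tree_space UNIV P" and v: "v \<in> tree_space UNIV (insert (Min P) (Q - P))"
    and w: "w \<in> tree_space UNIV (insert (Min Q) ({1..5} - Q))"
  shows "edge_list 5 [P, Q]" "decorable [P, Q] ((\<lambda>_. w)(P := u, Q := v))"
    "coboundary WL 5 1 \<psi> [P, Q] (decorate_two P Q u v w) =
      \<psi> [Q] (decorate_one Q (insert_trees (Min P) v u) w) - \<psi> [P] (decorate_one P u (insert_trees (Min Q) w v))"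
proof -
  let ?f = "(\<lambda>_. w)(P := u, Q := v)"
  have fin: "finite Q" "finite P" using PQ finite_subset[of Q "{1..5}"] finite_subset[of P Q] by auto
  have cardQ: "2 \<le> card Q" using PQ(3) card_mono[OF fin(1), of P] PQ(1) by auto
  have ne: "P \<noteq> {1..5}" "Q \<noteq> {1..5}" "P \<noteq> Q" "P \<noteq> {}" "Q \<noteq> {}" using PQ by auto
  show es: "edge_list 5 [P, Q]" using PQ cardQ by (auto simp: edge_list_def)
  have "inputs [P, Q] P = P" using fin PQ by (intro inputs_corolla) auto
  moreover have "inputs [P, Q] Q = insert (Min P) (Q - P)" using PQ ne by (intro inputs_one_edge) auto
  moreover have "inputs [P, Q] {1..5} = insert (Min Q) ({1..5} - Q)"
  proof (rule inputs_one_edge)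
    show "F \<subseteq> Q" if "F \<in> set [P, Q]" for F using that PQ by auto
  qed (use PQ ne in simp_all)
  ultimately have inp: "?f {1..5} \<in> tree_space UNIV (inputs [P, Q] {1..5})"
    "?f P \<in> tree_space UNIV (inputs [P, Q] P)" "?f Q \<in> tree_space UNIV (inputs [P, Q] Q)"
    using u v w ne by (simp_all del: One_nat_def)
  then show f: "decorable [P, Q] ?f"
    unfolding decorable_def vertices_def by (metis empty_iff insert_iff list.set)
  have parP: "parent 5 [P, Q] P Q"
  proof (rule parentI[OF es])
    show "Q \<subseteq> C" if "C \<in> set [P, Q]" "P \<subset> C" for C using that by auto
  qed (use PQ in \<open>simp_all add: vertices_def\<close>)
  have parQ: "parent 5 [P, Q] Q {1..5}"
  proof (rule parentI[OF es])
    show "{1..5} \<subseteq> C" if "C \<in> set [P, Q]" "Q \<subset> C" for C using that PQ(1) by auto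
  qed (use PQ in \<open>simp_all add: vertices_def\<close>)
  note eq = coboundary_decorate[OF es parP parQ f]
  have 1: "decorate [Q] (?f(Q := insert_trees (Min P) v u)) = decorate_one Q (insert_trees (Min P) v u) w"
    unfolding decorate_one_def using ne by (intro decorate_cong) (auto simp: mem_vertices simp del: One_nat_def)
  have 2: "decorate [P] (?f({1..5} := insert_trees (Min Q) w v)) = decorate_one P u (insert_trees (Min Q) w v)"
    unfolding decorate_one_def using ne by (intro decorate_cong) (auto simp: mem_vertices simp del: One_nat_def)
  show "coboundary WL 5 1 \<psi> [P, Q] (decorate_two P Q u v w) =
      \<psi> [Q] (decorate_one Q (insert_trees (Min P) v u) w) - \<psi> [P] (decorate_one P u (insert_trees (Min Q) w v))"
    using eq[of \<psi>] ne 1 2 unfolding decorate_two_def by (simp del: One_nat_def)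
qed

lemma disjoint_decoration:
  assumes PQ: "P \<union> Q = {1..5}" "P \<inter> Q = {}" "2 \<le> card P" "2 \<le> card Q"
    and u: "u \<in> tree_space UNIV P" and v: "v \<in> tree_space UNIV Q" and w: "w \<in> tree_space UNIV {Min P, Min Q}"
  shows "edge_list 5 [P, Q]" "decorable [P, Q] ((\<lambda>_. w)(P := u, Q := v))"
    "coboundary WL 5 1 \<psi> [P, Q] (decorate_two P Q u v w) =
      \<psi> [Q] (decorate_one Q v (insert_trees (Min P) w u)) - \<psi> [P] (decorate_one P u (insert_trees (Min Q) w v))"
proof -
  let ?f = "(\<lambda>_. w)(P := u, Q := v)"
  have ne: "P \<noteq> {}" "Q \<noteq> {}" using PQ by auto
  have psub: "P \<subset> {1..5}" "Q \<subset> {1..5}" using PQ(1,2) ne by blast+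
  have fin: "finite P" "finite Q" using psub finite_subset[of _ "{1..5::nat}"] by auto
  have not: "\<not> P \<subset> Q" "\<not> Q \<subset> P" "P \<noteq> Q" "P \<noteq> {1..5}" "Q \<noteq> {1..5}" using PQ(2) ne psub by auto
  show es: "edge_list 5 [P, Q]" using PQ psub not by (auto simp: edge_list_def)
  have "inputs [P, Q] P = P" using fin PQ not by (intro inputs_corolla) auto
  moreover have "inputs [P, Q] Q = Q" using fin PQ not by (intro inputs_corolla) auto
  moreover have "inputs [P, Q] {1..5} = {Min P, Min Q}" using PQ ne by (intro inputs_two) auto
  ultimately have inp: "?f {1..5} \<in> tree_space UNIV (inputs [P, Q] {1..5})"
    "?f P \<in> tree_space UNIV (inputs [P, Q] P)" "?f Q \<in> tree_space UNIV (inputs [P, Q] Q)"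
    using u v w not by (simp_all del: One_nat_def)
  then show f: "decorable [P, Q] ?f"
    unfolding decorable_def vertices_def by (metis empty_iff insert_iff list.set)
  have parP: "parent 5 [P, Q] P {1..5}"
  proof (rule parentI[OF es])
    show "{1..5} \<subseteq> C" if "C \<in> set [P, Q]" "P \<subset> C" for C using that not by auto
  qed (use psub in \<open>simp_all add: vertices_def\<close>)
  have parQ: "parent 5 [P, Q] Q {1..5}"
  proof (rule parentI[OF es])
    show "{1..5} \<subseteq> C" if "C \<in> set [P, Q]" "Q \<subset> C" for C using that not by auto
  qed (use psub in \<open>simp_all add: vertices_def\<close>)
  note eq = coboundary_decorate[OF es parP parQ f]
  have 1: "decorate [Q] (?f({1..5} := insert_trees (Min P) w u)) = decorate_one Q v (insert_trees (Min P) w u)"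
    unfolding decorate_one_def using not by (intro decorate_cong) (auto simp: mem_vertices simp del: One_nat_def)
  have 2: "decorate [P] (?f({1..5} := insert_trees (Min Q) w v)) = decorate_one P u (insert_trees (Min Q) w v)"
    unfolding decorate_one_def using not by (intro decorate_cong) (auto simp: mem_vertices simp del: One_nat_def)
  show "coboundary WL 5 1 \<psi> [P, Q] (decorate_two P Q u v w) =
      \<psi> [Q] (decorate_one Q v (insert_trees (Min P) w u)) - \<psi> [P] (decorate_one P u (insert_trees (Min Q) w v))"
    using eq[of \<psi>] not 1 2 unfolding decorate_two_def by (simp del: One_nat_def)
qed


section \<open>Values of the cocycle\<close>

lemma wl_cocycle_decorate:
  assumes es: "edge_list 5 [P, Q]" and f: "decorable [P, Q] f"
  shows "wl_cocycle [P, Q] (decorate [P, Q] f) =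
    cocycle_term P Q (\<lambda>V. coeff (evaluate (\<lambda>_. 0) (f V)) 0) (\<lambda>V d. coeff (evaluate d (f V)) 1) -
    cocycle_term Q P (\<lambda>V. coeff (evaluate (\<lambda>_. 0) (f V)) 0) (\<lambda>V d. coeff (evaluate d (f V)) 1)"
proof -
  have V: "V \<in> vertices 5 [P, Q]" if "V = {1..5} \<or> V = P \<or> V = Q" for V
    using that by (auto simp: vertices_def)
  have "cocycle_term P Q (wl_const [P, Q] (decorate [P, Q] f)) (wl_lin [P, Q] (decorate [P, Q] f)) =
      cocycle_term P Q (\<lambda>V. coeff (evaluate (\<lambda>_. 0) (f V)) 0) (\<lambda>V d. coeff (evaluate d (f V)) 1)"
    by (intro cocycle_term_cong conjI ext decorate_parts[OF es f V])
  moreover have "cocycle_term Q P (wl_const [P, Q] (decorate [P, Q] f)) (wl_lin [P, Q] (decorate [P, Q] f)) =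
      cocycle_term Q P (\<lambda>V. coeff (evaluate (\<lambda>_. 0) (f V)) 0) (\<lambda>V d. coeff (evaluate d (f V)) 1)"
    by (intro cocycle_term_cong conjI ext decorate_parts[OF es f V]) auto
  ultimately show ?thesis
    using es decorate_decorations[OF f] by (simp add: wl_cocycle_def)
qed

lemma cocycle_term_reverse: "P \<subset> Q \<Longrightarrow> P \<noteq> {} \<Longrightarrow> cocycle_term Q P c m = 0"
  by (auto simp: cocycle_term_def)

text \<open>To be applied with \<open>P\<close> decorated by \<open>mixed_leaves\<close>, whose
  constant part is zero.\<close>

lemma cocycle_term_nested_zero:
  "P \<subset> Q \<Longrightarrow> 1 \<in> P \<Longrightarrow> card P = 3 \<Longrightarrow> c P = 0 \<Longrightarrow> cocycle_term P Q c m = 0"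
  by (simp add: cocycle_term_def)

text \<open>The branch that accounts for the only nonzero value along the cycle.\<close>

lemma cocycle_term_nested:
  "P \<subset> Q \<Longrightarrow> 1 \<in> Q - P \<Longrightarrow> card P = 2 \<Longrightarrow> card Q = 4 \<Longrightarrow>
   cocycle_term P Q c m = c {1..5} * c P * m Q (\<lambda>_. 1)"
  by (simp add: cocycle_term_def)

lemma cocycle_term_disjoint_zero:
  assumes "P \<inter> Q = {}" "P \<noteq> {}" "1 \<in> Q" "card Q = 3"
  shows "cocycle_term P Q c m - cocycle_term Q P c m = 0"
proof -
  have "\<not> P \<subset> Q" "\<not> Q \<subset> P" "1 \<notin> P" using assms by auto
  then show ?thesis using assms by (simp add: cocycle_term_def)
qed

definition jordan_leaves :: "nat \<Rightarrow> nat \<Rightarrow> 'k::field magma_comb" where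
  "jordan_leaves a b = jordan (basis (Leaf a)) (basis (Leaf b))"

definition mixed_leaves :: "nat \<Rightarrow> nat \<Rightarrow> nat \<Rightarrow> 'k::field magma_comb" where
  "mixed_leaves a b c = mixed (basis (Leaf a)) (basis (Leaf b)) (basis (Leaf c))"

lemma leaf_closed: "basis (Leaf a) \<in> tree_space UNIV {a}"
  by (auto simp: trees_def)

lemma jordan_leaves_closed: "a \<noteq> b \<Longrightarrow> I = {a, b} \<Longrightarrow> jordan_leaves a b \<in> tree_space UNIV I"
  unfolding jordan_leaves_def by (rule jordan_closed[OF leaf_closed leaf_closed]) auto

lemma mixed_leaves_closed: "distinct [a, b, c] \<Longrightarrow> I = {a, b, c} \<Longrightarrow> mixed_leaves a b c \<in> tree_space UNIV I"
  unfolding mixed_leaves_def by (rule mixed_closed[OF leaf_closed leaf_closed leaf_closed]) auto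

lemma insert_jordan:
  assumes "a \<noteq> b"
  shows "insert_trees a (jordan_leaves a b) v = jordan v (basis (Leaf b))"
    and "insert_trees b (jordan_leaves a b) v = jordan (basis (Leaf a)) v"
  using assms by (simp_all add: jordan_leaves_def jordan_def insert_trees_linear insert_trees_prod)

lemma insert_mixed:
  assumes "distinct [a, b, c]"
  shows "insert_trees b (mixed_leaves a b c) v = mixed (basis (Leaf a)) v (basis (Leaf c))"
  using assms
  by (simp add: mixed_leaves_def mixed_def jordan_def lie_def insert_trees_linear insert_trees_prod node_prod_linear)

lemma evaluate_jordan_leaves: "a \<noteq> b \<Longrightarrow> evaluate d (jordan_leaves a b) = [:2:]"
  by (simp add: jordan_leaves_def jordan_def node_prod_basis evaluate_add times_tree_def)

text \<open>This is 8 \<epsilon> x' y z for exponentials: only the frequency of the first argument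
  survives.\<close>

lemma evaluate_mixed_leaves:
  "distinct [a, b, c] \<Longrightarrow> evaluate d (mixed_leaves a b c) = [:0, 8 * d a:]"
  by (simp add: mixed_leaves_def mixed_def jordan_def lie_def node_prod_linear node_prod_basis
      evaluate_add evaluate_diff times_tree_def algebra_simps)

text \<open>On coboundaries the alternating sum \<open>x1 - x2 + x3 - x4 + x5\<close> of the values
  at five decorated trees telescopes to zero, since neighbouring trees have contractions that agree
  modulo the relations. On the cocycle only \<open>x4\<close> contributes.\<close>

lemma wl_cocycle_not_coboundary:
  assumes char: "(2::'k::field) \<noteq> 0" "(3::'k) \<noteq> 0"
  shows "(wl_cocycle :: _ \<Rightarrow> (nat set \<Rightarrow> 'k magma_comb set set) \<Rightarrow> 'k) \<noteq> coboundary WL 5 1 \<psi>"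
proof
  assume eq: "wl_cocycle = coboundary WL 5 1 \<psi>"
  interpret weak_leibniz_congruence "wl_kernel :: nat set \<Rightarrow> 'k magma_comb set" by (rule congruence_wl)
  let ?j = "jordan_leaves :: nat \<Rightarrow> nat \<Rightarrow> 'k magma_comb"
  let ?m = "mixed_leaves :: nat \<Rightarrow> nat \<Rightarrow> nat \<Rightarrow> 'k magma_comb"
  let ?l = "\<lambda>i. basis (Leaf i) :: 'k magma_comb"
  note [simp del] = One_nat_def
  have sets: "{1, 3, 4} \<subset> {1, 2, 3, 4 :: nat}" "{1, 2, 4} \<subset> {1, 2, 3, 4 :: nat}" "{1, 2, 4} \<subset> {1, 2, 4, 5 :: nat}"
    "{2, 5} \<subset> {1, 2, 4, 5 :: nat}" "{1, 2, 3, 4 :: nat} \<subset> {1..5}" "{1, 2, 4, 5 :: nat} \<subset> {1..5}"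
    "{1, 2, 4 :: nat} \<subset> {1..5}" "{1, 3, 4 :: nat} \<subset> {1..5}" "{2, 5 :: nat} \<subset> {1..5}"
    by (simp_all add: root_eq psubset_eq set_eq_subset)
  have cards: "2 \<le> card {1, 3, 4 :: nat}" "2 \<le> card {1, 2, 4 :: nat}" "2 \<le> card {2, 5 :: nat}"
    "2 \<le> card {1, 2, 3, 4 :: nat}" "2 \<le> card {1, 2, 4, 5 :: nat}"
    by simp_all
  have mins: "Min {1, 3, 4 :: nat} = 1" "Min {1, 2, 4 :: nat} = 1" "Min {2, 5 :: nat} = 2"
    "Min {1, 2, 3, 4 :: nat} = 1" "Min {1, 2, 4, 5 :: nat} = 1"
    by simp_all
  have diffs: "insert 1 ({1, 2, 3, 4} - {1, 3, 4}) = {1, 2 :: nat}" "insert 1 ({1, 2, 3, 4} - {1, 2, 4}) = {1, 3 :: nat}"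
    "insert 1 ({1, 2, 4, 5} - {1, 2, 4}) = {1, 5 :: nat}" "insert 2 ({1, 2, 4, 5} - {2, 5}) = {1, 2, 4 :: nat}"
    "insert 1 ({1..5} - {1, 2, 3, 4}) = {1, 5 :: nat}" "insert 1 ({1..5} - {1, 2, 4, 5}) = {1, 3 :: nat}"
    "insert 1 ({1..5} - {1, 3, 4}) = {1, 2, 5 :: nat}" "insert 1 ({1..5} - {1, 2, 4}) = {1, 3, 5 :: nat}"
    "insert 2 ({1..5} - {2, 5}) = {1, 2, 3, 4 :: nat}"
    unfolding root_eq by auto
  have j: "?j 1 2 \<in> tree_space UNIV {1, 2}" "?j 1 3 \<in> tree_space UNIV {1, 3}" "?j 1 5 \<in> tree_space UNIV {1, 5}"
    "?j 2 5 \<in> tree_space UNIV {2, 5}" "?j 1 2 \<in> tree_space UNIV {2, 1}"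
    by (rule jordan_leaves_closed; auto)+
  have m: "?m 1 3 4 \<in> tree_space UNIV {1, 3, 4}" "?m 1 2 4 \<in> tree_space UNIV {1, 2, 4}"
    by (rule mixed_leaves_closed; simp)+
  \<comment> \<open>The edges of the one-edge trees in cyclic order are {1,3,4}, {1,2,3,4}, {1,2,4},
    {1,2,4,5}, {2,5}; each of \<open>x1\<close> to \<open>x5\<close> links two consecutive
    ones.\<close>
  note x1 = nested_decoration[OF sets(1,5) cards(1), unfolded mins diffs, OF m(1) j(1,3)]
  note x2 = nested_decoration[OF sets(2,5) cards(2), unfolded mins diffs, OF m(2) j(2,3)]
  note x3 = nested_decoration[OF sets(3,6) cards(2), unfolded mins diffs, OF m(2) j(3,2)]
  note x4 = nested_decoration[OF sets(4,6) cards(3), unfolded mins diffs, OF j(4) m(2) j(2)]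
  have un: "{2, 5} \<union> {1, 3, 4} = {1..5 :: nat}" "{2, 5} \<inter> {1, 3, 4 :: nat} = {}" by (auto simp: root_eq)
  note x5 = disjoint_decoration[OF un cards(3,1), unfolded mins, OF j(4) m(1) j(5)]

  let ?N = "wl_kernel :: nat set \<Rightarrow> 'k magma_comb set"
  note jm = jordan_mixed[OF char(2), folded mixed_leaves_def, folded jordan_leaves_def]
  have zero: "0 \<in> ?N {1, 2, 3, 4}" "0 \<in> ?N {1, 2, 4}" "0 \<in> ?N {1, 3, 4}" "0 \<in> ?N {2, 5}" "0 \<in> ?N {1, 3}" "0 \<in> ?N {1, 5}"
    by simp_all
  have "jordan (?l 2) (?m 1 3 4) - mixed (?l 1) (?j 3 2) (?l 4) \<in> ?N {1, 2, 3, 4}"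
    using jm[of 2 1 3 4] by (simp add: insert_commute)
  moreover have "jordan (?l 3) (?m 1 2 4) - mixed (?l 1) (?j 2 3) (?l 4) \<in> ?N {1, 2, 3, 4}"
    using jm[of 3 1 2 4] by (simp add: insert_commute)
  ultimately have "(jordan (?l 2) (?m 1 3 4) - mixed (?l 1) (?j 3 2) (?l 4)) -
      (jordan (?l 3) (?m 1 2 4) - mixed (?l 1) (?j 2 3) (?l 4)) \<in> ?N {1, 2, 3, 4}"
    by (rule diff[rotated]) simp
  \<comment> \<open>Both sides agree with D(1; {2,3}, 4): the factor 2 is absorbed into 3 on one
    side and the factor 3 into 2 on the other.\<close>
  then have k1: "jordan (?m 1 3 4) (?l 2) - jordan (?m 1 2 4) (?l 3) \<in> ?N {1, 2, 3, 4}"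
    by (simp add: jordan_leaves_def jordan_commute[of "?l 3" "?l 2"] jordan_commute[of "?l _" "mixed_leaves _ _ _"])
  have k2: "jordan (?j 1 3) (?l 5) - jordan (?j 1 5) (?l 3) \<in> ?N {1, 3, 5}"
    using jordan_assoc[OF char(2) leaf_closed[of 3] leaf_closed[of 1] leaf_closed[of 5], of "{1, 3, 5}"]
    by (simp add: insert_commute jordan_leaves_def jordan_commute[of "?l 3"])
  have k3: "jordan (?m 1 2 4) (?l 5) - mixed (?l 1) (?j 2 5) (?l 4) \<in> ?N {1, 2, 4, 5}"
    using jm[of 5 1 2 4] by (simp add: insert_commute jordan_commute[of "?l 5"])
  have k5: "jordan (?j 1 2) (?l 5) - jordan (?l 1) (?j 2 5) \<in> ?N {1, 2, 5}"
    using jordan_assoc[OF char(2) leaf_closed[of 1] leaf_closed[of 2] leaf_closed[of 5], of "{1, 2, 5}"]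
    by (simp add: insert_commute jordan_leaves_def)
  have jm_closed: "jordan (?m 1 3 4) (?l 2) \<in> tree_space UNIV {1, 2, 3, 4}" "jordan (?m 1 2 4) (?l 3) \<in> tree_space UNIV {1, 2, 3, 4}"
    "jordan (?m 1 2 4) (?l 5) \<in> tree_space UNIV {1, 2, 4, 5}"
    by (rule jordan_closed[OF m(1) leaf_closed] jordan_closed[OF m(2) leaf_closed]; auto; fail)+
  have jj_closed: "jordan (?j 1 3) (?l 5) \<in> tree_space UNIV {1, 3, 5}" "jordan (?j 1 5) (?l 3) \<in> tree_space UNIV {1, 3, 5}"
    "jordan (?j 1 2) (?l 5) \<in> tree_space UNIV {1, 2, 5}"
    by (rule jordan_closed[OF j(2) leaf_closed] jordan_closed[OF j(3) leaf_closed] jordan_closed[OF j(1) leaf_closed]; auto; fail)+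
  have jj_closed': "jordan (?l 1) (?j 2 5) \<in> tree_space UNIV {1, 2, 5}"
    by (rule jordan_closed[OF leaf_closed j(4)]) auto
  have mj_closed: "mixed (?l 1) (?j 2 5) (?l 4) \<in> tree_space UNIV {1, 2, 4, 5}"
    by (rule mixed_closed[OF leaf_closed j(4) leaf_closed]) auto
  \<comment> \<open>Each of \<open>e1\<close> to \<open>e5\<close> identifies two contractions at
    one of the five one-edge trees, by associativity or by the relation for D.\<close>
  have e1: "decorate_one {1, 2, 3, 4} (jordan (?m 1 3 4) (?l 2)) (?j 1 5) =
      decorate_one {1, 2, 3, 4} (jordan (?m 1 2 4) (?l 3)) (?j 1 5)"
    by (rule decorate_one_eqI[OF sets(5) cards(4) jm_closed(1,2) k1 refl, unfolded mins diffs, OF j(3,3)]) simp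
  have e2: "decorate_one {1, 2, 4} (?m 1 2 4) (jordan (?j 1 3) (?l 5)) =
      decorate_one {1, 2, 4} (?m 1 2 4) (jordan (?j 1 5) (?l 3))"
    by (rule decorate_one_eqI[OF sets(7) cards(2) m(2,2) _ refl, unfolded mins diffs, OF _ jj_closed(1,2) k2]) simp
  have e3: "decorate_one {1, 2, 4, 5} (jordan (?m 1 2 4) (?l 5)) (?j 1 3) =
      decorate_one {1, 2, 4, 5} (mixed (?l 1) (?j 2 5) (?l 4)) (?j 1 3)"
    by (rule decorate_one_eqI[OF sets(6) cards(5) jm_closed(3) mj_closed k3 refl, unfolded mins diffs, OF j(2,2)]) simp
  have e4: "decorate_one {2, 5} (?j 2 5) (jordan (?m 1 3 4) (?l 2)) =
      decorate_one {2, 5} (?j 2 5) (jordan (?m 1 2 4) (?l 3))"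
    by (rule decorate_one_eqI[OF sets(9) cards(3) j(4,4) _ refl, unfolded mins diffs, OF _ jm_closed(1,2) k1]) simp
  have e5: "decorate_one {1, 3, 4} (?m 1 3 4) (jordan (?j 1 2) (?l 5)) =
      decorate_one {1, 3, 4} (?m 1 3 4) (jordan (?l 1) (?j 2 5))"
    by (rule decorate_one_eqI[OF sets(8) cards(1) m(1,1) _ refl, unfolded mins diffs, OF _ jj_closed(3) jj_closed' k5]) simp

  have ne: "{2, 5} \<noteq> {1, 2, 4, 5 :: nat}" "{1, 3, 4} \<noteq> {1, 2, 3, 4 :: nat}" "{1, 2, 4} \<noteq> {1, 2, 3, 4 :: nat}"
    "{1, 2, 4} \<noteq> {1, 2, 4, 5 :: nat}" "{1..5} \<noteq> {2, 5 :: nat}" "{1..5} \<noteq> {1, 2, 4, 5 :: nat}"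
    by (rule less_imp_neq not_sym[OF less_imp_neq], rule sets)+
  have coeff: "coeff [:0, a:] 1 = a" for a :: 'k by (simp add: One_nat_def)
  note ev = evaluate_jordan_leaves evaluate_mixed_leaves coeff
  \<comment> \<open>The first three trees carry D at the inner vertex, which contains the leaf 1 and
    has three leaves; there the cocycle takes the constant part, which is zero.\<close>
  have "wl_cocycle [{1, 3, 4}, {1, 2, 3, 4}] (decorate_two {1, 3, 4} {1, 2, 3, 4} (?m 1 3 4) (?j 1 2) (?j 1 5)) = 0"
    unfolding decorate_two_def wl_cocycle_decorate[OF x1(1,2)]
    by (simp add: cocycle_term_nested_zero[OF sets(1)] cocycle_term_reverse[OF sets(1)] ne ev)
  moreover have "wl_cocycle [{1, 2, 4}, {1, 2, 3, 4}] (decorate_two {1, 2, 4} {1, 2, 3, 4} (?m 1 2 4) (?j 1 3) (?j 1 5)) = 0"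
    unfolding decorate_two_def wl_cocycle_decorate[OF x2(1,2)]
    by (simp add: cocycle_term_nested_zero[OF sets(2)] cocycle_term_reverse[OF sets(2)] ne ev)
  moreover have "wl_cocycle [{1, 2, 4}, {1, 2, 4, 5}] (decorate_two {1, 2, 4} {1, 2, 4, 5} (?m 1 2 4) (?j 1 5) (?j 1 3)) = 0"
    unfolding decorate_two_def wl_cocycle_decorate[OF x3(1,2)]
    by (simp add: cocycle_term_nested_zero[OF sets(3)] cocycle_term_reverse[OF sets(3)] ne ev)
  \<comment> \<open>The root and the cherry {2,5} contribute the constant part 2 each, and D at
    {1,2,4,5} the linear part 8 at frequencies 1.\<close>
  moreover have "wl_cocycle [{2, 5}, {1, 2, 4, 5}] (decorate_two {2, 5} {1, 2, 4, 5} (?j 2 5) (?m 1 2 4) (?j 1 3)) = 2 ^ 5"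
    unfolding decorate_two_def wl_cocycle_decorate[OF x4(1,2)]
    by (simp add: cocycle_term_nested[OF sets(4)] cocycle_term_reverse[OF sets(4)] ne ev)
  moreover have "wl_cocycle [{2, 5}, {1, 3, 4}] (decorate_two {2, 5} {1, 3, 4} (?j 2 5) (?m 1 3 4) (?j 1 2)) = 0"
    unfolding decorate_two_def wl_cocycle_decorate[OF x5(1,2)]
    by (subst cocycle_term_disjoint_zero[OF un(2)]; simp)
  \<comment> \<open>In the alternating sum of the five values every value of \<open>\<psi>\<close>
    occurs twice with opposite signs, which forces the value at \<open>x4\<close> to vanish.\<close>
  ultimately have "(2 :: 'k) ^ 5 = 0"
    using e1 e2 e3 e4 e5
    unfolding eq x1(3) x2(3) x3(3) x4(3) x5(3)
    by (simp add: insert_jordan insert_mixed)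
  then show False using power_not_zero[OF char(1), of 5] by contradiction
qed

theorem theorem1p4:
  assumes "CHAR('k::field) \<noteq> 2" and "CHAR('k) \<noteq> 3"
  shows "isomorphic_operads (quadratic_operad (koszul_dual weak_leibniz))
           (weak_leibniz_operad :: ('k, (('k \<times> 'k, nat) btree \<Rightarrow>\<^sub>0 'k) set set) operad) \<and>
         \<not> koszul (weak_leibniz_operad :: ('k, (('k \<times> 'k, nat) btree \<Rightarrow>\<^sub>0 'k) set set) operad)"
proof
  have char: "(2::'k) \<noteq> 0" "(3::'k) \<noteq> 0"
    using of_nat_prime_neq_zero[of 2, where 'k = 'k] of_nat_prime_neq_zero[of 3, where 'k = 'k] assms by simp_all
  then show "isomorphic_operads (quadratic_operad (koszul_dual weak_leibniz))
      (weak_leibniz_operad :: ('k, (('k \<times> 'k, nat) btree \<Rightarrow>\<^sub>0 'k) set set) operad)"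
    by (rule self_dual)
  show "\<not> koszul (weak_leibniz_operad :: ('k, (('k \<times> 'k, nat) btree \<Rightarrow>\<^sub>0 'k) set set) operad)"
  proof
    let ?\<phi> = "wl_cocycle :: _ \<Rightarrow> (nat set \<Rightarrow> 'k magma_comb set set) \<Rightarrow> 'k"
    assume "koszul (WL :: ('k, 'k magma_comb set set) operad)"
    then have "if (2::nat) = 0 then ?\<phi> = (\<lambda>es x. 0)
         else \<exists>\<psi>\<in>cochains WL 5 (2 - 1). ?\<phi> = coboundary WL 5 (2 - 1) \<psi>"
      unfolding koszul_def using wl_cocycle_cochain wl_cocycle_closed
      by (elim allE[of _ 5] allE[of _ 2] impE ballE[of _ _ ?\<phi>]) auto
    then show False using wl_cocycle_not_coboundary[OF char] by auto
  qed
qed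

end
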